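(* Let $d\ge2$, let $\Omega\subset\mathbb R^d$ be a bounded region with smooth boundary, let $A,V,\sigma$ satisfy the standing assumptions in the context, and suppose $\sigma<0$ on $\partial\Omega$. Let $\lambda_j^{\mathscr R_-}$ be the $j$-th eigenvalue of the magnetic Schrödinger operator $H_{A,V}^{\mathscr R}$ with Robin boundary condition, and suppose $0<\lambda_1^{\mathscr R_-}<\lambda_2^{\mathscr R_-}\le\lambda_3^{\mathscr R_-}\le\cdots$. Then for any $k\in\mathbb N$, $$\lambda_{k+1}^{\mathscr R_-}\le \frac{d+2}{d\,\mathrm{Vol}(\Omega)}\left(\|A\|_{L^2(\Omega)}^2+\|V\|_{L^1(\Omega)}\right)+\mathcal K_{d,k}(\Omega).$$
   Context: $\mathbb N=\{1,2,3,\dots\}$. $H_{A,V}^{\mathscr R}=(D_x-A)^2+V$, $D_x=\frac1i\nabla_x$, is the operator on $L^2(\Omega)$ with Robin boundary condition $(\nabla-iA)u\cdot\mathbf n=-\sigma u$ on $\partial\Omega$ ($\mathbf n$ the outer normal), defined by closing the quadratic form $$q[u]=\|(\nabla-iA)u\|_{L^2(\Omega)}^2+\langle Vu,u\rangle_{L^2(\Omega)}+\int_{\partial\Omega}\sigma(x)|u(x)|^2\,dS$$ on $\{u\in L^2(\Omega):(\nabla-iA)u\in L^2(\Omega)^d,\ V^{1/2}u\in L^2(\Omega)\}$, $dS$ the surface measure. Standing assumptions: $A:\Omega\to\mathbb R^d$ is in $L^2_{\rm loc}(\Omega)^d$; $V:\Omega\to\mathbb R$, $0\le V\in L^1_{\rm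 loc}(\Omega)$; $\sigma\in L^\infty(\partial\Omega)$ is real valued; $(H_{A,V}^{\mathscr R}+1)^{-1}$ is compact on $L^2(\Omega)$. Eigenvalues are enumerated in nondecreasing order, repeated according to multiplicity. $\omega_d$ denotes the volume of the unit ball of $\mathbb R^d$, and $$\mathcal K_{d,k}(\Omega)=(2\pi)^2\left(\frac{d+2}{2}\right)^{2/d}\left(\frac{k}{\omega_d\,\mathrm{Vol}(\Omega)}\right)^{2/d}.$$ Norms may take the value $+\infty$. *)

theory Defs
  imports "HOL-Analysis.Analysis"
begin

section \<open>Smooth functions and domains with smooth boundary\<close>

primrec Ck_on :: "nat \<Rightarrow> (real ^ 'n \<Rightarrow> 'b::real_normed_vector) \<Rightarrow> (real ^ 'n) set \<Rightarrow> bool" where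
  "Ck_on 0 f S \<longleftrightarrow> continuous_on S f"
| "Ck_on (Suc m) f S \<longleftrightarrow> (\<forall>x\<in>S. f differentiable (at x)) \<and>
     (\<forall>i. Ck_on m (\<lambda>x. frechet_derivative f (at x) (axis i 1)) S)"

text \<open>Only used for open \<^term>\<open>S\<close>.\<close>

definition smooth_on :: "(real ^ 'n \<Rightarrow> 'b::real_normed_vector) \<Rightarrow> (real ^ 'n) set \<Rightarrow> bool" where
  "smooth_on f S \<longleftrightarrow> (\<forall>m. Ck_on m f S)"

text \<open>Near each boundary point, after a rotation of the coordinate axes, the set is the region
  strictly above the graph of a smooth function. The unit vector \<^term>\<open>e\<close> is the rotated last axis, and
  \<^term>\<open>x - (x \<bullet> e) *\<^sub>R e\<close> stands for the remaining coordinates of \<^term>\<open>x\<close>.\<close>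

definition smooth_boundary :: "(real ^ 'n) set \<Rightarrow> bool" where
  "smooth_boundary \<Omega> \<longleftrightarrow>
     (\<forall>p\<in>frontier \<Omega>. \<exists>r>0. \<exists>e \<gamma>. norm e = 1 \<and> smooth_on (\<gamma> :: real ^ 'n \<Rightarrow> real) UNIV \<and>
        \<Omega> \<inter> ball p r = {x \<in> ball p r. \<gamma> (x - (x \<bullet> e) *\<^sub>R e) < x \<bullet> e})"

definition test_function :: "(real ^ 'n) set \<Rightarrow> (real ^ 'n \<Rightarrow> real) \<Rightarrow> bool" where
  "test_function \<Omega> \<phi> \<longleftrightarrow> smooth_on \<phi> UNIV \<and>
     compact (closure {x. \<phi> x \<noteq> 0}) \<and> closure {x. \<phi> x \<noteq> 0} \<subseteq> \<Omega>"


section \<open>Surface measure\<close>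

text \<open>Hausdorff measure of integer dimension \<^term>\<open>m \<ge> 1\<close>, normalised so that it agrees with the
  \<^term>\<open>m\<close>-dimensional surface measure on smooth submanifolds. (For \<^term>\<open>m = 0\<close> the
  convention \<^term>\<open>(0::real) ^ 0 = 1\<close> would make empty covering sets count.)\<close>

definition hausdorff_outer :: "nat \<Rightarrow> 'a::euclidean_space set \<Rightarrow> ennreal" where
  "hausdorff_outer m X =
     (SUP \<delta>\<in>{0<..}. INF C\<in>{C. X \<subseteq> (\<Union>i::nat. C i) \<and> (\<forall>i. bounded (C i) \<and> diameter (C i) \<le> \<delta>)}.
        \<Sum>i. ennreal (unit_ball_vol (real m) * (diameter (C i) / 2) ^ m))"

text \<open>The measure is defined on the sets that are measurable in the sense of Caratheodory.\<close>

definition hausdorff_measure :: "nat \<Rightarrow> 'a::euclidean_space measure" where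
  "hausdorff_measure m =
     measure_of UNIV (lambda_system UNIV (Pow UNIV) (hausdorff_outer m)) (hausdorff_outer m)"

definition surface_measure :: "(real ^ 'n) set \<Rightarrow> (real ^ 'n) measure" where
  "surface_measure \<Omega> = restrict_space (hausdorff_measure (CARD('n) - 1)) (frontier \<Omega>)"


section \<open>Lebesgue spaces\<close>

text \<open>Elements of \<open>L\<^sup>2\<close> are represented by functions; equality in \<open>L\<^sup>2\<close> is equality almost everywhere.\<close>

definition L2 :: "'a measure \<Rightarrow> ('a \<Rightarrow> 'b::euclidean_space) set" where
  "L2 M = {f \<in> borel_measurable M. integrable M (\<lambda>x. (norm (f x))\<^sup>2)}"

definition L2_inner :: "'a measure \<Rightarrow> ('a \<Rightarrow> complex) \<Rightarrow> ('a \<Rightarrow> complex) \<Rightarrow> complex" where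
  "L2_inner M f g = (LINT x|M. f x * cnj (g x))"

definition L2_norm2 :: "'a measure \<Rightarrow> ('a \<Rightarrow> 'b::euclidean_space) \<Rightarrow> ennreal" where
  "L2_norm2 M f = (\<integral>\<^sup>+ x. ennreal ((norm (f x))\<^sup>2) \<partial>M)"

definition L1_norm :: "'a measure \<Rightarrow> ('a \<Rightarrow> 'b::euclidean_space) \<Rightarrow> ennreal" where
  "L1_norm M f = (\<integral>\<^sup>+ x. ennreal (norm (f x)) \<partial>M)"

definition L2_tendsto ::
    "'a measure \<Rightarrow> (nat \<Rightarrow> 'a \<Rightarrow> 'b::euclidean_space) \<Rightarrow> ('a \<Rightarrow> 'b) \<Rightarrow> bool" where
  "L2_tendsto M f g \<longleftrightarrow> (\<lambda>n. L2_norm2 M (\<lambda>x. f n x - g x)) \<longlonglongrightarrow> 0"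

definition L1_loc :: "(real ^ 'n) set \<Rightarrow> (real ^ 'n \<Rightarrow> 'b::euclidean_space) set" where
  "L1_loc \<Omega> = {f \<in> borel_measurable (lebesgue_on \<Omega>).
     \<forall>K. compact K \<longrightarrow> K \<subseteq> \<Omega> \<longrightarrow> f absolutely_integrable_on K}"

definition L2_loc :: "(real ^ 'n) set \<Rightarrow> (real ^ 'n \<Rightarrow> 'b::euclidean_space) set" where
  "L2_loc \<Omega> = {f \<in> borel_measurable (lebesgue_on \<Omega>).
     \<forall>K. compact K \<longrightarrow> K \<subseteq> \<Omega> \<longrightarrow> (\<lambda>x. (norm (f x))\<^sup>2) absolutely_integrable_on K}"

definition Linfinity :: "'a measure \<Rightarrow> ('a \<Rightarrow> real) set" where
  "Linfinity M = {f \<in> borel_measurable M. \<exists>C. AE x in M. \<bar>f x\<bar> \<le> C}"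


section \<open>Weak gradients and boundary traces\<close>

definition weak_gradient ::
    "(real ^ 'n) set \<Rightarrow> (real ^ 'n \<Rightarrow> complex) \<Rightarrow> (real ^ 'n \<Rightarrow> complex ^ 'n) \<Rightarrow> bool" where
  "weak_gradient \<Omega> u G \<longleftrightarrow> u \<in> L1_loc \<Omega> \<and> G \<in> L1_loc \<Omega> \<and>
     (\<forall>i \<phi>. test_function \<Omega> \<phi> \<longrightarrow>
        (LINT x|lebesgue_on \<Omega>. u x * of_real (frechet_derivative \<phi> (at x) (axis i 1))) =
        - (LINT x|lebesgue_on \<Omega>. G x $ i * of_real (\<phi> x)))"

text \<open>\<open>G\<close> represents \<open>(\<nabla> - iA)u\<close>, where \<open>\<nabla>u\<close> is taken in the sense of distributions.\<close>

definition magnetic_gradient ::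
    "(real ^ 'n) set \<Rightarrow> (real ^ 'n \<Rightarrow> real ^ 'n) \<Rightarrow>
     (real ^ 'n \<Rightarrow> complex) \<Rightarrow> (real ^ 'n \<Rightarrow> complex ^ 'n) \<Rightarrow> bool" where
  "magnetic_gradient \<Omega> A u G \<longleftrightarrow>
     weak_gradient \<Omega> u (\<lambda>x. \<chi> i. G x $ i + \<i> * of_real (A x $ i) * u x)"

text \<open>\<open>g\<close> is the trace on \<open>\<partial>\<Omega>\<close> of \<open>v \<in> H\<^sup>1(\<Omega>)\<close>: the continuous extension to \<open>H\<^sup>1(\<Omega>)\<close> of the restriction
  map for functions that are smooth up to the boundary.\<close>

definition is_trace ::
    "(real ^ 'n) set \<Rightarrow> (real ^ 'n \<Rightarrow> complex) \<Rightarrow> (real ^ 'n \<Rightarrow> complex) \<Rightarrow> bool" where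
  "is_trace \<Omega> v g \<longleftrightarrow> v \<in> L2 (lebesgue_on \<Omega>) \<and> g \<in> L2 (surface_measure \<Omega>) \<and>
     (\<exists>G. G \<in> L2 (lebesgue_on \<Omega>) \<and> weak_gradient \<Omega> v G \<and>
       (\<exists>w :: nat \<Rightarrow> real ^ 'n \<Rightarrow> complex. (\<forall>n. smooth_on (w n) UNIV) \<and>
          L2_tendsto (lebesgue_on \<Omega>) w v \<and>
          L2_tendsto (lebesgue_on \<Omega>) (\<lambda>n x. \<chi> i. frechet_derivative (w n) (at x) (axis i 1)) G \<and>
          L2_tendsto (surface_measure \<Omega>) w g))"


section \<open>Operators defined by closing a quadratic form\<close>

text \<open>A (partial, linear) operator on \<^term>\<open>L2 M\<close> is represented by its graph.\<close>

type_synonym 'a L2_operator = "(('a \<Rightarrow> complex) \<times> ('a \<Rightarrow> complex)) set"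

definition polar_form :: "(('a \<Rightarrow> complex) \<Rightarrow> real) \<Rightarrow> ('a \<Rightarrow> complex) \<Rightarrow> ('a \<Rightarrow> complex) \<Rightarrow> complex" where
  "polar_form q u v =
     (of_real (q (\<lambda>x. u x + v x)) - of_real (q (\<lambda>x. u x - v x))
      + \<i> * of_real (q (\<lambda>x. u x + \<i> * v x)) - \<i> * of_real (q (\<lambda>x. u x - \<i> * v x))) / 4"

definition quadratic_form_on ::
    "'a measure \<Rightarrow> ('a \<Rightarrow> complex) set \<Rightarrow> (('a \<Rightarrow> complex) \<Rightarrow> real) \<Rightarrow> bool" where
  "quadratic_form_on M D q \<longleftrightarrow>
     D \<subseteq> L2 M \<and> (\<lambda>x. 0) \<in> D \<and>
     (\<forall>u\<in>D. \<forall>v\<in>D. \<forall>a b. (\<lambda>x. a * u x + b * v x) \<in> D) \<and>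
     (\<forall>u\<in>D. polar_form q u u = of_real (q u)) \<and>
     (\<forall>u\<in>D. \<forall>v\<in>D. polar_form q v u = cnj (polar_form q u v)) \<and>
     (\<forall>u\<in>D. \<forall>v\<in>D. \<forall>w\<in>D. \<forall>a b.
        polar_form q (\<lambda>x. a * u x + b * v x) w = a * polar_form q u w + b * polar_form q v w)"

definition form_tendsto ::
    "'a measure \<Rightarrow> ('a \<Rightarrow> complex) set \<Rightarrow> (('a \<Rightarrow> complex) \<Rightarrow> real) \<Rightarrow>
     (nat \<Rightarrow> 'a \<Rightarrow> complex) \<Rightarrow> ('a \<Rightarrow> complex) \<Rightarrow> bool" where
  "form_tendsto M D q u U \<longleftrightarrow> (\<forall>n. u n \<in> D) \<and> U \<in> L2 M \<and> L2_tendsto M u U \<and>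
     (\<forall>\<epsilon>>0. \<exists>N. \<forall>m\<ge>N. \<forall>n\<ge>N. \<bar>q (\<lambda>x. u m x - u n x)\<bar> < \<epsilon>)"

definition dense_in_L2 :: "'a measure \<Rightarrow> ('a \<Rightarrow> complex) set \<Rightarrow> bool" where
  "dense_in_L2 M D \<longleftrightarrow> (\<forall>f\<in>L2 M. \<exists>u. (\<forall>n. u n \<in> D) \<and> L2_tendsto M u f)"

definition semibounded_form ::
    "'a measure \<Rightarrow> ('a \<Rightarrow> complex) set \<Rightarrow> (('a \<Rightarrow> complex) \<Rightarrow> real) \<Rightarrow> bool" where
  "semibounded_form M D q \<longleftrightarrow> (\<exists>c. \<forall>u\<in>D. c * (LINT x|M. (cmod (u x))\<^sup>2) \<le> q u)"

definition closable_form ::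
    "'a measure \<Rightarrow> ('a \<Rightarrow> complex) set \<Rightarrow> (('a \<Rightarrow> complex) \<Rightarrow> real) \<Rightarrow> bool" where
  "closable_form M D q \<longleftrightarrow> (\<forall>u. form_tendsto M D q u (\<lambda>x. 0) \<longrightarrow> (\<lambda>n. q (u n)) \<longlonglongrightarrow> 0)"

definition closure_dom ::
    "'a measure \<Rightarrow> ('a \<Rightarrow> complex) set \<Rightarrow> (('a \<Rightarrow> complex) \<Rightarrow> real) \<Rightarrow> ('a \<Rightarrow> complex) set" where
  "closure_dom M D q = {U. \<exists>u. form_tendsto M D q u U}"

text \<open>The sesquilinear form of the closure of \<open>q\<close> (the limit does not depend on the sequences).\<close>

definition closure_form ::
    "'a measure \<Rightarrow> ('a \<Rightarrow> complex) set \<Rightarrow> (('a \<Rightarrow> complex) \<Rightarrow> real) \<Rightarrow>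
     ('a \<Rightarrow> complex) \<Rightarrow> ('a \<Rightarrow> complex) \<Rightarrow> complex" where
  "closure_form M D q U W =
     (THE z. \<forall>u w. form_tendsto M D q u U \<longrightarrow> form_tendsto M D q w W \<longrightarrow>
        (\<lambda>n. polar_form q (u n) (w n)) \<longlonglongrightarrow> z)"

text \<open>The self-adjoint operator that the representation theorem associates with the closure of a
  densely defined, lower semibounded, closable quadratic form. Other forms have no
  associated operator; they are sent to the empty graph, which has no resolvent.\<close>

definition form_operator ::
    "'a measure \<Rightarrow> ('a \<Rightarrow> complex) set \<Rightarrow> (('a \<Rightarrow> complex) \<Rightarrow> real) \<Rightarrow> 'a L2_operator" where
  "form_operator M D q =
     (if quadratic_form_on M D q \<and> dense_in_L2 M D \<and> semibounded_form M D q \<and> closable_form M D q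
      then {(U, F). U \<in> closure_dom M D q \<and> F \<in> L2 M \<and>
                    (\<forall>W\<in>closure_dom M D q. closure_form M D q U W = L2_inner M F W)}
      else {})"


section \<open>Compact resolvent and enumeration of eigenvalues\<close>

text \<open>\<open>(T + 1)\<^sup>-\<^sup>1\<close> exists as an everywhere defined compact operator. The condition \<open>(T + 1)u = f\<close>
  is expressed by \<open>(u, f - u) \<in> T\<close>.\<close>

definition compact_resolvent :: "'a measure \<Rightarrow> 'a L2_operator \<Rightarrow> bool" where
  "compact_resolvent M T \<longleftrightarrow>
     (\<forall>f\<in>L2 M. \<exists>u. (u, \<lambda>x. f x - u x) \<in> T) \<and>
     (\<forall>u. (u, \<lambda>x. - u x) \<in> T \<longrightarrow> (AE x in M. u x = 0)) \<and>
     (\<forall>f u. (\<forall>n. f n \<in> L2 M \<and> L2_norm2 M (f n) \<le> 1 \<and> (u n, \<lambda>x. f n x - u n x) \<in> T) \<longrightarrow>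
        (\<exists>r h. strict_mono (r :: nat \<Rightarrow> nat) \<and> h \<in> L2 M \<and> L2_tendsto M (u \<circ> r) h))"

definition eigenspace :: "'a L2_operator \<Rightarrow> real \<Rightarrow> ('a \<Rightarrow> complex) set" where
  "eigenspace T \<mu> = {u. (u, \<lambda>x. of_real \<mu> * u x) \<in> T}"

text \<open>\<open>E\<close> has dimension \<open>m\<close> over the complex numbers, when functions that agree almost everywhere are identified.\<close>

definition has_dimension :: "'a measure \<Rightarrow> ('a \<Rightarrow> complex) set \<Rightarrow> nat \<Rightarrow> bool" where
  "has_dimension M E m \<longleftrightarrow> (\<exists>\<phi> :: nat \<Rightarrow> 'a \<Rightarrow> complex.
     (\<forall>i<m. \<phi> i \<in> E) \<and>
     (\<forall>c. (AE x in M. (\<Sum>i<m. c i * \<phi> i x) = 0) \<longrightarrow> (\<forall>i<m. c i = 0)) \<and>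
     (\<forall>u\<in>E. \<exists>c. AE x in M. u x = (\<Sum>i<m. c i * \<phi> i x)))"

text \<open>\<open>ev 1 \<le> ev 2 \<le> \<dots>\<close> lists all eigenvalues, each according to its multiplicity; \<open>ev 0\<close> is irrelevant.\<close>

definition eigenvalue_enumeration :: "'a measure \<Rightarrow> 'a L2_operator \<Rightarrow> (nat \<Rightarrow> real) \<Rightarrow> bool" where
  "eigenvalue_enumeration M T ev \<longleftrightarrow>
     (\<forall>i j. 1 \<le> i \<longrightarrow> i \<le> j \<longrightarrow> ev i \<le> ev j) \<and>
     (\<forall>\<mu>. finite {j. 1 \<le> j \<and> ev j = \<mu>} \<and>
          has_dimension M (eigenspace T \<mu>) (card {j. 1 \<le> j \<and> ev j = \<mu>}))"


section \<open>The magnetic Robin operator\<close>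

definition robin_form_domain ::
    "(real ^ 'n) set \<Rightarrow> (real ^ 'n \<Rightarrow> real ^ 'n) \<Rightarrow> (real ^ 'n \<Rightarrow> real) \<Rightarrow> (real ^ 'n \<Rightarrow> complex) set" where
  "robin_form_domain \<Omega> A V =
     {u. u \<in> L2 (lebesgue_on \<Omega>) \<and>
         (\<exists>G. magnetic_gradient \<Omega> A u G \<and> G \<in> L2 (lebesgue_on \<Omega>)) \<and>
         (\<lambda>x. of_real (sqrt (V x)) * u x) \<in> L2 (lebesgue_on \<Omega>)}"

text \<open>For \<open>u\<close> in the form domain with \<open>A\<close> only locally square integrable, \<open>u\<close> itself need not have a trace, but
  \<open>\<bar>u\<bar> \<in> H\<^sup>1(\<Omega>)\<close> by the diamagnetic inequality. Hence \<open>\<bar>u\<bar>\<close> on \<open>\<partial>\<Omega>\<close> is the trace of \<open>\<bar>u\<bar>\<close>. Both choices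
  below are unique up to null sets.\<close>

definition robin_form ::
    "(real ^ 'n) set \<Rightarrow> (real ^ 'n \<Rightarrow> real ^ 'n) \<Rightarrow> (real ^ 'n \<Rightarrow> real) \<Rightarrow> (real ^ 'n \<Rightarrow> real) \<Rightarrow>
     (real ^ 'n \<Rightarrow> complex) \<Rightarrow> real" where
  "robin_form \<Omega> A V \<sigma> u =
     (let G = (SOME G. magnetic_gradient \<Omega> A u G);
          g = (SOME g. is_trace \<Omega> (\<lambda>x. of_real (cmod (u x))) g)
      in (LINT x|lebesgue_on \<Omega>. (norm (G x))\<^sup>2)
         + (LINT x|lebesgue_on \<Omega>. V x * (cmod (u x))\<^sup>2)
         + (LINT x|surface_measure \<Omega>. \<sigma> x * (cmod (g x))\<^sup>2))"

definition robin_operator ::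
    "(real ^ 'n) set \<Rightarrow> (real ^ 'n \<Rightarrow> real ^ 'n) \<Rightarrow> (real ^ 'n \<Rightarrow> real) \<Rightarrow> (real ^ 'n \<Rightarrow> real) \<Rightarrow>
     (real ^ 'n) L2_operator" where
  "robin_operator \<Omega> A V \<sigma> =
     form_operator (lebesgue_on \<Omega>) (robin_form_domain \<Omega> A V) (robin_form \<Omega> A V \<sigma>)"

definition kroeger_const :: "(real ^ 'n) set \<Rightarrow> nat \<Rightarrow> real" where
  "kroeger_const \<Omega> k =
     (let d = real CARD('n); \<omega> = measure lebesgue (ball (0 :: real ^ 'n) 1)
      in (2 * pi)\<^sup>2 * ((d + 2) / 2) powr (2 / d) * (real k / (\<omega> * measure lebesgue \<Omega>)) powr (2 / d))"

end

theory Submission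
  imports Defs "HOL-Computational_Algebra.Polynomial" "HOL-Probability.Characteristic_Functions"
begin

text \<open>
  The proof is Kroeger's averaging argument with the plane waves
  \<open>e\<^sub>\<xi>(x) = exp(i \<xi> \<bullet> x)\<close> as trial functions. Put \<open>\<lambda> = \<lambda>\<^sub>k\<^sub>+\<^sub>1\<close>, and let \<open>N\<close> be the span of the
  eigenspaces for the eigenvalues below \<open>\<lambda>\<close>; its dimension is at most \<open>k\<close>. The closed form is at
  least \<open>\<lambda>\<close> on the orthogonal complement of \<open>N\<close>, it is nonnegative on \<open>N\<close> because \<open>\<lambda>\<^sub>1 > 0\<close>, and it has
  no mixed terms because \<open>N\<close> is invariant under the operator. For an orthonormal basis
  \<open>u\<^sub>j\<close> of \<open>N\<close> this gives, with \<open>q\<close> the quadratic form,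
  \<open>\<lambda> (\<parallel>e\<parallel>\<^sup>2 - \<Sum>\<^sub>j \<bar>\<langle>e, u\<^sub>j\<rangle>\<bar>\<^sup>2) \<le> q(e)\<close> for every \<open>e\<close> in the form domain
  (\<open>kroeger_variational_bound\<close>).

  For \<open>e = e\<^sub>\<xi>\<close> the left side contains \<open>\<parallel>e\<^sub>\<xi>\<parallel>\<^sup>2 = Vol \<Omega>\<close> and the Fourier transforms of the \<open>u\<^sub>j\<close>. On
  the right side the boundary term is nonpositive because \<open>\<sigma> < 0\<close>, so that
  \<open>q(e\<^sub>\<xi>) \<le> \<bar>\<xi>\<bar>\<^sup>2 Vol \<Omega> - 2 \<xi> \<bullet> \<integral>A + \<parallel>A\<parallel>\<^sup>2 + \<parallel>V\<parallel>\<^sub>1\<close> (\<open>robin_form_plane_wave_le\<close>). Now integrate over the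
  ball \<open>\<bar>\<xi>\<bar> < r\<close>: the linear term cancels by symmetry, the second moment of the ball is explicit
  (\<open>ball_second_moment\<close>), and each \<open>\<bar>\<langle>e\<^sub>\<xi>, u\<^sub>j\<rangle>\<bar>\<^sup>2\<close> integrates to at most \<open>(2\<pi>)\<^sup>d\<close>
  (\<open>plane_wave_bessel\<close>). A suitable \<open>r\<close> turns the result into the claim, with \<open>r\<^sup>2\<close> equal to the
  constant \<open>K\<^sub>d\<^sub>,\<^sub>k\<close> (\<open>kroeger_averaging\<close>). If one of the norms is infinite, there is nothing to prove.

  Three ingredients carry the weight. The operator is known only through the compactness of its
  resolvent \<open>R = (H + 1)\<^bsup>-1\<^esup>\<close> and through its eigenspaces. The bound on the orthogonal complement of
  \<open>N\<close> therefore starts from the maximum principle for compact symmetric operators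
  (\<open>numerical_range_bound\<close>), which bounds \<open>R\<close>, and is then carried over from \<open>R\<close> to the form
  (\<open>shifted_form_nonneg\<close>, \<open>form_lower_bound\<close>). The form uses an unspecified weak gradient, so its value
  at a plane wave is known only once weak gradients are unique (\<open>weak_gradient_unique\<close>); this
  requires enough smooth test functions. The inequality for Fourier transforms is proved
  with a Gaussian weight, whose Fourier transform is a nonnegative kernel of total mass \<open>(2\<pi>)\<^sup>d\<close>.
\<close>

section \<open>Spaces of functions with a semi-inner product\<close>

lemma lin_closed_sum:
  fixes W :: "('a \<Rightarrow> complex) set"
  assumes zero: "(\<lambda>x. 0) \<in> W"
    and lin: "\<And>f g a b. f \<in> W \<Longrightarrow> g \<in> W \<Longrightarrow> (\<lambda>x. a * f x + b * g x) \<in> W"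
    and X: "finite X" "X \<subseteq> W"
  shows "(\<lambda>x. \<Sum>u\<in>X. c u * u x) \<in> W"
  using X
proof (induction X rule: finite_induct)
  case (insert y X)
  then have "(\<lambda>x. c y * y x + 1 * (\<Sum>u\<in>X. c u * u x)) \<in> W" by (intro lin) auto
  with insert.hyps show ?case by simp
qed (simp add: zero)

text \<open>Null vectors are not divided out, since elements of \<open>L\<^sup>2\<close> are represented by functions.
  Besides \<open>L\<^sup>2\<close> itself, the instances are a form domain with the shifted polar form and a domain of a
  positive symmetric operator \<open>S\<close> with \<open>\<langle>S f, g\<rangle>\<close>; Cauchy-Schwarz is used in all three.\<close>

locale semi_inner_space =
  fixes H :: "('a \<Rightarrow> complex) set" and ip :: "('a \<Rightarrow> complex) \<Rightarrow> ('a \<Rightarrow> complex) \<Rightarrow> complex"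
  assumes zero_mem: "(\<lambda>x. 0) \<in> H"
    and lin_mem: "f \<in> H \<Longrightarrow> g \<in> H \<Longrightarrow> (\<lambda>x. a * f x + b * g x) \<in> H"
    and ip_lin: "f \<in> H \<Longrightarrow> g \<in> H \<Longrightarrow> h \<in> H \<Longrightarrow> ip (\<lambda>x. a * f x + b * g x) h = a * ip f h + b * ip g h"
    and ip_cnj: "f \<in> H \<Longrightarrow> g \<in> H \<Longrightarrow> ip g f = cnj (ip f g)"
    and ip_nonneg: "f \<in> H \<Longrightarrow> 0 \<le> Re (ip f f)"
begin

definition nsq :: "('a \<Rightarrow> complex) \<Rightarrow> real" where "nsq f = Re (ip f f)"

lemma nsq_nonneg [simp]: "f \<in> H \<Longrightarrow> 0 \<le> nsq f"
  by (simp add: nsq_def ip_nonneg)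

lemma ip_self: "f \<in> H \<Longrightarrow> ip f f = of_real (nsq f)"
  using ip_cnj[of f f] by (simp add: nsq_def complex_eq_iff)

lemma scale_mem: "f \<in> H \<Longrightarrow> (\<lambda>x. a * f x) \<in> H"
  using lin_mem[of f f a 0] by simp

lemma add_mem: "f \<in> H \<Longrightarrow> g \<in> H \<Longrightarrow> (\<lambda>x. f x + g x) \<in> H"
  using lin_mem[of f g 1 1] by simp

lemma diff_mem: "f \<in> H \<Longrightarrow> g \<in> H \<Longrightarrow> (\<lambda>x. f x - g x) \<in> H"
  using lin_mem[of f g 1 "-1"] by simp

lemma ip_scale: "f \<in> H \<Longrightarrow> h \<in> H \<Longrightarrow> ip (\<lambda>x. a * f x) h = a * ip f h"
  using ip_lin[of f f h a 0] by simp

lemma ip_add: "f \<in> H \<Longrightarrow> g \<in> H \<Longrightarrow> h \<in> H \<Longrightarrow> ip (\<lambda>x. f x + g x) h = ip f h + ip g h"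
  using ip_lin[of f g h 1 1] by simp

lemma ip_diff: "f \<in> H \<Longrightarrow> g \<in> H \<Longrightarrow> h \<in> H \<Longrightarrow> ip (\<lambda>x. f x - g x) h = ip f h - ip g h"
  using ip_lin[of f g h 1 "-1"] by simp

lemma ip_lin_right: "f \<in> H \<Longrightarrow> g \<in> H \<Longrightarrow> h \<in> H \<Longrightarrow>
    ip h (\<lambda>x. a * f x + b * g x) = cnj a * ip h f + cnj b * ip h g"
  using ip_cnj[of "\<lambda>x. a * f x + b * g x" h] ip_cnj[of f h] ip_cnj[of g h]
  by (simp add: ip_lin lin_mem)

lemma ip_scale_right: "f \<in> H \<Longrightarrow> h \<in> H \<Longrightarrow> ip h (\<lambda>x. a * f x) = cnj a * ip h f"
  using ip_lin_right[of f f h a 0] by simp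

lemma ip_add_right: "f \<in> H \<Longrightarrow> g \<in> H \<Longrightarrow> h \<in> H \<Longrightarrow> ip h (\<lambda>x. f x + g x) = ip h f + ip h g"
  using ip_lin_right[of f g h 1 1] by simp

lemma ip_diff_right: "f \<in> H \<Longrightarrow> g \<in> H \<Longrightarrow> h \<in> H \<Longrightarrow> ip h (\<lambda>x. f x - g x) = ip h f - ip h g"
  using ip_lin_right[of f g h 1 "-1"] by simp

lemmas ip_simps = ip_scale ip_add ip_diff ip_scale_right ip_add_right ip_diff_right
  scale_mem add_mem diff_mem zero_mem

lemma sum_mem: "(\<And>i. i \<in> I \<Longrightarrow> f i \<in> H) \<Longrightarrow> (\<lambda>x. \<Sum>i\<in>I. c i * f i x) \<in> H"
  by (induction I rule: infinite_finite_induct) (simp_all add: ip_simps)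

lemma ip_zero [simp]: "h \<in> H \<Longrightarrow> ip (\<lambda>x. 0) h = 0"
  using ip_scale[of "\<lambda>x. 0" h 0] zero_mem by simp

lemma ip_zero_right [simp]: "h \<in> H \<Longrightarrow> ip h (\<lambda>x. 0) = 0"
  using ip_cnj[OF zero_mem, of h] by simp

lemma ip_sum: "(\<And>i. i \<in> I \<Longrightarrow> f i \<in> H) \<Longrightarrow> h \<in> H \<Longrightarrow>
    ip (\<lambda>x. \<Sum>i\<in>I. c i * f i x) h = (\<Sum>i\<in>I. c i * ip (f i) h)"
  by (induction I rule: infinite_finite_induct) (simp_all add: ip_simps sum_mem)

lemma ip_sum_right: "(\<And>i. i \<in> I \<Longrightarrow> f i \<in> H) \<Longrightarrow> h \<in> H \<Longrightarrow>
    ip h (\<lambda>x. \<Sum>i\<in>I. c i * f i x) = (\<Sum>i\<in>I. cnj (c i) * ip h (f i))"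
  by (induction I rule: infinite_finite_induct) (simp_all add: ip_simps sum_mem)

lemma nsq_scale: "f \<in> H \<Longrightarrow> nsq (\<lambda>x. a * f x) = (cmod a)\<^sup>2 * nsq f"
proof -
  assume f: "f \<in> H"
  have "ip (\<lambda>x. a * f x) (\<lambda>x. a * f x) = (a * cnj a) * ip f f"
    using f by (simp add: ip_simps)
  also have "\<dots> = of_real ((cmod a)\<^sup>2 * nsq f)"
    using f by (simp only: ip_self complex_norm_square of_real_mult)
  finally show ?thesis by (simp add: nsq_def)
qed

lemma nsq_add: "f \<in> H \<Longrightarrow> g \<in> H \<Longrightarrow> nsq (\<lambda>x. f x + g x) = nsq f + 2 * Re (ip f g) + nsq g"
  using ip_cnj[of f g] by (simp add: nsq_def ip_simps)

lemma nsq_diff: "f \<in> H \<Longrightarrow> g \<in> H \<Longrightarrow> nsq (\<lambda>x. f x - g x) = nsq f - 2 * Re (ip f g) + nsq g"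
  using ip_cnj[of f g] by (simp add: nsq_def ip_simps)

lemma nsq_diff_swap: "f \<in> H \<Longrightarrow> g \<in> H \<Longrightarrow> nsq (\<lambda>x. f x - g x) = nsq (\<lambda>x. g x - f x)"
  using ip_cnj[of f g] by (simp add: nsq_diff)

lemma nsq_add_le: "f \<in> H \<Longrightarrow> g \<in> H \<Longrightarrow> nsq (\<lambda>x. f x + g x) \<le> 2 * nsq f + 2 * nsq g"
  using nsq_add[of f g] nsq_diff[of f g] nsq_nonneg[of "\<lambda>x. f x - g x"] by (simp add: diff_mem)

lemma nsq_triangle: "f \<in> H \<Longrightarrow> g \<in> H \<Longrightarrow> h \<in> H \<Longrightarrow>
    nsq (\<lambda>x. f x - h x) \<le> 2 * nsq (\<lambda>x. f x - g x) + 2 * nsq (\<lambda>x. g x - h x)"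
  using nsq_add_le[of "\<lambda>x. f x - g x" "\<lambda>x. g x - h x"] by (simp add: diff_mem)

text \<open>The discriminant argument: \<open>nsq (f - t \<langle>f, g\<rangle> g) \<ge> 0\<close> for all real \<open>t\<close>. If \<open>g\<close> is a null vector,
  the left side is affine in \<open>t\<close>, and its slope must vanish.\<close>

lemma cauchy_schwarz: assumes f: "f \<in> H" and g: "g \<in> H"
  shows "(cmod (ip f g))\<^sup>2 \<le> nsq f * nsq g"
proof -
  define z where "z = ip f g"
  have key: "0 \<le> nsq f - 2 * t * (cmod z)\<^sup>2 + t\<^sup>2 * (cmod z)\<^sup>2 * nsq g" for t :: real
  proof -
    have "0 \<le> nsq (\<lambda>x. f x - (of_real t * z) * g x)"
      using f g by (intro nsq_nonneg) (simp add: ip_simps)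
    also have "\<dots> = nsq f - 2 * Re (cnj (of_real t * z) * z) + (cmod (of_real t * z))\<^sup>2 * nsq g"
      using f g by (simp add: nsq_diff ip_simps nsq_scale z_def)
    also have "Re (cnj (of_real t * z) * z) = t * (cmod z)\<^sup>2"
      by (simp add: cmod_power2) (simp add: power2_eq_square algebra_simps)
    finally show ?thesis by (simp add: norm_mult power_mult_distrib)
  qed
  have nf: "0 \<le> nsq f" and ng: "0 \<le> nsq g" using f g by auto
  show ?thesis
  proof (cases "nsq g = 0")
    case True
    have "(cmod z)\<^sup>2 = 0"
    proof (rule ccontr)
      assume "(cmod z)\<^sup>2 \<noteq> 0"
      then have pos: "(cmod z)\<^sup>2 > 0" by simp
      have "2 * ((nsq f + 1) / (2 * (cmod z)\<^sup>2)) * (cmod z)\<^sup>2 = nsq f + 1"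
        using pos by (simp add: field_simps)
      with key[of "(nsq f + 1) / (2 * (cmod z)\<^sup>2)"] True show False by simp
    qed
    then show ?thesis using True by (simp add: z_def)
  next
    case False
    then have ng: "nsq g > 0" using ng by simp
    have "2 * (1 / nsq g) * (cmod z)\<^sup>2 - (1 / nsq g)\<^sup>2 * (cmod z)\<^sup>2 * nsq g = (cmod z)\<^sup>2 / nsq g"
      using ng by (simp add: field_simps power2_eq_square)
    then have "(cmod z)\<^sup>2 / nsq g \<le> nsq f" using key[of "1 / nsq g"] by simp
    then show ?thesis using ng by (simp add: z_def field_simps)
  qed
qed

lemma cmod_ip_le: "f \<in> H \<Longrightarrow> g \<in> H \<Longrightarrow> cmod (ip f g) \<le> sqrt (nsq f) * sqrt (nsq g)"
  using cauchy_schwarz[of f g] by (metis real_le_rsqrt real_sqrt_mult)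

lemma ip_null: "f \<in> H \<Longrightarrow> g \<in> H \<Longrightarrow> nsq f = 0 \<Longrightarrow> ip f g = 0"
  using cauchy_schwarz[of f g] by simp

lemma ip_null_right: "f \<in> H \<Longrightarrow> g \<in> H \<Longrightarrow> nsq g = 0 \<Longrightarrow> ip f g = 0"
  using cauchy_schwarz[of f g] by simp

text \<open>In this form the statement also covers sequences that converge to nothing in the space, such
  as two approximating sequences of an element of the closure of a form.\<close>

lemma ip_tendsto_cong:
  assumes u: "\<And>n. u n \<in> H" "\<And>n. u' n \<in> H" and w: "\<And>n. w n \<in> H" "\<And>n. w' n \<in> H"
    and du: "(\<lambda>n. nsq (\<lambda>x. u n x - u' n x)) \<longlonglongrightarrow> 0"
    and dw: "(\<lambda>n. nsq (\<lambda>x. w n x - w' n x)) \<longlonglongrightarrow> 0"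
    and bu: "\<And>n. nsq (u' n) \<le> C" and bw: "\<And>n. nsq (w' n) \<le> C"
  shows "(\<lambda>n. ip (u n) (w n) - ip (u' n) (w' n)) \<longlonglongrightarrow> 0"
proof (rule Lim_null_comparison)
  let ?a = "\<lambda>n. nsq (\<lambda>x. u n x - u' n x)" and ?b = "\<lambda>n. nsq (\<lambda>x. w n x - w' n x)"
  have "cmod (ip (u n) (w n) - ip (u' n) (w' n)) \<le>
     sqrt (?a n) * sqrt (?b n) + sqrt (?a n) * sqrt C + sqrt C * sqrt (?b n)" for n
  proof -
    let ?p = "\<lambda>x. u n x - u' n x" and ?q = "\<lambda>x. w n x - w' n x"
    have pq: "?p \<in> H" "?q \<in> H" using u w by (auto simp: diff_mem)
    have "ip (u n) (w n) - ip (u' n) (w' n) = ip ?p ?q + ip ?p (w' n) + ip (u' n) ?q"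
      using u w by (simp add: ip_simps)
    then have "cmod (ip (u n) (w n) - ip (u' n) (w' n)) = cmod (ip ?p ?q + ip ?p (w' n) + ip (u' n) ?q)"
      by (rule arg_cong)
    also have "\<dots> \<le> cmod (ip ?p ?q) + cmod (ip ?p (w' n)) + cmod (ip (u' n) ?q)"
      by (rule order_trans[OF norm_triangle_ineq add_right_mono[OF norm_triangle_ineq]])
    also have "\<dots> \<le> sqrt (?a n) * sqrt (?b n) + sqrt (?a n) * sqrt C + sqrt C * sqrt (?b n)"
    proof (intro add_mono)
      show "cmod (ip ?p ?q) \<le> sqrt (?a n) * sqrt (?b n)" by (rule cmod_ip_le[OF pq])
      show "cmod (ip ?p (w' n)) \<le> sqrt (?a n) * sqrt C"
        by (rule order_trans[OF cmod_ip_le[OF pq(1) w(2)]])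
          (intro mult_left_mono real_sqrt_le_mono bw real_sqrt_ge_zero nsq_nonneg pq(1))
      show "cmod (ip (u' n) ?q) \<le> sqrt C * sqrt (?b n)"
        by (rule order_trans[OF cmod_ip_le[OF u(2) pq(2)]])
          (intro mult_right_mono real_sqrt_le_mono bu real_sqrt_ge_zero nsq_nonneg pq(2))
    qed
    finally show ?thesis .
  qed
  then show "\<forall>\<^sub>F n in sequentially. cmod (ip (u n) (w n) - ip (u' n) (w' n)) \<le>
     sqrt (?a n) * sqrt (?b n) + sqrt (?a n) * sqrt C + sqrt C * sqrt (?b n)" by simp
  have "(\<lambda>n. sqrt (?a n) * sqrt (?b n) + sqrt (?a n) * sqrt C + sqrt C * sqrt (?b n)) \<longlonglongrightarrow>
     sqrt 0 * sqrt 0 + sqrt 0 * sqrt C + sqrt C * sqrt 0"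
    by (intro tendsto_intros du dw)
  then show "(\<lambda>n. sqrt (?a n) * sqrt (?b n) + sqrt (?a n) * sqrt C + sqrt C * sqrt (?b n)) \<longlonglongrightarrow> 0"
    by simp
qed

lemma ip_tendsto:
  assumes "\<And>n. u n \<in> H" "U \<in> H" "\<And>n. w n \<in> H" "W \<in> H"
    and "(\<lambda>n. nsq (\<lambda>x. u n x - U x)) \<longlonglongrightarrow> 0" "(\<lambda>n. nsq (\<lambda>x. w n x - W x)) \<longlonglongrightarrow> 0"
  shows "(\<lambda>n. ip (u n) (w n)) \<longlonglongrightarrow> ip U W"
  using ip_tendsto_cong[of u "\<lambda>_. U" w "\<lambda>_. W" "max (nsq U) (nsq W)"] assms
  by (simp add: LIM_zero_iff)

lemma nsq_tendsto_trans:
  assumes "\<And>n. u n \<in> H" "\<And>n. v n \<in> H" "\<And>n. w n \<in> H"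
    and "(\<lambda>n. nsq (\<lambda>x. u n x - v n x)) \<longlonglongrightarrow> 0" "(\<lambda>n. nsq (\<lambda>x. v n x - w n x)) \<longlonglongrightarrow> 0"
  shows "(\<lambda>n. nsq (\<lambda>x. u n x - w n x)) \<longlonglongrightarrow> 0"
proof (rule tendsto_sandwich[OF _ _ tendsto_const])
  show "(\<lambda>n. 2 * nsq (\<lambda>x. u n x - v n x) + 2 * nsq (\<lambda>x. v n x - w n x)) \<longlonglongrightarrow> 0"
    using tendsto_add[OF tendsto_mult_left[OF assms(4), of 2] tendsto_mult_left[OF assms(5), of 2]] by simp
  show "\<forall>\<^sub>F n in sequentially. nsq (\<lambda>x. u n x - w n x)
      \<le> 2 * nsq (\<lambda>x. u n x - v n x) + 2 * nsq (\<lambda>x. v n x - w n x)"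
    using assms nsq_triangle by simp
qed (use assms in \<open>simp add: diff_mem\<close>)

lemma nsq_tendsto:
  assumes "\<And>n. u n \<in> H" "U \<in> H" "(\<lambda>n. nsq (\<lambda>x. u n x - U x)) \<longlonglongrightarrow> 0"
  shows "(\<lambda>n. nsq (u n)) \<longlonglongrightarrow> nsq U"
  unfolding nsq_def using ip_tendsto[of u U u U] assms by (auto intro: tendsto_Re)

definition cauchy_seq :: "(nat \<Rightarrow> 'a \<Rightarrow> complex) \<Rightarrow> bool" where
  "cauchy_seq u \<longleftrightarrow> (\<forall>\<epsilon>>0. \<exists>N. \<forall>m\<ge>N. \<forall>n\<ge>N. nsq (\<lambda>x. u m x - u n x) < \<epsilon>)"

lemma tendsto_imp_cauchy_seq:
  assumes "\<And>n. u n \<in> H" "U \<in> H" "(\<lambda>n. nsq (\<lambda>x. u n x - U x)) \<longlonglongrightarrow> 0"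
  shows "cauchy_seq u"
  unfolding cauchy_seq_def
proof (intro allI impI)
  fix e :: real assume "e > 0"
  then have "\<forall>\<^sub>F n in sequentially. nsq (\<lambda>x. u n x - U x) < e / 4"
    using assms(3) by (intro order_tendstoD(2)[OF assms(3)]) simp
  then obtain N where N: "\<And>n. n \<ge> N \<Longrightarrow> nsq (\<lambda>x. u n x - U x) < e / 4"
    by (auto simp: eventually_sequentially)
  have "nsq (\<lambda>x. u m x - u n x) < e" if "m \<ge> N" "n \<ge> N" for m n
    using nsq_triangle[of "u m" U "u n"] N[OF that(1)] N[OF that(2)] nsq_diff_swap[of U "u n"] assms
    by simp
  then show "\<exists>N. \<forall>m\<ge>N. \<forall>n\<ge>N. nsq (\<lambda>x. u m x - u n x) < e" by blast
qed

lemma cauchy_seq_lin: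
  assumes u: "\<And>n. u n \<in> H" "cauchy_seq u" and v: "\<And>n. v n \<in> H" "cauchy_seq v"
  shows "cauchy_seq (\<lambda>n x. a * u n x + b * v n x)"
  unfolding cauchy_seq_def
proof (intro allI impI)
  fix e :: real assume e: "e > 0"
  define K where "K = 2 * (cmod a)\<^sup>2 + 2 * (cmod b)\<^sup>2 + 1"
  have K: "K > 0" unfolding K_def by (simp add: add_nonneg_pos)
  obtain N1 where N1: "\<And>m n. m \<ge> N1 \<Longrightarrow> n \<ge> N1 \<Longrightarrow> nsq (\<lambda>x. u m x - u n x) < e / K"
    using u(2) e K unfolding cauchy_seq_def by (metis divide_pos_pos)
  obtain N2 where N2: "\<And>m n. m \<ge> N2 \<Longrightarrow> n \<ge> N2 \<Longrightarrow> nsq (\<lambda>x. v m x - v n x) < e / K"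
    using v(2) e K unfolding cauchy_seq_def by (metis divide_pos_pos)
  have "nsq (\<lambda>x. (a * u m x + b * v m x) - (a * u n x + b * v n x)) < e"
    if mn: "m \<ge> max N1 N2" "n \<ge> max N1 N2" for m n
  proof -
    let ?p = "\<lambda>x. u m x - u n x" and ?q = "\<lambda>x. v m x - v n x"
    have pq: "?p \<in> H" "?q \<in> H" using u v by (auto simp: diff_mem)
    have "nsq (\<lambda>x. (a * u m x + b * v m x) - (a * u n x + b * v n x)) = nsq (\<lambda>x. a * ?p x + b * ?q x)"
      by (rule arg_cong[of _ _ nsq]) (auto simp: algebra_simps)
    also have "\<dots> \<le> 2 * nsq (\<lambda>x. a * ?p x) + 2 * nsq (\<lambda>x. b * ?q x)"
      using pq by (intro nsq_add_le) (simp_all add: scale_mem)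
    also have "\<dots> = 2 * (cmod a)\<^sup>2 * nsq ?p + 2 * (cmod b)\<^sup>2 * nsq ?q"
      using pq by (simp add: nsq_scale)
    also have "\<dots> \<le> 2 * (cmod a)\<^sup>2 * (e / K) + 2 * (cmod b)\<^sup>2 * (e / K)"
      using N1[of m n] N2[of m n] mn by (intro add_mono mult_left_mono) auto
    also have "\<dots> = (K - 1) * (e / K)"
      unfolding distrib_right[symmetric] by (simp add: K_def)
    also have "\<dots> < e" using e K by (simp add: field_simps)
    finally show ?thesis .
  qed
  then show "\<exists>N. \<forall>m\<ge>N. \<forall>n\<ge>N. nsq (\<lambda>x. (a * u m x + b * v m x) - (a * u n x + b * v n x)) < e"
    by blast
qed

lemma cauchy_seq_bounded:
  assumes u: "\<And>n. u n \<in> H" "cauchy_seq u"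
  shows "\<exists>C. \<forall>n. nsq (u n) \<le> C"
proof -
  obtain N where N: "\<And>m n. m \<ge> N \<Longrightarrow> n \<ge> N \<Longrightarrow> nsq (\<lambda>x. u m x - u n x) < 1"
    using u(2) unfolding cauchy_seq_def by (metis zero_less_one)
  define C where "C = Max ((\<lambda>n. nsq (u n)) ` {..N})"
  have C: "nsq (u n) \<le> C" if "n \<le> N" for n using that by (auto simp: C_def)
  have "nsq (u n) \<le> max C (2 + 2 * C)" for n
  proof (cases "n \<le> N")
    case False
    then have "nsq (\<lambda>x. (u n x - u N x) + u N x) \<le> 2 * nsq (\<lambda>x. u n x - u N x) + 2 * nsq (u N)"
      using u by (intro nsq_add_le) (auto simp: diff_mem)
    with N[of n N] C[of N] False show ?thesis by simp
  qed (use C in \<open>auto intro: max.coboundedI1\<close>)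
  then show ?thesis by blast
qed

lemma ip_cauchy:
  assumes u: "\<And>n. u n \<in> H" "cauchy_seq u" and w: "\<And>n. w n \<in> H" "cauchy_seq w"
  shows "convergent (\<lambda>n. ip (u n) (w n))"
proof -
  obtain C1 C2 where C: "\<And>n. nsq (u n) \<le> C1" "\<And>n. nsq (w n) \<le> C2"
    using cauchy_seq_bounded[of u] cauchy_seq_bounded[of w] u w by auto
  define B where "B = sqrt C1 + sqrt C2 + 1"
  have C12: "0 \<le> C1" "0 \<le> C2" using C(1)[of 0] C(2)[of 0] u(1)[of 0] w(1)[of 0] nsq_nonneg order_trans by blast+
  have B: "B > 0" using C12 by (simp add: B_def add_nonneg_pos)
  have "Cauchy (\<lambda>n. ip (u n) (w n))"
  proof (rule CauchyI)
    fix e :: real assume e: "e > 0"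
    define d where "d = (e / B)\<^sup>2"
    have d: "d > 0" using e B by (simp add: d_def)
    obtain N1 where N1: "\<And>m n. m \<ge> N1 \<Longrightarrow> n \<ge> N1 \<Longrightarrow> nsq (\<lambda>x. u m x - u n x) < d"
      using u(2) d unfolding cauchy_seq_def by metis
    obtain N2 where N2: "\<And>m n. m \<ge> N2 \<Longrightarrow> n \<ge> N2 \<Longrightarrow> nsq (\<lambda>x. w m x - w n x) < d"
      using w(2) d unfolding cauchy_seq_def by metis
    have "cmod (ip (u m) (w m) - ip (u n) (w n)) < e" if mn: "m \<ge> max N1 N2" "n \<ge> max N1 N2" for m n
    proof -
      let ?p = "\<lambda>x. u m x - u n x" and ?q = "\<lambda>x. w m x - w n x"
      have pq: "?p \<in> H" "?q \<in> H" using u w by (auto simp: diff_mem)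
      have sd: "sqrt d = e / B" using e B by (simp add: d_def)
      have "ip (u m) (w m) - ip (u n) (w n) = ip ?p (w m) + ip (u n) ?q"
        using u w by (simp add: ip_simps)
      also have "cmod \<dots> \<le> cmod (ip ?p (w m)) + cmod (ip (u n) ?q)" by (rule norm_triangle_ineq)
      also have "\<dots> \<le> sqrt (nsq ?p) * sqrt (nsq (w m)) + sqrt (nsq (u n)) * sqrt (nsq ?q)"
        using cmod_ip_le pq u w by (intro add_mono) auto
      also have "\<dots> \<le> sqrt d * sqrt C2 + sqrt C1 * sqrt d"
        using N1[of m n] N2[of m n] mn C pq u w C12 d
        by (intro add_mono mult_mono real_sqrt_le_mono) (auto intro: less_imp_le)
      also have "\<dots> = (sqrt C1 + sqrt C2) * sqrt d" by (simp add: algebra_simps)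
      also have "\<dots> = (B - 1) * (e / B)" unfolding sd by (simp add: B_def)
      also have "\<dots> < e" using e B by (simp add: field_simps)
      finally show ?thesis .
    qed
    then show "\<exists>M. \<forall>m\<ge>M. \<forall>n\<ge>M. cmod (ip (u m) (w m) - ip (u n) (w n)) < e" by blast
  qed
  then show ?thesis by (rule Cauchy_convergent)
qed

end

section \<open>Compact symmetric operators\<close>

context semi_inner_space
begin

text \<open>The basis is built inside an arbitrary class \<open>W\<close> that is closed under linear combinations, so
  that it inherits every linear property of the generators, in particular that of spanning
  an invariant subspace. Generators that are null after projection are dropped; the last
  clause says that the span is still the same up to null vectors.\<close>

lemma gram_schmidt:
  assumes B: "finite B" "B \<subseteq> W" and W: "W \<subseteq> H" "(\<lambda>x. 0) \<in> W"
    and W_lin: "\<And>f g a b. f \<in> W \<Longrightarrow> g \<in> W \<Longrightarrow> (\<lambda>x. a * f x + b * g x) \<in> W"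
  shows "\<exists>U. finite U \<and> U \<subseteq> W \<and> card U \<le> card B \<and>
    (\<forall>u\<in>U. \<forall>v\<in>U. ip u v = (if u = v then 1 else 0)) \<and>
    (\<forall>f\<in>H. (\<forall>u\<in>U. ip f u = 0) \<longrightarrow> (\<forall>b\<in>B. ip f b = 0))"
  using B
proof (induction B rule: finite_induct)
  case empty
  then show ?case by (intro exI[of _ "{}"]) auto
next
  case (insert b B)
  then obtain U where U: "finite U" "U \<subseteq> W" "card U \<le> card B"
    "\<And>u v. u \<in> U \<Longrightarrow> v \<in> U \<Longrightarrow> ip u v = (if u = v then 1 else 0)"
    "\<And>f. f \<in> H \<Longrightarrow> (\<forall>u\<in>U. ip f u = 0) \<Longrightarrow> (\<forall>b\<in>B. ip f b = 0)" by auto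
  have bW: "b \<in> W" and bH: "b \<in> H" using insert.prems W by auto
  have UH: "u \<in> H" if "u \<in> U" for u using that U W by auto
  define p where "p = (\<lambda>x. \<Sum>u\<in>U. ip b u * u x)"
  define r where "r = (\<lambda>x. b x - p x)"
  have pW: "p \<in> W" unfolding p_def by (rule lin_closed_sum[OF W(2) _ U(1,2)]) (rule W_lin)
  have rW: "r \<in> W" using W_lin[OF bW pW, of 1 "-1"] by (simp add: r_def)
  have pH: "p \<in> H" and rH: "r \<in> H" using pW rW W by auto
  have p_ip: "ip p v = ip b v" if v: "v \<in> U" for v
  proof -
    have "ip p v = (\<Sum>u\<in>U. ip b u * ip u v)" unfolding p_def using UH v by (subst ip_sum) auto
    also have "\<dots> = (\<Sum>u\<in>U. if u = v then ip b u else 0)" using U(4) v by (intro sum.cong) auto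
    finally show ?thesis using U(1) v by simp
  qed
  have r_orth: "ip r v = 0" if "v \<in> U" for v
    using p_ip[OF that] bH pH UH[OF that] by (simp add: r_def ip_diff)
  have f_b: "ip f b = ip f r" if f: "f \<in> H" "\<forall>u\<in>U. ip f u = 0" for f
  proof -
    have "ip f p = (\<Sum>u\<in>U. cnj (ip b u) * ip f u)" unfolding p_def using UH f by (subst ip_sum_right) auto
    then have "ip f p = 0" using f by simp
    then show ?thesis using f(1) bH pH by (simp add: r_def ip_diff_right)
  qed
  show ?case
  proof (cases "nsq r = 0")
    case True
    have orth: "\<forall>f\<in>H. (\<forall>u\<in>U. ip f u = 0) \<longrightarrow> (\<forall>c\<in>insert b B. ip f c = 0)"
    proof (intro ballI impI)
      fix f c assume f: "f \<in> H" "\<forall>u\<in>U. ip f u = 0" and c: "c \<in> insert b B"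
      have "ip f b = 0" using f_b[OF f] ip_null_right[OF f(1) rH True] by simp
      with U(5)[OF f] c show "ip f c = 0" by blast
    qed
    have "card U \<le> card (insert b B)" using U(3) insert.hyps by simp
    then show ?thesis using U(4) by (intro exI[of _ U] conjI U(1,2) orth) auto
  next
    case False
    then have pos: "nsq r > 0" using nsq_nonneg[OF rH] by simp
    define a where "a = complex_of_real (1 / sqrt (nsq r))"
    define v where "v = (\<lambda>x. a * r x)"
    have a0: "a \<noteq> 0" using pos by (simp add: a_def)
    have vW: "v \<in> W" using W_lin[OF rW rW, of a 0] by (simp add: v_def)
    then have vH: "v \<in> H" using W by auto
    have "nsq v = 1" using pos rH
      unfolding v_def nsq_scale[OF rH] a_def by (simp add: norm_divide power_divide)
    then have vv: "ip v v = 1" using ip_self[OF vH] by simp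
    have vu: "ip v u = 0" if "u \<in> U" for u using r_orth[OF that] rH UH[OF that] by (simp add: v_def ip_scale)
    have uv: "ip u v = 0" if "u \<in> U" for u using ip_cnj[OF vH UH[OF that]] vu[OF that] by simp
    have vU: "v \<notin> U" 
    proof
      assume "v \<in> U"
      from vu[OF this] vv show False by simp
    qed
    have "ip f c = 0" if f: "f \<in> H" "\<forall>u\<in>insert v U. ip f u = 0" and c: "c \<in> insert b B" for f c
    proof -
      have "cnj a * ip f r = 0" using f rH by (simp add: v_def ip_scale_right)
      then have "ip f r = 0" using a0 by simp
      moreover have fU: "\<forall>u\<in>U. ip f u = 0" using f(2) by blast
      ultimately have "ip f b = 0" using f_b[OF f(1)] by simp
      moreover have "\<forall>b\<in>B. ip f b = 0" using U(5)[OF f(1) fU] .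
      ultimately show ?thesis using c by blast
    qed
    then have orth: "\<forall>f\<in>H. (\<forall>u\<in>insert v U. ip f u = 0) \<longrightarrow> (\<forall>c\<in>insert b B. ip f c = 0)" by blast
    have card: "card (insert v U) \<le> card (insert b B)" using U(1,3) vU insert.hyps by simp
    have on: "\<forall>x\<in>insert v U. \<forall>y\<in>insert v U. ip x y = (if x = y then 1 else 0)"
    proof (intro ballI)
      fix x y assume "x \<in> insert v U" "y \<in> insert v U"
      then consider "x = v" "y = v" | "x = v" "y \<in> U" | "x \<in> U" "y = v" | "x \<in> U" "y \<in> U" by blast
      then show "ip x y = (if x = y then 1 else 0)"
      proof cases
        case 1 then show ?thesis using vv by simp
      next
        case 2
        then have "x \<noteq> y" using vU by blast
        then show ?thesis unfolding \<open>x = v\<close> using vu[OF 2(2)] by (simp only: if_False)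
      next
        case 3
        then have "x \<noteq> y" using vU by blast
        then show ?thesis unfolding \<open>y = v\<close> using uv[OF 3(1)] by (simp only: if_False)
      next
        case 4 show ?thesis by (rule U(4)[OF 4])
      qed
    qed
    have "finite (insert v U)" "insert v U \<subseteq> W" using U(1,2) vW by auto
    then show ?thesis by (intro exI[of _ "insert v U"] conjI on orth card)
  qed
qed

end

text \<open>Symmetry makes \<open>R\<close> linear up to null vectors (\<open>R_lin\<close>), and no more can be
  expected from a resolvent whose values are arbitrary representatives of classes of functions.\<close>

locale symmetric_operator = semi_inner_space H ip
  for H :: "('a \<Rightarrow> complex) set" and ip +
  fixes K :: "('a \<Rightarrow> complex) set" and R :: "('a \<Rightarrow> complex) \<Rightarrow> ('a \<Rightarrow> complex)"
  assumes K_sub: "K \<subseteq> H" and K_zero: "(\<lambda>x. 0) \<in> K"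
    and K_lin: "f \<in> K \<Longrightarrow> g \<in> K \<Longrightarrow> (\<lambda>x. a * f x + b * g x) \<in> K"
    and R_mem: "f \<in> K \<Longrightarrow> R f \<in> K"
    and R_sym: "f \<in> K \<Longrightarrow> g \<in> K \<Longrightarrow> ip (R f) g = ip f (R g)"
begin

lemma K_H: "f \<in> K \<Longrightarrow> f \<in> H" using K_sub by auto

lemma K_scale: "f \<in> K \<Longrightarrow> (\<lambda>x. a * f x) \<in> K" using K_lin[of f f a 0] by simp

lemma K_diff: "f \<in> K \<Longrightarrow> g \<in> K \<Longrightarrow> (\<lambda>x. f x - g x) \<in> K" using K_lin[of f g 1 "-1"] by simp

lemma R_lin: assumes "f \<in> K" "g \<in> K" "h \<in> K"
  shows "ip (R (\<lambda>x. a * f x + b * g x)) h = a * ip (R f) h + b * ip (R g) h"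
  using assms by (simp add: R_sym K_lin ip_lin K_H R_mem)

lemma R_scale: "f \<in> K \<Longrightarrow> h \<in> K \<Longrightarrow> ip (R (\<lambda>x. a * f x)) h = a * ip (R f) h"
  using R_lin[of f f h a 0] by simp

lemma nsq_eqI: assumes "k \<in> K" "l \<in> K" "\<And>h. h \<in> K \<Longrightarrow> ip k h = ip l h" shows "nsq k = nsq l"
  using assms(3)[OF assms(1)] assms(3)[OF assms(2)] ip_cnj[of k l] assms(1,2)
  by (simp add: nsq_def K_H)

lemma nsq_R_scale: assumes "f \<in> K" shows "nsq (R (\<lambda>x. a * f x)) = (cmod a)\<^sup>2 * nsq (R f)"
proof -
  have "nsq (R (\<lambda>x. a * f x)) = nsq (\<lambda>x. a * R f x)"
    using assms by (intro nsq_eqI) (auto simp: R_mem K_scale R_scale ip_scale K_H)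
  then show ?thesis using assms by (simp add: nsq_scale K_H R_mem)
qed

lemma nsq_R_diff: assumes "f \<in> K" "g \<in> K" shows "nsq (\<lambda>x. R f x - R g x) = nsq (R (\<lambda>x. f x - g x))"
proof (rule nsq_eqI)
  fix h assume "h \<in> K"
  then show "ip (\<lambda>x. R f x - R g x) h = ip (R (\<lambda>x. f x - g x)) h"
    using R_lin[of f g h 1 "-1"] assms by (simp add: ip_diff K_H R_mem)
qed (use assms in \<open>auto simp: R_mem K_diff\<close>)

text \<open>Cauchy-Schwarz for the form \<open>\<langle>R f, g\<rangle>\<close>, applied to \<open>f\<close> and \<open>R f\<close>.\<close>

lemma psd_bound:
  assumes psd: "\<And>f. f \<in> K \<Longrightarrow> 0 \<le> Re (ip (R f) f)" and up: "\<And>f. f \<in> K \<Longrightarrow> Re (ip (R f) f) \<le> \<theta> * nsq f"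
    and \<theta>: "0 \<le> \<theta>" and f: "f \<in> K"
  shows "nsq (R f) \<le> \<theta> * Re (ip (R f) f)"
proof -
  interpret S: semi_inner_space K "\<lambda>f g. ip (R f) g"
  proof
    show "ip (R g) f = cnj (ip (R f) g)" if "f \<in> K" "g \<in> K" for f g
      using that by (subst R_sym) (auto simp: K_H R_mem intro: ip_cnj)
  qed (use K_zero K_lin R_lin psd in auto)
  have Rf: "R f \<in> K" using f R_mem by blast
  have "(nsq (R f))\<^sup>2 = (cmod (ip (R f) (R f)))\<^sup>2" using Rf by (simp add: ip_self K_H)
  also have "\<dots> \<le> Re (ip (R f) f) * Re (ip (R (R f)) (R f))"
    using S.cauchy_schwarz[OF f Rf] by (simp add: S.nsq_def)
  also have "\<dots> \<le> Re (ip (R f) f) * (\<theta> * nsq (R f))"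
    using psd[OF f] up[OF Rf] by (intro mult_left_mono) auto
  finally have *: "nsq (R f) * nsq (R f) \<le> (\<theta> * Re (ip (R f) f)) * nsq (R f)"
    by (simp add: power2_eq_square algebra_simps)
  have "nsq (R f) \<ge> 0" using Rf by (simp add: K_H)
  then consider "nsq (R f) = 0" | "nsq (R f) > 0" by linarith
  then show ?thesis
  proof cases
    case 1 then show ?thesis using \<theta> psd[OF f] by simp
  next
    case 2 then show ?thesis using * mult_right_le_imp_le by blast
  qed
qed

text \<open>\<open>R + \<epsilon>\<close> has dense range, by Richardson's iteration: replacing \<open>f\<close> by \<open>f + \<tau> r\<close>, where \<open>r\<close> is the residual,
  multiplies the residual by \<open>S = 1 - \<tau> (R + \<epsilon>)\<close>. For \<open>\<tau> = 1 / (C + \<epsilon>)\<close> the operator \<open>S\<close> lies between \<open>0\<close>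
  and \<open>\<theta> = 1 - \<tau> \<epsilon> < 1\<close>, so the residual decays geometrically.\<close>

lemma approximate_solution:
  assumes psd: "\<And>f. f \<in> K \<Longrightarrow> 0 \<le> Re (ip (R f) f)" and up: "\<And>f. f \<in> K \<Longrightarrow> Re (ip (R f) f) \<le> C * nsq f"
    and C: "0 \<le> C" and e: "0 < \<epsilon>" and d: "0 < \<delta>" and w: "w \<in> K"
  shows "\<exists>f\<in>K. nsq (\<lambda>x. w x - R f x - of_real \<epsilon> * f x) < \<delta>"
proof -
  define \<tau> where "\<tau> = 1 / (C + \<epsilon>)"
  define \<theta> where "\<theta> = 1 - \<tau> * \<epsilon>"
  have tau: "\<tau> > 0" and th: "0 \<le> \<theta>" "\<theta> < 1" "1 - \<tau> * \<epsilon> - \<tau> * C = 0"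
    using C e by (auto simp: \<tau>_def \<theta>_def field_simps)
  define S where "S = (\<lambda>f x. f x - of_real \<tau> * (R f x + of_real \<epsilon> * f x))"
  have S_eq: "S f = (\<lambda>x. of_real \<theta> * f x + of_real (-\<tau>) * R f x)" for f
    by (auto simp: S_def \<theta>_def algebra_simps)
  have ipS: "ip (S f) h = of_real \<theta> * ip f h - of_real \<tau> * ip (R f) h" if "f \<in> K" "h \<in> K" for f h
    unfolding S_eq using that by (subst ip_lin) (auto simp: K_H R_mem)
  have S_K: "S f \<in> K" if "f \<in> K" for f
    unfolding S_eq using that K_lin R_mem by blast
  interpret S: symmetric_operator H ip K S
  proof
    show "ip (S f) g = ip f (S g)" if "f \<in> K" "g \<in> K" for f g
      using ip_cnj[of "S g" f] ip_cnj[of "R g" f] ip_cnj[of g f] that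
      by (simp add: ipS K_H S_K R_mem R_sym)
  qed (use K_zero K_lin K_sub S_K in auto)
  have Re_S: "Re (ip (S f) f) = \<theta> * nsq f - \<tau> * Re (ip (R f) f)" if "f \<in> K" for f
    using that by (simp add: ipS nsq_def)
  have S_bound: "nsq (S f) \<le> \<theta>\<^sup>2 * nsq f" if f: "f \<in> K" for f
  proof -
    have up': "Re (ip (S f) f) \<le> \<theta> * nsq f" if "f \<in> K" for f
      using psd[OF that] tau Re_S[OF that] by simp
    have "nsq (S f) \<le> \<theta> * Re (ip (S f) f)"
    proof (rule S.psd_bound[OF _ up' th(1) f])
      fix f assume f: "f \<in> K"
      have "\<tau> * Re (ip (R f) f) \<le> \<tau> * (C * nsq f)" using tau up[OF f] by (intro mult_left_mono) auto
      also have "\<dots> = (\<tau> * C) * nsq f" by simp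
      also have "\<tau> * C = \<theta>" using th(3) by (simp add: \<theta>_def)
      finally show "0 \<le> Re (ip (S f) f)" using Re_S[OF f] by simp
    qed
    also have "\<dots> \<le> \<theta> * (\<theta> * nsq f)" using up'[OF f] th by (intro mult_left_mono) auto
    finally show ?thesis by (simp add: power2_eq_square mult.assoc)
  qed
  have iter: "\<exists>f\<in>K. nsq (\<lambda>x. w x - R f x - of_real \<epsilon> * f x) \<le> (\<theta>\<^sup>2) ^ n * (nsq (\<lambda>x. w x - R (\<lambda>x. 0) x))" for n
  proof (induction n)
    case 0 show ?case using K_zero by (intro bexI[of _ "\<lambda>x. 0"]) auto
  next
    case (Suc n)
    then obtain f where f: "f \<in> K" and
      le: "nsq (\<lambda>x. w x - R f x - of_real \<epsilon> * f x) \<le> (\<theta>\<^sup>2) ^ n * (nsq (\<lambda>x. w x - R (\<lambda>x. 0) x))" by blast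
    define r where "r = (\<lambda>x. w x - R f x - of_real \<epsilon> * f x)"
    define f' where "f' = (\<lambda>x. f x + of_real \<tau> * r x)"
    have rK: "r \<in> K" unfolding r_def by (intro K_diff K_scale w R_mem f)
    have f'K: "f' \<in> K" using K_lin[OF f rK, of 1 "of_real \<tau>"] by (simp add: f'_def)
    have "nsq (\<lambda>x. w x - R f' x - of_real \<epsilon> * f' x) = nsq (S r)"
    proof (rule nsq_eqI)
      fix h assume h: "h \<in> K"
      have 1: "ip (R f') h = ip (R f) h + of_real \<tau> * ip (R r) h"
        using R_lin[OF f rK h, of 1 "of_real \<tau>"] by (simp add: f'_def)
      have 2: "ip f' h = ip f h + of_real \<tau> * ip r h"
        using ip_lin[OF K_H[OF f] K_H[OF rK] K_H[OF h], of 1 "of_real \<tau>"] by (simp add: f'_def)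
      have 3: "ip r h = ip w h - ip (R f) h - of_real \<epsilon> * ip f h"
        unfolding r_def using w f h by (simp add: ip_simps K_H R_mem)
      have "ip (\<lambda>x. w x - R f' x - of_real \<epsilon> * f' x) h = ip w h - ip (R f') h - of_real \<epsilon> * ip f' h"
        using w f'K h by (simp add: ip_simps K_H R_mem)
      also have "\<dots> = ip r h - of_real \<tau> * ip (R r) h - of_real (\<tau> * \<epsilon>) * ip r h"
        by (simp add: 1 2 3 algebra_simps)
      also have "\<dots> = ip (S r) h" using rK h by (simp add: ipS \<theta>_def algebra_simps)
      finally show "ip (\<lambda>x. w x - R f' x - of_real \<epsilon> * f' x) h = ip (S r) h" .
    qed (auto intro!: K_diff K_scale w R_mem f'K S_K rK)
    also have "\<dots> \<le> \<theta>\<^sup>2 * nsq r" by (rule S_bound[OF rK])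
    also have "\<dots> \<le> \<theta>\<^sup>2 * ((\<theta>\<^sup>2) ^ n * (nsq (\<lambda>x. w x - R (\<lambda>x. 0) x)))"
      using le by (intro mult_left_mono) (auto simp: r_def)
    finally show ?case using f'K by (intro bexI[of _ f']) (simp_all add: mult.assoc)
  qed
  have "\<theta>\<^sup>2 < 1" using th by (simp add: power_less_one_iff abs_square_less_1)
  then have "(\<lambda>n. (\<theta>\<^sup>2) ^ n * (nsq (\<lambda>x. w x - R (\<lambda>x. 0) x))) \<longlonglongrightarrow> 0"
    by (intro tendsto_mult_left_zero LIMSEQ_power_zero) simp
  then have "\<forall>\<^sub>F n in sequentially. (\<theta>\<^sup>2) ^ n * (nsq (\<lambda>x. w x - R (\<lambda>x. 0) x)) < \<delta>"
    using d by (rule order_tendstoD)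
  then obtain n where n: "(\<theta>\<^sup>2) ^ n * (nsq (\<lambda>x. w x - R (\<lambda>x. 0) x)) < \<delta>"
    by (auto simp: eventually_sequentially)
  show ?thesis using iter[of n] n by force
qed

lemma normalize:
  assumes f: "f \<in> K" and pos: "nsq f > 0"
  shows "\<exists>g\<in>K. nsq g = 1 \<and> Re (ip (R g) g) = Re (ip (R f) f) / nsq f \<and> nsq (R g) = nsq (R f) / nsq f"
proof -
  define a where "a = complex_of_real (1 / sqrt (nsq f))"
  have a2: "(cmod a)\<^sup>2 = 1 / nsq f" using pos by (simp add: a_def norm_divide power_divide)
  have aa: "a * cnj a = of_real (1 / nsq f)" using a2 complex_norm_square[of a] by simp
  have "ip (R (\<lambda>x. a * f x)) (\<lambda>x. a * f x) = (a * cnj a) * ip (R f) f"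
    using f by (simp add: R_scale K_scale ip_scale_right K_H R_mem)
  then have "Re (ip (R (\<lambda>x. a * f x)) (\<lambda>x. a * f x)) = Re (ip (R f) f) / nsq f"
    unfolding aa by simp
  moreover have "nsq (\<lambda>x. a * f x) = 1" using f pos by (simp add: nsq_scale K_H a2)
  moreover have "nsq (R (\<lambda>x. a * f x)) = nsq (R f) / nsq f" using f by (simp add: nsq_R_scale a2)
  ultimately show ?thesis using K_scale[OF f] by blast
qed

lemma R_null: "f \<in> K \<Longrightarrow> nsq f = 0 \<Longrightarrow> nsq (R f) = 0"
  using R_sym[of f "R f"] ip_null[of f "R (R f)"] by (simp add: nsq_def K_H R_mem)

end

locale compact_symmetric_operator = symmetric_operator +
  assumes K_closed: "(\<And>n. f n \<in> K) \<Longrightarrow> h \<in> H \<Longrightarrow> (\<lambda>n. nsq (\<lambda>x. f n x - h x)) \<longlonglongrightarrow> 0 \<Longrightarrow> h \<in> K"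
    and R_compact: "(\<And>n. f n \<in> K) \<Longrightarrow> (\<And>n. nsq (f n) \<le> 1) \<Longrightarrow>
      \<exists>r h. strict_mono (r :: nat \<Rightarrow> nat) \<and> h \<in> H \<and> (\<lambda>n. nsq (\<lambda>x. R (f (r n)) x - h x)) \<longlonglongrightarrow> 0"
begin

text \<open>Images of unit vectors whose norms tend to infinity have no convergent subsequence.\<close>

lemma R_bounded: "\<exists>B\<ge>0. \<forall>f\<in>K. nsq (R f) \<le> B * nsq f"
proof -
  have "\<exists>B\<ge>0. \<forall>f\<in>K. nsq f = 1 \<longrightarrow> nsq (R f) \<le> B"
  proof (rule ccontr)
    assume "\<not> ?thesis"
    then have "\<exists>f\<in>K. nsq f = 1 \<and> real n < nsq (R f)" for n
      by (meson not_le of_nat_0_le_iff)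
    then obtain f where f: "\<And>n. f n \<in> K" "\<And>n. nsq (f n) = 1" "\<And>n. real n < nsq (R (f n))"
      by metis
    obtain r h where r: "strict_mono (r :: nat \<Rightarrow> nat)" and h: "h \<in> H"
      and lim: "(\<lambda>n. nsq (\<lambda>x. R (f (r n)) x - h x)) \<longlonglongrightarrow> 0"
      using R_compact[of f] f by auto
    have "(\<lambda>n. nsq (R (f (r n)))) \<longlonglongrightarrow> nsq h"
      using f by (intro nsq_tendsto[OF _ h lim]) (auto simp: K_H R_mem)
    then have "\<forall>\<^sub>F n in sequentially. nsq (R (f (r n))) < nsq h + 1"
      by (rule order_tendstoD) simp
    then obtain N where N: "\<And>n. n \<ge> N \<Longrightarrow> nsq (R (f (r n))) < nsq h + 1"
      by (auto simp: eventually_sequentially)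
    obtain M where M: "nsq h + 1 < real M" using reals_Archimedean2 by blast
    have "real (max M N) \<le> real (r (max M N))" using seq_suble[OF r] by simp
    also have "\<dots> < nsq h + 1" using f(3)[of "r (max M N)"] N[of "max M N"] by simp
    finally show False using M by simp
  qed
  then obtain B where B: "B \<ge> 0" "\<And>f. f \<in> K \<Longrightarrow> nsq f = 1 \<Longrightarrow> nsq (R f) \<le> B" by blast
  have "nsq (R f) \<le> B * nsq f" if f: "f \<in> K" for f
  proof (cases "nsq f = 0")
    case True then show ?thesis using R_null[OF f] by simp
  next
    case False
    then have pos: "nsq f > 0" using nsq_nonneg[OF K_H[OF f]] by simp
    from normalize[OF f this] B(2) have "nsq (R f) / nsq f \<le> B" by fastforce
    then show ?thesis using pos by (simp add: field_simps)
  qed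
  then show ?thesis using B(1) by blast
qed

lemma Re_ip_R_le:
  assumes B: "B \<ge> 0" "\<And>f. f \<in> K \<Longrightarrow> nsq (R f) \<le> B * nsq f" and f: "f \<in> K"
  shows "\<bar>Re (ip (R f) f)\<bar> \<le> sqrt B * nsq f"
proof -
  have "\<bar>Re (ip (R f) f)\<bar> \<le> sqrt (nsq (R f)) * sqrt (nsq f)"
    using abs_Re_le_cmod cmod_ip_le[of "R f" f] f by (meson K_H R_mem order_trans)
  also have "\<dots> \<le> sqrt (B * nsq f) * sqrt (nsq f)"
    using f by (intro mult_right_mono real_sqrt_le_mono B real_sqrt_ge_zero nsq_nonneg K_H)
  also have "\<dots> = sqrt B * nsq f" using f by (simp add: real_sqrt_mult K_H)
  finally show ?thesis .
qed

text \<open>The maximum principle. Suppose that the supremum \<open>m\<close> of \<open>\<langle>R g, g\<rangle>\<close> over unit vectors exceeds \<open>\<nu>\<close>, and take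
  unit vectors \<open>g\<^sub>n\<close> with \<open>\<langle>R g\<^sub>n, g\<^sub>n\<rangle> \<rightarrow> m\<close>. The operator \<open>S = m - R\<close> is positive, so \<open>psd_bound\<close> shows
  \<open>S g\<^sub>n \<rightarrow> 0\<close>. Along a subsequence \<open>R g\<^sub>n\<close> converges, hence so does \<open>g\<^sub>n\<close>, and the limit is an eigenvector
  of norm one for the eigenvalue \<open>m\<close>.\<close>

lemma numerical_range_bound:
  assumes nu: "0 \<le> \<nu>"
    and no_ev: "\<And>\<phi> m. \<phi> \<in> K \<Longrightarrow> m > \<nu> \<Longrightarrow> nsq (\<lambda>x. R \<phi> x - of_real m * \<phi> x) = 0 \<Longrightarrow> nsq \<phi> = 0"
    and f: "f \<in> K"
  shows "Re (ip (R f) f) \<le> \<nu> * nsq f"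
proof (rule ccontr)
  assume contra: "\<not> ?thesis"
  obtain B where B: "B \<ge> 0" "\<And>f. f \<in> K \<Longrightarrow> nsq (R f) \<le> B * nsq f" using R_bounded by blast
  have R_le: "\<bar>Re (ip (R g) g)\<bar> \<le> sqrt B * nsq g" if "g \<in> K" for g
    using Re_ip_R_le[OF B that] by blast
  define X where "X = {Re (ip (R g) g) | g. g \<in> K \<and> nsq g = 1}"
  define m where "m = Sup X"
  have bdd: "bdd_above X"
    unfolding bdd_above_def X_def using R_le by (intro exI[of _ "sqrt B"]) fastforce
  have m_up: "Re (ip (R g) g) \<le> m * nsq g" if g: "g \<in> K" for g
  proof (cases "nsq g = 0")
    case True then show ?thesis using R_le[OF g] by simp
  next
    case False
    then have pos: "nsq g > 0" using nsq_nonneg[OF K_H[OF g]] by simp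
    then have "Re (ip (R g) g) / nsq g \<in> X" using normalize[OF g pos] unfolding X_def by force
    then have "Re (ip (R g) g) / nsq g \<le> m" unfolding m_def by (intro cSup_upper bdd)
    then show ?thesis using pos by (simp add: field_simps)
  qed
  have fpos: "nsq f > 0" using contra R_le[OF f] nsq_nonneg[OF K_H[OF f]]
    by (cases "nsq f = 0") auto
  have m_nu: "m > \<nu>"
  proof -
    have "\<nu> * nsq f < m * nsq f" using contra m_up[OF f] by linarith
    then show ?thesis using fpos by simp
  qed
  have Xne: "X \<noteq> {}" unfolding X_def using normalize[OF f fpos] by blast
  have "\<exists>g\<in>K. nsq g = 1 \<and> m - 1 / real (Suc n) < Re (ip (R g) g)" for n
  proof -
    have "m - 1 / real (Suc n) < Sup X" unfolding m_def by simp
    then obtain y where "y \<in> X" "m - 1 / real (Suc n) < y" using less_cSup_iff[OF Xne bdd] by blast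
    then show ?thesis unfolding X_def by blast
  qed
  then obtain g where g: "\<And>n. g n \<in> K" "\<And>n. nsq (g n) = 1"
    "\<And>n. m - 1 / real (Suc n) < Re (ip (R (g n)) (g n))" by metis
  define S where "S = (\<lambda>f x. of_real m * f x - R f x)"
  have S_eq: "S f = (\<lambda>x. of_real m * f x + (-1) * R f x)" for f by (auto simp: S_def)
  have ipS: "ip (S f) h = of_real m * ip f h - ip (R f) h" if "f \<in> K" "h \<in> K" for f h
    unfolding S_eq using that by (subst ip_lin) (auto simp: K_H R_mem)
  have S_K: "S f \<in> K" if "f \<in> K" for f unfolding S_eq using that K_lin R_mem by blast
  interpret S: symmetric_operator H ip K S
  proof
    show "ip (S f) g = ip f (S g)" if "f \<in> K" "g \<in> K" for f g
      using ip_cnj[of "S g" f] ip_cnj[of "R g" f] ip_cnj[of g f] that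
      by (simp add: ipS K_H S_K R_mem R_sym)
  qed (use K_zero K_lin K_sub S_K in auto)
  have Re_S: "Re (ip (S f) f) = m * nsq f - Re (ip (R f) f)" if "f \<in> K" for f
    using that by (simp add: ipS nsq_def)
  have S_le: "nsq (S (g n)) \<le> (m + sqrt B) * (1 / real (Suc n))" for n
  proof -
    have "nsq (S (g n)) \<le> (m + sqrt B) * Re (ip (S (g n)) (g n))"
    proof (rule S.psd_bound[OF _ _ _ g(1)])
      show "0 \<le> m + sqrt B" using m_nu nu B by simp
      show "0 \<le> Re (ip (S f) f)" if "f \<in> K" for f using Re_S[OF that] m_up[OF that] by simp
      show "Re (ip (S f) f) \<le> (m + sqrt B) * nsq f" if "f \<in> K" for f
        using Re_S[OF that] R_le[OF that] by (simp add: distrib_right)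
    qed
    also have "\<dots> \<le> (m + sqrt B) * (1 / real (Suc n))"
      using Re_S[OF g(1)[of n]] g(2,3)[of n] m_nu nu B by (intro mult_left_mono) auto
    finally show ?thesis .
  qed
  have S0: "(\<lambda>n. nsq (S (g n))) \<longlonglongrightarrow> 0"
  proof (rule tendsto_sandwich[OF _ _ tendsto_const])
    show "(\<lambda>n. (m + sqrt B) * (1 / real (Suc n))) \<longlonglongrightarrow> 0"
      using tendsto_mult_right_zero[OF LIMSEQ_inverse_real_of_nat] by (simp add: inverse_eq_divide)
    show "\<forall>\<^sub>F n in sequentially. 0 \<le> nsq (S (g n))" using g S_K by (simp add: K_H)
  qed (use S_le in auto)
  obtain r h where r: "strict_mono (r :: nat \<Rightarrow> nat)" and h: "h \<in> H"
    and lim: "(\<lambda>n. nsq (\<lambda>x. R (g (r n)) x - h x)) \<longlonglongrightarrow> 0"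
    using R_compact[of g] g by auto
  have gH: "g n \<in> H" "R (g n) \<in> H" for n using g by (auto simp: K_H R_mem)
  \<comment> \<open>Since \<open>m g\<^sub>n - R g\<^sub>n \<rightarrow> 0\<close> and \<open>R g\<^sub>n \<rightarrow> h\<close>, this is the limit of the \<open>g\<^sub>n\<close>.\<close>
  define \<phi> where "\<phi> = (\<lambda>x. of_real (1 / m) * h x)"
  have m0: "m > 0" using m_nu nu by simp
  have \<phi>H: "\<phi> \<in> H" unfolding \<phi>_def by (rule scale_mem[OF h])
  have h_eq: "h = (\<lambda>x. of_real m * \<phi> x)" using m0 by (auto simp: \<phi>_def)
  have "(\<lambda>n. nsq (\<lambda>x. of_real m * g (r n) x - R (g (r n)) x)) \<longlonglongrightarrow> 0"
    using LIMSEQ_subseq_LIMSEQ[OF S0 r] by (simp add: o_def S_def)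
  then have "(\<lambda>n. nsq (\<lambda>x. of_real m * g (r n) x - h x)) \<longlonglongrightarrow> 0"
    by (rule nsq_tendsto_trans[where v = "\<lambda>n. R (g (r n))", rotated 3])
      (use gH h lim in \<open>auto simp: scale_mem\<close>)
  then have "(\<lambda>n. (1 / m)\<^sup>2 * nsq (\<lambda>x. of_real m * g (r n) x - h x)) \<longlonglongrightarrow> 0"
    by (rule tendsto_mult_right_zero)
  moreover have "(1 / m)\<^sup>2 * nsq (\<lambda>x. of_real m * g (r n) x - h x) = nsq (\<lambda>x. g (r n) x - \<phi> x)" for n
  proof -
    have "nsq (\<lambda>x. of_real (1 / m) * (of_real m * g (r n) x - h x))
        = (cmod (of_real (1 / m)))\<^sup>2 * nsq (\<lambda>x. of_real m * g (r n) x - h x)"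
      using gH h by (intro nsq_scale) (simp add: ip_simps)
    moreover have "(\<lambda>x. of_real (1 / m) * (of_real m * g (r n) x - h x)) = (\<lambda>x. g (r n) x - \<phi> x)"
      using m0 by (auto simp: \<phi>_def algebra_simps)
    ultimately show ?thesis using m0 by (simp add: norm_divide)
  qed
  ultimately have g\<phi>: "(\<lambda>n. nsq (\<lambda>x. g (r n) x - \<phi> x)) \<longlonglongrightarrow> 0" by simp
  have \<phi>K: "\<phi> \<in> K" using K_closed[of "\<lambda>n. g (r n)" \<phi>] g \<phi>H g\<phi> by blast
  have "(\<lambda>n. nsq (\<lambda>x. R \<phi> x - R (g (r n)) x)) \<longlonglongrightarrow> 0"
  proof (rule tendsto_sandwich[OF _ _ tendsto_const])
    show "(\<lambda>n. B * nsq (\<lambda>x. g (r n) x - \<phi> x)) \<longlonglongrightarrow> 0"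
      using tendsto_mult_right_zero[OF g\<phi>] by simp
    show "\<forall>\<^sub>F n in sequentially. nsq (\<lambda>x. R \<phi> x - R (g (r n)) x) \<le> B * nsq (\<lambda>x. g (r n) x - \<phi> x)"
    proof (rule always_eventually, rule allI)
      fix n
      have "nsq (\<lambda>x. R \<phi> x - R (g (r n)) x) = nsq (R (\<lambda>x. \<phi> x - g (r n) x))"
        using \<phi>K g by (intro nsq_R_diff) auto
      also have "\<dots> \<le> B * nsq (\<lambda>x. \<phi> x - g (r n) x)" using \<phi>K g by (intro B K_diff) auto
      finally show "nsq (\<lambda>x. R \<phi> x - R (g (r n)) x) \<le> B * nsq (\<lambda>x. g (r n) x - \<phi> x)"
        using nsq_diff_swap[of \<phi> "g (r n)"] \<phi>H gH by simp
    qed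
    show "\<forall>\<^sub>F n in sequentially. 0 \<le> nsq (\<lambda>x. R \<phi> x - R (g (r n)) x)"
      using \<phi>K gH by (simp add: diff_mem K_H R_mem)
  qed
  then have "(\<lambda>n::nat. nsq (\<lambda>x. R \<phi> x - h x)) \<longlonglongrightarrow> 0"
    by (rule nsq_tendsto_trans[where v = "\<lambda>n. R (g (r n))", rotated 3])
      (use gH h \<phi>K lim in \<open>auto simp: K_H R_mem\<close>)
  then have "nsq (\<lambda>x. R \<phi> x - of_real m * \<phi> x) = 0"
    by (subst (asm) h_eq) (simp add: LIMSEQ_const_iff)
  then have "nsq \<phi> = 0" using no_ev \<phi>K m_nu by blast
  moreover have "(\<lambda>n. nsq (g (r n))) \<longlonglongrightarrow> nsq \<phi>"
    by (rule nsq_tendsto[OF gH(1) \<phi>H g\<phi>])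
  ultimately show False using g(2) by (simp add: LIMSEQ_const_iff)
qed

end

section \<open>Closed semibounded forms\<close>

lemma L2_integrable_mult_cnj:
  assumes "f \<in> L2 M" "g \<in> L2 M"
  shows "integrable M (\<lambda>x. f x * cnj (g x))"
proof (rule Bochner_Integration.integrable_bound)
  show "integrable M (\<lambda>x. (norm (f x))\<^sup>2 + (norm (g x))\<^sup>2)"
    using assms by (simp add: L2_def)
  show "(\<lambda>x. f x * cnj (g x)) \<in> borel_measurable M"
  proof -
    have f: "f \<in> borel_measurable M" and g: "g \<in> borel_measurable M" using assms by (auto simp: L2_def)
    have "(\<lambda>x. cnj (g x)) \<in> borel_measurable M"
      by (rule measurable_compose[OF g borel_measurable_continuous_onI]) (intro continuous_intros)
    with f show ?thesis by (rule borel_measurable_times)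
  qed
  show "AE x in M. norm (f x * cnj (g x)) \<le> norm ((norm (f x))\<^sup>2 + (norm (g x))\<^sup>2)"
  proof (rule AE_I2)
    fix x
    have "2 * (cmod (f x) * cmod (g x)) \<le> (cmod (f x))\<^sup>2 + (cmod (g x))\<^sup>2"
      using sum_squares_bound[of "cmod (f x)" "cmod (g x)"] by (simp add: mult.assoc)
    then have "cmod (f x) * cmod (g x) \<le> (cmod (f x))\<^sup>2 + (cmod (g x))\<^sup>2"
      using mult_nonneg_nonneg[OF norm_ge_zero norm_ge_zero, of "f x" "g x"] by linarith
    then show "norm (f x * cnj (g x)) \<le> norm ((norm (f x))\<^sup>2 + (norm (g x))\<^sup>2)"
      by (simp add: norm_mult)
  qed
qed

lemma L2_lin:
  fixes f g :: "'a \<Rightarrow> complex"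
  assumes "f \<in> L2 M" "g \<in> L2 M"
  shows "(\<lambda>x. a * f x + b * g x) \<in> L2 M"
proof -
  have [measurable]: "f \<in> borel_measurable M" "g \<in> borel_measurable M" using assms by (auto simp: L2_def)
  have "integrable M (\<lambda>x. (norm (a * f x + b * g x))\<^sup>2)"
  proof (rule Bochner_Integration.integrable_bound)
    show "integrable M (\<lambda>x. 2 * ((cmod a)\<^sup>2 * (norm (f x))\<^sup>2) + 2 * ((cmod b)\<^sup>2 * (norm (g x))\<^sup>2))"
      using assms by (simp add: L2_def)
    show "(\<lambda>x. (norm (a * f x + b * g x))\<^sup>2) \<in> borel_measurable M" by measurable
    show "AE x in M. norm ((norm (a * f x + b * g x))\<^sup>2) \<le>
        norm (2 * ((cmod a)\<^sup>2 * (norm (f x))\<^sup>2) + 2 * ((cmod b)\<^sup>2 * (norm (g x))\<^sup>2))"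
    proof (rule AE_I2)
      fix x
      have "(norm (a * f x + b * g x))\<^sup>2 \<le> (cmod a * cmod (f x) + cmod b * cmod (g x))\<^sup>2"
        using norm_triangle_ineq[of "a * f x" "b * g x"] by (intro power_mono) (auto simp: norm_mult)
      also have "\<dots> \<le> 2 * ((cmod a * cmod (f x))\<^sup>2) + 2 * ((cmod b * cmod (g x))\<^sup>2)"
        using sum_squares_bound[of "cmod a * cmod (f x)" "cmod b * cmod (g x)"]
        by (simp add: power2_sum)
      finally show "norm ((norm (a * f x + b * g x))\<^sup>2) \<le>
        norm (2 * ((cmod a)\<^sup>2 * (norm (f x))\<^sup>2) + 2 * ((cmod b)\<^sup>2 * (norm (g x))\<^sup>2))"
        by (simp add: power_mult_distrib)
    qed
  qed
  then show ?thesis by (simp add: L2_def)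
qed

text \<open>Throughout, \<open>L2.nsq\<close> is the squared norm of \<open>L\<^sup>2\<close>.\<close>

interpretation L2: semi_inner_space "L2 M" "L2_inner M" for M :: "'a measure"
proof
  show "(\<lambda>x. 0) \<in> L2 M" by (simp add: L2_def)
  show "L2_inner M (\<lambda>x. a * f x + b * g x) h = a * L2_inner M f h + b * L2_inner M g h"
    if "f \<in> L2 M" "g \<in> L2 M" "h \<in> L2 M" for f g h a b
    using L2_integrable_mult_cnj[OF that(1,3)] L2_integrable_mult_cnj[OF that(2,3)]
    by (simp add: L2_inner_def distrib_right mult.assoc)
  show "L2_inner M g f = cnj (L2_inner M f g)" for f g
    unfolding L2_inner_def by (subst Bochner_Integration.integral_cnj[symmetric]) (simp add: mult.commute)
  show "0 \<le> Re (L2_inner M f f)" for f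
    unfolding L2_inner_def by (simp add: complex_norm_square[symmetric] flip: of_real_power)
qed (fact L2_lin)

lemma L2_nsq_eq: "L2.nsq M f = (LINT x|M. (cmod (f x))\<^sup>2)"
  unfolding L2.nsq_def L2_inner_def by (simp add: complex_norm_square[symmetric] flip: of_real_power)

lemma L2_norm2_eq: "f \<in> L2 M \<Longrightarrow> L2_norm2 M f = ennreal (L2.nsq M f)"
  unfolding L2_norm2_def L2_nsq_eq L2_def by (subst nn_integral_eq_integral) auto

lemma L2_tendsto_iff:
  assumes "\<And>n. u n \<in> L2 M" "U \<in> L2 M"
  shows "L2_tendsto M u U \<longleftrightarrow> (\<lambda>n. L2.nsq M (\<lambda>x. u n x - U x)) \<longlonglongrightarrow> 0"
proof -
  have "L2_tendsto M u U \<longleftrightarrow> (\<lambda>n. ennreal (L2.nsq M (\<lambda>x. u n x - U x))) \<longlonglongrightarrow> ennreal 0"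
    using assms by (simp add: L2_tendsto_def L2_norm2_eq L2.diff_mem)
  also have "\<dots> \<longleftrightarrow> (\<lambda>n. L2.nsq M (\<lambda>x. u n x - U x)) \<longlonglongrightarrow> 0"
    using assms by (intro tendsto_ennreal_iff) (auto simp: L2.diff_mem)
  finally show ?thesis .
qed

lemma L2_nsq_eq_0I: "AE x in M. f x = 0 \<Longrightarrow> L2.nsq M f = 0"
  unfolding L2_nsq_eq by (rule integral_eq_zero_AE) auto

text \<open>The constant \<open>c\<close> makes \<open>q + c \<parallel>\<cdot>\<parallel>\<^sup>2\<close> a positive form. Convergence in the sense of \<open>form_tendsto\<close> is
  \<open>L\<^sup>2\<close> convergence of a Cauchy sequence for that form (\<open>form_tendstoD\<close>, \<open>form_tendstoI\<close>).\<close>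

locale closable_form_space =
  fixes M :: "'a measure" and D :: "('a \<Rightarrow> complex) set" and q :: "('a \<Rightarrow> complex) \<Rightarrow> real" and c :: real
  assumes qf: "quadratic_form_on M D q" and closable: "closable_form M D q"
    and c_ge_1: "1 \<le> c" and lower: "u \<in> D \<Longrightarrow> - c * L2.nsq M u \<le> q u"
begin

abbreviation "nsq \<equiv> L2.nsq M"
abbreviation "inn \<equiv> L2_inner M"
abbreviation "P \<equiv> polar_form q"
abbreviation "Dc \<equiv> closure_dom M D q"
abbreviation "Q \<equiv> closure_form M D q"

lemma D_L2: "u \<in> D \<Longrightarrow> u \<in> L2 M"
  and D_zero: "(\<lambda>x. 0) \<in> D"
  and D_lin: "u \<in> D \<Longrightarrow> v \<in> D \<Longrightarrow> (\<lambda>x. a * u x + b * v x) \<in> D"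
  and P_self: "u \<in> D \<Longrightarrow> P u u = of_real (q u)"
  and P_cnj: "u \<in> D \<Longrightarrow> v \<in> D \<Longrightarrow> P v u = cnj (P u v)"
  and P_lin: "u \<in> D \<Longrightarrow> v \<in> D \<Longrightarrow> w \<in> D \<Longrightarrow> P (\<lambda>x. a * u x + b * v x) w = a * P u w + b * P v w"
  using qf unfolding quadratic_form_on_def by blast+

definition "E_ip u v = P u v + of_real c * inn u v"

sublocale E: semi_inner_space D E_ip
proof
  show "0 \<le> Re (E_ip u u)" if "u \<in> D" for u
    using lower[OF that] L2.ip_self[OF D_L2[OF that]] P_self[OF that] by (simp add: E_ip_def)
  show "E_ip v u = cnj (E_ip u v)" if "u \<in> D" "v \<in> D" for u v
    using P_cnj[OF that] L2.ip_cnj[of u M v] that by (simp add: D_L2 E_ip_def)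
qed (auto simp: D_zero D_lin P_lin L2.ip_lin D_L2 algebra_simps E_ip_def)

lemma E_nsq: "u \<in> D \<Longrightarrow> E.nsq u = q u + c * nsq u"
  by (simp add: E.nsq_def P_self L2.ip_self D_L2 E_ip_def)

lemma form_tendstoD:
  assumes "form_tendsto M D q u U"
  shows "u n \<in> D" "u n \<in> L2 M" "U \<in> L2 M" "(\<lambda>n. nsq (\<lambda>x. u n x - U x)) \<longlonglongrightarrow> 0" "E.cauchy_seq u"
proof -
  show uD: "u n \<in> D" for n using assms by (auto simp: form_tendsto_def)
  then show uL: "u n \<in> L2 M" for n using D_L2 by blast
  show U: "U \<in> L2 M" using assms by (auto simp: form_tendsto_def)
  show lim: "(\<lambda>n. nsq (\<lambda>x. u n x - U x)) \<longlonglongrightarrow> 0"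
    using assms L2_tendsto_iff[of u M U] uL U by (auto simp: form_tendsto_def)
  have cau: "L2.cauchy_seq M u" by (rule L2.tendsto_imp_cauchy_seq[OF uL U lim])
  show "E.cauchy_seq u"
    unfolding E.cauchy_seq_def
  proof (intro allI impI)
    fix e :: real assume e: "e > 0"
    have c0: "c > 0" using c_ge_1 by simp
    obtain N1 where N1: "\<And>m n. m \<ge> N1 \<Longrightarrow> n \<ge> N1 \<Longrightarrow> nsq (\<lambda>x. u m x - u n x) < e / (2 * c)"
      using cau e c0 unfolding L2.cauchy_seq_def by (metis divide_pos_pos mult_pos_pos zero_less_numeral)
    obtain N2 where N2: "\<And>m n. m \<ge> N2 \<Longrightarrow> n \<ge> N2 \<Longrightarrow> \<bar>q (\<lambda>x. u m x - u n x)\<bar> < e / 2"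
      using assms e unfolding form_tendsto_def by (metis half_gt_zero)
    have "E.nsq (\<lambda>x. u m x - u n x) < e" if "m \<ge> max N1 N2" "n \<ge> max N1 N2" for m n
    proof -
      have "c * nsq (\<lambda>x. u m x - u n x) < e / 2" using N1[of m n] that c0 by (simp add: field_simps)
      then show ?thesis using N2[of m n] that E_nsq[OF E.diff_mem[OF uD uD], of m n] by simp
    qed
    then show "\<exists>N. \<forall>m\<ge>N. \<forall>n\<ge>N. E.nsq (\<lambda>x. u m x - u n x) < e" by blast
  qed
qed

lemma form_tendstoI:
  assumes uD: "\<And>n. u n \<in> D" and U: "U \<in> L2 M" and lim: "(\<lambda>n. nsq (\<lambda>x. u n x - U x)) \<longlonglongrightarrow> 0"
    and cau: "E.cauchy_seq u"
  shows "form_tendsto M D q u U"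
proof -
  have uL: "u n \<in> L2 M" for n using uD D_L2 by blast
  have cau2: "L2.cauchy_seq M u" by (rule L2.tendsto_imp_cauchy_seq[OF uL U lim])
  have "\<exists>N. \<forall>m\<ge>N. \<forall>n\<ge>N. \<bar>q (\<lambda>x. u m x - u n x)\<bar> < e" if e: "e > 0" for e
  proof -
    have c0: "c > 0" using c_ge_1 by simp
    obtain N1 where N1: "\<And>m n. m \<ge> N1 \<Longrightarrow> n \<ge> N1 \<Longrightarrow> nsq (\<lambda>x. u m x - u n x) < e / (2 * c)"
      using cau2 e c0 unfolding L2.cauchy_seq_def by (metis divide_pos_pos mult_pos_pos zero_less_numeral)
    obtain N2 where N2: "\<And>m n. m \<ge> N2 \<Longrightarrow> n \<ge> N2 \<Longrightarrow> E.nsq (\<lambda>x. u m x - u n x) < e / 2"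
      using cau e unfolding E.cauchy_seq_def by (metis half_gt_zero)
    have "\<bar>q (\<lambda>x. u m x - u n x)\<bar> < e" if "m \<ge> max N1 N2" "n \<ge> max N1 N2" for m n
    proof -
      have d: "(\<lambda>x. u m x - u n x) \<in> D" by (rule E.diff_mem[OF uD uD])
      have "c * nsq (\<lambda>x. u m x - u n x) < e / 2" using N1[of m n] that c0 by (simp add: field_simps)
      moreover have "0 \<le> c * nsq (\<lambda>x. u m x - u n x)" using c0 d D_L2 by simp
      moreover have "0 \<le> E.nsq (\<lambda>x. u m x - u n x)" using d by simp
      ultimately show ?thesis using N2[of m n] that E_nsq[OF d] by simp
    qed
    then show ?thesis by blast
  qed
  then show ?thesis using assms L2_tendsto_iff[of u M U] uL by (auto simp: form_tendsto_def)
qed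

lemma form_tendsto_lin:
  assumes u: "form_tendsto M D q u U" and v: "form_tendsto M D q v V"
  shows "form_tendsto M D q (\<lambda>n x. a * u n x + b * v n x) (\<lambda>x. a * U x + b * V x)"
proof (rule form_tendstoI)
  note u = form_tendstoD[OF u] and v = form_tendstoD[OF v]
  show "E.cauchy_seq (\<lambda>n x. a * u n x + b * v n x)"
    using u v by (intro E.cauchy_seq_lin) auto
  show "(\<lambda>n. nsq (\<lambda>x. (a * u n x + b * v n x) - (a * U x + b * V x))) \<longlonglongrightarrow> 0"
  proof (rule tendsto_sandwich[OF _ _ tendsto_const])
    show "(\<lambda>n. 2 * ((cmod a)\<^sup>2 * nsq (\<lambda>x. u n x - U x)) + 2 * ((cmod b)\<^sup>2 * nsq (\<lambda>x. v n x - V x))) \<longlonglongrightarrow> 0"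
      using tendsto_add[OF tendsto_mult_left[OF tendsto_mult_left[OF u(4), of "(cmod a)\<^sup>2"], of 2]
          tendsto_mult_left[OF tendsto_mult_left[OF v(4), of "(cmod b)\<^sup>2"], of 2]] by simp
    have eq: "(\<lambda>x. (a * u n x + b * v n x) - (a * U x + b * V x))
        = (\<lambda>x. a * (u n x - U x) + b * (v n x - V x))" for n by (auto simp: algebra_simps)
    have "nsq (\<lambda>x. a * (u n x - U x) + b * (v n x - V x))
       \<le> 2 * ((cmod a)\<^sup>2 * nsq (\<lambda>x. u n x - U x)) + 2 * ((cmod b)\<^sup>2 * nsq (\<lambda>x. v n x - V x))" for n
    proof -
      have d: "(\<lambda>x. u n x - U x) \<in> L2 M" "(\<lambda>x. v n x - V x) \<in> L2 M" using u v by (auto simp: L2.diff_mem)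
      show ?thesis
        using L2.nsq_add_le[OF L2.scale_mem[OF d(1), of a] L2.scale_mem[OF d(2), of b]]
          L2.nsq_scale[OF d(1), of a] L2.nsq_scale[OF d(2), of b] by simp
    qed
    then show "\<forall>\<^sub>F n in sequentially. nsq (\<lambda>x. (a * u n x + b * v n x) - (a * U x + b * V x))
       \<le> 2 * ((cmod a)\<^sup>2 * nsq (\<lambda>x. u n x - U x)) + 2 * ((cmod b)\<^sup>2 * nsq (\<lambda>x. v n x - V x))"
      unfolding eq by simp
    show "\<forall>\<^sub>F n in sequentially. 0 \<le> nsq (\<lambda>x. (a * u n x + b * v n x) - (a * U x + b * V x))"
      using u v by (intro always_eventually allI L2.nsq_nonneg L2.diff_mem L2.lin_mem) auto
  qed
qed (use form_tendstoD[OF u] form_tendstoD[OF v] in \<open>auto simp: E.lin_mem L2.lin_mem\<close>)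

text \<open>This is where closability enters: the difference of the two sequences tends to zero.\<close>

lemma form_tendsto_unique:
  assumes u: "form_tendsto M D q u U" and v: "form_tendsto M D q v U"
  shows "(\<lambda>n. E.nsq (\<lambda>x. u n x - v n x)) \<longlonglongrightarrow> 0"
proof -
  note uD = form_tendstoD[OF u] and vD = form_tendstoD[OF v]
  have 0: "form_tendsto M D q (\<lambda>n x. u n x - v n x) (\<lambda>x. 0)"
    using form_tendsto_lin[OF u v, of 1 "-1"] by simp
  have "(\<lambda>n. q (\<lambda>x. u n x - v n x)) \<longlonglongrightarrow> 0" using closable 0 unfolding closable_form_def by blast
  moreover have "(\<lambda>n. nsq (\<lambda>x. u n x - v n x)) \<longlonglongrightarrow> 0" using form_tendstoD(4)[OF 0] by simp
  ultimately have "(\<lambda>n. q (\<lambda>x. u n x - v n x) + c * nsq (\<lambda>x. u n x - v n x)) \<longlonglongrightarrow> 0 + c * 0"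
    by (intro tendsto_intros)
  then show ?thesis using uD vD by (simp add: E_nsq E.diff_mem)
qed

text \<open>The definite description in \<open>closure_form\<close> denotes: for one pair of sequences the shifted
  polar form converges by Cauchy-Schwarz, and by \<open>form_tendsto_unique\<close> every other pair has the same limit.\<close>

lemma closure_form_limit:
  assumes u: "form_tendsto M D q u U" and w: "form_tendsto M D q w W"
  shows "(\<lambda>n. P (u n) (w n)) \<longlonglongrightarrow> Q U W"
proof -
  have inn_lim: "(\<lambda>n. inn (u' n) (w' n)) \<longlonglongrightarrow> inn U W"
    if "form_tendsto M D q u' U" "form_tendsto M D q w' W" for u' w'
    using form_tendstoD[OF that(1)] form_tendstoD[OF that(2)] by (intro L2.ip_tendsto) auto
  note uD = form_tendstoD[OF u] and wD = form_tendstoD[OF w]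
  have "convergent (\<lambda>n. E_ip (u n) (w n))"
    using uD wD by (intro E.ip_cauchy) auto
  then obtain z where z: "(\<lambda>n. E_ip (u n) (w n)) \<longlonglongrightarrow> z" by (auto simp: convergent_def)
  \<comment> \<open>The limit for the shifted form is \<open>z\<close>; the shift converges by itself.\<close>
  define y where "y = z - of_real c * inn U W"
  obtain C1 where C1: "\<And>n. E.nsq (u n) \<le> C1" using E.cauchy_seq_bounded uD by blast
  obtain C2 where C2: "\<And>n. E.nsq (w n) \<le> C2" using E.cauchy_seq_bounded wD by blast
  have lim: "(\<lambda>n. P (u' n) (w' n)) \<longlonglongrightarrow> y"
    if u': "form_tendsto M D q u' U" and w': "form_tendsto M D q w' W" for u' w'
  proof -
    note u'D = form_tendstoD[OF u'] and w'D = form_tendstoD[OF w']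
    have "(\<lambda>n. E_ip (u' n) (w' n) - E_ip (u n) (w n)) \<longlonglongrightarrow> 0"
      using u'D w'D uD wD form_tendsto_unique[OF u' u] form_tendsto_unique[OF w' w] C1 C2
      by (intro E.ip_tendsto_cong[where C = "max C1 C2"]) (auto simp: max.coboundedI1 max.coboundedI2)
    from tendsto_add[OF this z] have "(\<lambda>n. E_ip (u' n) (w' n)) \<longlonglongrightarrow> z" by simp
    from tendsto_diff[OF this tendsto_mult[OF tendsto_const[of "of_real c"] inn_lim[OF u' w']]] show ?thesis
      by (simp add: y_def E_ip_def)
  qed
  have "Q U W = y"
    unfolding closure_form_def
  proof (rule the_equality)
    show "\<forall>u w. form_tendsto M D q u U \<longrightarrow> form_tendsto M D q w W \<longrightarrow> (\<lambda>n. P (u n) (w n)) \<longlonglongrightarrow> y"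
      using lim by blast
    fix y' assume "\<forall>u w. form_tendsto M D q u U \<longrightarrow> form_tendsto M D q w W \<longrightarrow> (\<lambda>n. P (u n) (w n)) \<longlonglongrightarrow> y'"
    then have "(\<lambda>n. P (u n) (w n)) \<longlonglongrightarrow> y'" using u w by blast
    then show "y' = y" using lim[OF u w] LIMSEQ_unique by blast
  qed
  then show ?thesis using lim[OF u w] by simp
qed

lemma Dc_seq: assumes "U \<in> Dc" obtains u where "form_tendsto M D q u U"
  using assms unfolding closure_dom_def by blast

lemma Dc_L2: "U \<in> Dc \<Longrightarrow> U \<in> L2 M" by (metis Dc_seq form_tendstoD(3))

lemma form_tendsto_const: assumes "u \<in> D" shows "form_tendsto M D q (\<lambda>_. u) u"
  using assms L2.nsq_def[of M "\<lambda>x. 0"] E.nsq_def[of "\<lambda>x. 0"] D_zero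
  by (intro form_tendstoI) (auto simp: D_L2 L2.zero_mem E.cauchy_seq_def)

lemma D_Dc: "u \<in> D \<Longrightarrow> u \<in> Dc" using form_tendsto_const unfolding closure_dom_def by blast

lemma Q_eq_P: "u \<in> D \<Longrightarrow> w \<in> D \<Longrightarrow> Q u w = P u w"
  using closure_form_limit[OF form_tendsto_const form_tendsto_const, of u w] by (simp add: LIMSEQ_const_iff)

lemma Dc_lin: "U \<in> Dc \<Longrightarrow> V \<in> Dc \<Longrightarrow> (\<lambda>x. a * U x + b * V x) \<in> Dc"
  unfolding closure_dom_def using form_tendsto_lin by blast

lemma Q_lin: assumes "U \<in> Dc" "V \<in> Dc" "W \<in> Dc"
  shows "Q (\<lambda>x. a * U x + b * V x) W = a * Q U W + b * Q V W"
proof -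
  obtain u v w where u: "form_tendsto M D q u U" and v: "form_tendsto M D q v V" and w: "form_tendsto M D q w W"
    using assms Dc_seq by metis
  have "(\<lambda>n. P (\<lambda>x. a * u n x + b * v n x) (w n)) \<longlonglongrightarrow> Q (\<lambda>x. a * U x + b * V x) W"
    by (rule closure_form_limit[OF form_tendsto_lin[OF u v] w])
  moreover have "(\<lambda>n. a * P (u n) (w n) + b * P (v n) (w n)) \<longlonglongrightarrow> a * Q U W + b * Q V W"
    by (intro tendsto_intros closure_form_limit u v w)
  ultimately show ?thesis
    using form_tendstoD(1)[OF u] form_tendstoD(1)[OF v] form_tendstoD(1)[OF w]
    by (simp add: P_lin LIMSEQ_unique)
qed

lemma Q_cnj: assumes "U \<in> Dc" "V \<in> Dc" shows "Q V U = cnj (Q U V)"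
proof -
  obtain u v where u: "form_tendsto M D q u U" and v: "form_tendsto M D q v V"
    using assms Dc_seq by metis
  have "(\<lambda>n. cnj (P (u n) (v n))) \<longlonglongrightarrow> cnj (Q U V)"
    using closure_form_limit[OF u v] tendsto_cnj by blast
  moreover have "cnj (P (u n) (v n)) = P (v n) (u n)" for n
    using P_cnj form_tendstoD(1)[OF u] form_tendstoD(1)[OF v] by metis
  ultimately show ?thesis using closure_form_limit[OF v u] LIMSEQ_unique by simp
qed

lemma Q_lower: assumes "U \<in> Dc" shows "- c * nsq U \<le> Re (Q U U)"
proof -
  obtain u where u: "form_tendsto M D q u U" using assms Dc_seq by metis
  note uD = form_tendstoD[OF u]
  have "(\<lambda>n. - c * nsq (u n)) \<longlonglongrightarrow> - c * nsq U"
    using uD by (intro tendsto_mult_left L2.nsq_tendsto) auto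
  moreover have "(\<lambda>n. Re (P (u n) (u n))) \<longlonglongrightarrow> Re (Q U U)"
    by (intro tendsto_Re closure_form_limit u)
  ultimately show ?thesis
    using lower uD(1) P_self by (elim LIMSEQ_le) (auto simp: uD)
qed

end

section \<open>The variational principle for an operator with compact resolvent\<close>

lemma (in semi_inner_space) nsq_eq_0_of_diff:
  assumes "u \<in> H" "\<phi> \<in> H" "nsq (\<lambda>x. u x - of_real m * \<phi> x) = 0" "nsq u = 0" "m \<noteq> 0"
  shows "nsq \<phi> = 0"
proof -
  have "nsq (\<lambda>x. u x - of_real m * \<phi> x) = nsq u - 2 * Re (ip u (\<lambda>x. of_real m * \<phi> x)) + m\<^sup>2 * nsq \<phi>"
    using assms by (subst nsq_diff) (auto simp: scale_mem nsq_scale)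
  then show ?thesis using assms ip_null[of u "\<lambda>x. of_real m * \<phi> x"] by (simp add: scale_mem)
qed

text \<open>\<open>T\<close> is the graph of the operator that belongs to the closure \<open>Q\<close> of \<open>q\<close>, and \<open>R\<close> below is its
  resolvent \<open>(T + 1)\<^bsup>-1\<^esup>\<close>. An eigenvalue \<open>m\<close> of \<open>R\<close> corresponds to the eigenvalue \<open>1 / m - 1\<close> of \<open>T\<close>.\<close>

locale form_operator_resolvent = closable_form_space +
  fixes T
  assumes T_form: "(U, F) \<in> T \<longleftrightarrow> U \<in> Dc \<and> F \<in> L2 M \<and> (\<forall>W\<in>Dc. Q U W = inn F W)"
    and cr: "compact_resolvent M T"
begin

lemma T_D: assumes "(U, F) \<in> T"
  shows "U \<in> Dc" "U \<in> L2 M" "F \<in> L2 M" "W \<in> Dc \<Longrightarrow> Q U W = inn F W"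
  using assms Dc_L2 by (auto simp: T_form)

lemma T_lin: "(U, F) \<in> T \<Longrightarrow> (V, G) \<in> T \<Longrightarrow> (\<lambda>x. a * U x + b * V x, \<lambda>x. a * F x + b * G x) \<in> T"
  by (auto simp: T_form Dc_lin L2.lin_mem Q_lin L2.ip_lin Dc_L2)

lemma T_cong: assumes "(U, F) \<in> T" "F' \<in> L2 M" "nsq (\<lambda>x. F x - F' x) = 0" shows "(U, F') \<in> T"
proof -
  have "inn F W = inn F' W" if "W \<in> Dc" for W
    using L2.ip_null[of "\<lambda>x. F x - F' x" M W] T_D(3)[OF assms(1)] assms(2,3) Dc_L2[OF that]
    by (simp add: L2.ip_simps)
  then show ?thesis using assms by (auto simp: T_form)
qed

definition R where "R f = (SOME u. (u, \<lambda>x. f x - u x) \<in> T)"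

lemma R_T: "f \<in> L2 M \<Longrightarrow> (R f, \<lambda>x. f x - R f x) \<in> T"
  unfolding R_def using cr by (intro someI_ex[of "\<lambda>u. (u, \<lambda>x. f x - u x) \<in> T"]) (auto simp: compact_resolvent_def)

lemma R_Dc: "f \<in> L2 M \<Longrightarrow> R f \<in> Dc" and R_L2: "f \<in> L2 M \<Longrightarrow> R f \<in> L2 M"
  using R_T T_D by blast+

lemma Q_R: "f \<in> L2 M \<Longrightarrow> W \<in> Dc \<Longrightarrow> Q (R f) W = inn f W - inn (R f) W"
  using T_D(4)[OF R_T[of f], of W] by (simp add: L2.ip_diff R_L2 Dc_L2)

lemma R_sym: assumes "f \<in> L2 M" "g \<in> L2 M" shows "inn (R f) g = inn f (R g)"
proof -
  have "inn f (R g) - inn (R f) (R g) = cnj (inn g (R f) - inn (R g) (R f))"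
    using Q_cnj[of "R g" "R f"] Q_R[OF assms(1), of "R g"] Q_R[OF assms(2), of "R f"] assms by (simp add: R_Dc)
  also have "\<dots> = inn (R f) g - inn (R f) (R g)"
    using L2.ip_cnj[of g M "R f"] L2.ip_cnj[of "R g" M "R f"] assms by (simp add: R_L2)
  finally show ?thesis by simp
qed

lemma R_compact:
  assumes "\<And>n. f n \<in> L2 M" "\<And>n. nsq (f n) \<le> 1"
  shows "\<exists>r h. strict_mono (r :: nat \<Rightarrow> nat) \<and> h \<in> L2 M \<and> (\<lambda>n. nsq (\<lambda>x. R (f (r n)) x - h x)) \<longlonglongrightarrow> 0"
proof -
  have "\<forall>n. f n \<in> L2 M \<and> L2_norm2 M (f n) \<le> 1 \<and> (R (f n), \<lambda>x. f n x - R (f n) x) \<in> T"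
    using assms R_T by (simp add: L2_norm2_eq)
  then obtain r h where r: "strict_mono (r :: nat \<Rightarrow> nat)" and h: "h \<in> L2 M"
    and lim: "L2_tendsto M ((\<lambda>n. R (f n)) \<circ> r) h"
    using cr[unfolded compact_resolvent_def, THEN conjunct2, THEN conjunct2, THEN spec, of f,
        THEN spec, of "\<lambda>n. R (f n)"] by blast
  have "(\<lambda>n. nsq (\<lambda>x. ((\<lambda>n. R (f n)) \<circ> r) n x - h x)) \<longlonglongrightarrow> 0"
    using lim L2_tendsto_iff[of "(\<lambda>n. R (f n)) \<circ> r" M h] h assms by (simp add: R_L2)
  then show ?thesis using r h by auto
qed

lemma eigen_of_R:
  assumes \<phi>: "\<phi> \<in> L2 M" and m: "m \<noteq> 0" and 0: "nsq (\<lambda>x. R \<phi> x - of_real m * \<phi> x) = 0"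
  shows "R \<phi> \<in> eigenspace T (1 / m - 1)"
proof -
  have "nsq (\<lambda>x. (\<phi> x - R \<phi> x) - of_real (1 / m - 1) * R \<phi> x) = nsq (\<lambda>x. of_real (- 1 / m) * (R \<phi> x - of_real m * \<phi> x))"
    using m by (intro arg_cong[of _ _ nsq]) (auto simp: field_simps)
  also have "\<dots> = 0" using \<phi> 0 by (subst L2.nsq_scale) (auto simp: L2.diff_mem L2.scale_mem R_L2)
  finally have "(R \<phi>, \<lambda>x. of_real (1 / m - 1) * R \<phi> x) \<in> T"
    using T_cong[OF R_T[OF \<phi>], of "\<lambda>x. of_real (1 / m - 1) * R \<phi> x"] \<phi> L2.scale_mem R_L2 by blast
  then show ?thesis by (simp add: eigenspace_def)
qed

text \<open>Apply the maximum principle to \<open>-R\<close>: a positive eigenvalue \<open>m\<close> of \<open>-R\<close> would be an eigenvalue \<open>-1 / m - 1 < 0\<close>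
  of \<open>T\<close>.\<close>

lemma resolvent_nonneg:
  assumes no_ev: "\<And>\<mu> u. \<mu> < 0 \<Longrightarrow> u \<in> eigenspace T \<mu> \<Longrightarrow> nsq u = 0" and f: "f \<in> L2 M"
  shows "0 \<le> Re (inn (R f) f)"
proof -
  interpret N: compact_symmetric_operator "L2 M" inn "L2 M" "\<lambda>f x. (-1) * R f x"
  proof
    show "(\<lambda>x. - 1 * R f x) \<in> L2 M" if "f \<in> L2 M" for f using that by (intro L2.scale_mem R_L2)
    show "inn (\<lambda>x. - 1 * R f x) g = inn f (\<lambda>x. - 1 * R g x)" if "f \<in> L2 M" "g \<in> L2 M" for f g
      unfolding L2.ip_scale[OF R_L2[OF that(1)] that(2)] L2.ip_scale_right[OF R_L2[OF that(2)] that(1)]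
      using R_sym[OF that] by simp
    show "\<exists>r h. strict_mono (r :: nat \<Rightarrow> nat) \<and> h \<in> L2 M \<and> (\<lambda>n. nsq (\<lambda>x. - 1 * R (f (r n)) x - h x)) \<longlonglongrightarrow> 0"
      if "\<And>n. f n \<in> L2 M" "\<And>n. nsq (f n) \<le> 1" for f
    proof -
      obtain r h where r: "strict_mono (r :: nat \<Rightarrow> nat)" "h \<in> L2 M" "(\<lambda>n. nsq (\<lambda>x. R (f (r n)) x - h x)) \<longlonglongrightarrow> 0"
        using R_compact[of f] \<open>\<And>n. f n \<in> L2 M\<close> \<open>\<And>n. nsq (f n) \<le> 1\<close> by blast
      have "nsq (\<lambda>x. (-1) * R (f (r n)) x - (-1) * h x) = nsq (\<lambda>x. R (f (r n)) x - h x)" for n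
      proof -
        have "nsq (\<lambda>x. (-1) * R (f (r n)) x - (-1) * h x) = nsq (\<lambda>x. (-1) * (R (f (r n)) x - h x))"
          by (intro arg_cong[of _ _ nsq]) auto
        also have "\<dots> = nsq (\<lambda>x. R (f (r n)) x - h x)"
          using that(1) r(2) by (subst L2.nsq_scale) (auto simp: L2.diff_mem R_L2)
        finally show ?thesis .
      qed
      then show ?thesis using r L2.scale_mem[OF r(2), of "-1"]
        by (intro exI[of _ r] exI[of _ "\<lambda>x. (-1) * h x"]) simp
    qed
  qed (auto simp: L2.zero_mem L2.lin_mem)
  have "Re (inn (\<lambda>x. (-1) * R f x) f) \<le> 0 * nsq f"
  proof (rule N.numerical_range_bound[OF _ _ f])
    fix \<phi> and m :: real
    assume \<phi>: "\<phi> \<in> L2 M" and m: "0 < m" and 0: "nsq (\<lambda>x. - 1 * R \<phi> x - of_real m * \<phi> x) = 0"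
    have "nsq (\<lambda>x. R \<phi> x - of_real (-m) * \<phi> x) = nsq (\<lambda>x. (-1) * (- 1 * R \<phi> x - of_real m * \<phi> x))"
      by (intro arg_cong[of _ _ nsq]) (auto simp: algebra_simps)
    also have "\<dots> = 0"
      unfolding L2.nsq_scale[OF L2.diff_mem[OF L2.scale_mem[OF R_L2[OF \<phi>]] L2.scale_mem[OF \<phi>]]] 0 by simp
    finally have 1: "nsq (\<lambda>x. R \<phi> x - of_real (-m) * \<phi> x) = 0" .
    have "nsq (R \<phi>) = 0"
      using no_ev[OF _ eigen_of_R[OF \<phi> _ 1]] m by (simp add: field_simps)
    then show "nsq \<phi> = 0" using L2.nsq_eq_0_of_diff[OF R_L2[OF \<phi>] \<phi> 1] m by simp
  qed simp
  moreover have "inn (\<lambda>x. (-1) * R f x) f = - inn (R f) f"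
    unfolding L2.ip_scale[OF R_L2[OF f] f] by simp
  ultimately show ?thesis by simp
qed

lemma Q_lin_right: assumes "U \<in> Dc" "V \<in> Dc" "W \<in> Dc"
  shows "Q W (\<lambda>x. a * U x + b * V x) = cnj a * Q W U + cnj b * Q W V"
  using Q_cnj[OF Dc_lin[OF assms(1,2)] assms(3), of a b] Q_cnj[of U W] Q_cnj[of V W] assms
  by (simp add: Q_lin)

lemma Re_Q_sub: assumes U: "U \<in> Dc" and V: "V \<in> Dc"
  shows "Re (Q (\<lambda>x. U x - of_real t * V x) (\<lambda>x. U x - of_real t * V x))
     = Re (Q U U) - 2 * t * Re (Q V U) + t\<^sup>2 * Re (Q V V)"
proof -
  have eq: "(\<lambda>x. U x - of_real t * V x) = (\<lambda>x. 1 * U x + (- of_real t) * V x)" by auto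
  show ?thesis
    unfolding eq Q_lin[OF U V Dc_lin[OF U V]] Q_lin_right[OF U V U] Q_lin_right[OF U V V]
    using Q_cnj[OF V U] by (simp add: power2_eq_square algebra_simps)
qed

lemma shifted_form_sub: assumes w: "w \<in> Dc" and f: "f \<in> L2 M"
  shows "Re (Q (\<lambda>x. w x - of_real t * R f x) (\<lambda>x. w x - of_real t * R f x)) + nsq (\<lambda>x. w x - of_real t * R f x)
     = Re (Q w w) + nsq w - 2 * t * Re (inn f w) + t\<^sup>2 * Re (inn (R f) f)"
proof -
  have wL: "w \<in> L2 M" using w Dc_L2 by blast
  have "nsq (\<lambda>x. w x - of_real t * R f x) = nsq w - 2 * t * Re (inn w (R f)) + t\<^sup>2 * nsq (R f)"
    using wL f by (simp add: L2.nsq_diff L2.scale_mem R_L2 L2.ip_scale_right L2.nsq_scale)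
  moreover have "Re (inn w (R f)) = Re (inn (R f) w)"
    using L2.ip_cnj[of w M "R f"] wL f by (simp add: R_L2)
  moreover have "Re (inn f (R f)) = Re (inn (R f) f)" using R_sym[OF f f] by simp
  ultimately show ?thesis
    using Re_Q_sub[OF w R_Dc[OF f], of t] w f R_L2[OF f]
    by (simp add: Q_R R_Dc L2.ip_self algebra_simps)
qed

text \<open>Since \<open>(Q + 1)(R f, R f) = \<langle>R f, f\<rangle>\<close>, positivity of \<open>R\<close> settles the elements of the range of \<open>R\<close>. For
  a general \<open>w\<close> in the form domain choose \<open>f\<close> with \<open>w \<approx> (R + \<epsilon>) f\<close>. Then \<open>w - R f \<approx> \<epsilon> f\<close>, and expanding
  \<open>(Q + 1)(w - R f) \<ge> -c \<parallel>w - R f\<parallel>\<^sup>2\<close> yields \<open>(Q + 1)(w) \<ge> \<langle>R f, f\<rangle> + (2 \<epsilon> - 2 c \<epsilon>\<^sup>2) \<parallel>f\<parallel>\<^sup>2\<close> up to a multiple of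
  the squared residual. With \<open>\<epsilon> = 1 / (2 c)\<close> the bracket equals \<open>\<epsilon>\<close>, which absorbs the cross terms.\<close>

lemma shifted_form_nonneg:
  assumes no_ev: "\<And>\<mu> u. \<mu> < 0 \<Longrightarrow> u \<in> eigenspace T \<mu> \<Longrightarrow> nsq u = 0" and w: "w \<in> Dc"
  shows "0 \<le> Re (Q w w) + nsq w"
proof (rule field_le_epsilon)
  fix e :: real assume e: "e > 0"
  interpret C: compact_symmetric_operator "L2 M" inn "L2 M" R
  proof
    show "\<exists>r h. strict_mono (r :: nat \<Rightarrow> nat) \<and> h \<in> L2 M \<and> (\<lambda>n. nsq (\<lambda>x. R (f (r n)) x - h x)) \<longlonglongrightarrow> 0"
      if "\<And>n. f n \<in> L2 M" "\<And>n. nsq (f n) \<le> 1" for f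
      using that by (rule R_compact)
  qed (auto simp: L2.zero_mem L2.lin_mem R_L2 R_sym)
  have psd: "0 \<le> Re (inn (R f) f)" if "f \<in> L2 M" for f
    by (rule resolvent_nonneg[OF _ that]) (rule no_ev)
  obtain B where B: "B \<ge> 0" "\<And>f. f \<in> L2 M \<Longrightarrow> nsq (R f) \<le> B * nsq f" using C.R_bounded by blast
  have up: "Re (inn (R f) f) \<le> sqrt B * nsq f" if "f \<in> L2 M" for f
    using C.Re_ip_R_le[OF B that] by simp
  have wL: "w \<in> L2 M" using w Dc_L2 by blast
  define \<epsilon> where "\<epsilon> = 1 / (2 * c)"
  have c0: "c > 0" and \<epsilon>0: "\<epsilon> > 0" and c\<epsilon>: "2 * c * \<epsilon> = 1" using c_ge_1 by (auto simp: \<epsilon>_def)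
  obtain f where f: "f \<in> L2 M" and r_small: "nsq (\<lambda>x. w x - R f x - of_real \<epsilon> * f x) < e / (4 * c)"
    using C.approximate_solution[OF psd up _ \<epsilon>0 _ wL, where \<delta> = "e / (4 * c)"] B(1) e c0 by auto
  define r where "r = (\<lambda>x. w x - R f x - of_real \<epsilon> * f x)"
  have rL: "r \<in> L2 M" unfolding r_def by (intro L2.diff_mem L2.scale_mem wL R_L2 f)
  have vD: "(\<lambda>x. w x - of_real 1 * R f x) \<in> Dc"
    using Dc_lin[OF w R_Dc[OF f], of 1 "-1"] by simp
  have v_eq: "(\<lambda>x. w x - of_real 1 * R f x) = (\<lambda>x. of_real \<epsilon> * f x + r x)" by (auto simp: r_def)
  have "nsq (\<lambda>x. of_real \<epsilon> * f x + r x) \<le> 2 * (\<epsilon>\<^sup>2 * nsq f) + 2 * nsq r"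
    using L2.nsq_add_le[OF L2.scale_mem[OF f, of "of_real \<epsilon>"] rL] f by (simp add: L2.nsq_scale)
  then have nv: "nsq (\<lambda>x. w x - of_real 1 * R f x) \<le> 2 * (\<epsilon>\<^sup>2 * nsq f) + 2 * nsq r"
    unfolding v_eq .
  have "- c * nsq (\<lambda>x. w x - of_real 1 * R f x) \<le> Re (Q (\<lambda>x. w x - of_real 1 * R f x) (\<lambda>x. w x - of_real 1 * R f x))"
    by (rule Q_lower[OF vD])
  moreover have "0 \<le> nsq (\<lambda>x. w x - of_real 1 * R f x)" using vD Dc_L2 by simp
  moreover have "c * nsq (\<lambda>x. w x - of_real 1 * R f x) \<le> c * (2 * (\<epsilon>\<^sup>2 * nsq f) + 2 * nsq r)"
    using nv c0 by (intro mult_left_mono) auto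
  moreover have "c * (2 * (\<epsilon>\<^sup>2 * nsq f) + 2 * nsq r) = \<epsilon> * nsq f + 2 * c * nsq r"
  proof -
    have "c * (2 * (\<epsilon>\<^sup>2 * nsq f) + 2 * nsq r) = (2 * c * \<epsilon>) * \<epsilon> * nsq f + 2 * c * nsq r"
      by (simp add: power2_eq_square algebra_simps)
    then show ?thesis by (simp add: c\<epsilon>)
  qed
  ultimately have 1: "- (\<epsilon> * nsq f + 2 * c * nsq r)
     \<le> Re (Q w w) + nsq w - 2 * Re (inn f w) + Re (inn (R f) f)"
    using shifted_form_sub[OF w f, of 1] by simp
  have "inn f w = inn f (R f) + of_real \<epsilon> * inn f f + inn f r"
  proof -
    have "w = (\<lambda>x. (R f x + of_real \<epsilon> * f x) + r x)" by (auto simp: r_def)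
    then have "inn f w = inn f (\<lambda>x. (R f x + of_real \<epsilon> * f x) + r x)" by simp
    also have "\<dots> = inn f (R f) + of_real \<epsilon> * inn f f + inn f r"
      using f rL by (simp add: L2.ip_simps R_L2)
    finally show ?thesis .
  qed
  then have 2: "Re (inn f w) = Re (inn (R f) f) + \<epsilon> * nsq f + Re (inn f r)"
    using R_sym[OF f f] f by (simp add: L2.ip_self)
  have "0 \<le> nsq (\<lambda>x. of_real \<epsilon> * f x + r x)" using L2.add_mem[OF L2.scale_mem[OF f] rL] by simp
  then have "0 \<le> \<epsilon> * (\<epsilon> * nsq f + 2 * Re (inn f r)) + nsq r"
    unfolding L2.nsq_add[OF L2.scale_mem[OF f] rL] L2.nsq_scale[OF f] L2.ip_scale[OF f rL]
    by (simp add: power2_eq_square algebra_simps)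
  then have "0 \<le> 2 * c * (\<epsilon> * (\<epsilon> * nsq f + 2 * Re (inn f r)) + nsq r)" using c0 by simp
  also have "\<dots> = (2 * c * \<epsilon>) * (\<epsilon> * nsq f + 2 * Re (inn f r)) + 2 * c * nsq r"
    by (simp only: distrib_left mult.assoc)
  finally have 3: "0 \<le> \<epsilon> * nsq f + 2 * Re (inn f r) + 2 * c * nsq r" by (simp add: c\<epsilon>)
  have "4 * c * nsq r < e" using r_small c0 by (simp add: r_def field_simps)
  then show "0 \<le> Re (Q w w) + nsq w + e" using 1 2 3 psd[OF f] by linarith
qed

text \<open>On the orthogonal complement of \<open>B\<close>, which is invariant under \<open>R\<close>, the maximum principle gives
  \<open>R \<le> 1 / (1 + lam)\<close>: a larger eigenvalue of \<open>R\<close> belongs to an eigenvalue of \<open>T\<close> below \<open>lam\<close>, whose eigenvectors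
  are orthogonal to that complement. The bound passes to the form by expanding
  \<open>(Q + 1)(w - (1 + lam) R w) \<ge> 0\<close>.\<close>

lemma form_lower_bound:
  assumes no_ev: "\<And>\<mu> u. \<mu> < 0 \<Longrightarrow> u \<in> eigenspace T \<mu> \<Longrightarrow> nsq u = 0"
    and B: "\<And>b. b \<in> B \<Longrightarrow> \<exists>\<mu>\<ge>0. b \<in> eigenspace T \<mu>"
    and lam: "0 \<le> lam"
    and span: "\<And>\<mu> u f. \<mu> < lam \<Longrightarrow> u \<in> eigenspace T \<mu> \<Longrightarrow> f \<in> L2 M \<Longrightarrow> (\<forall>b\<in>B. inn f b = 0) \<Longrightarrow> inn u f = 0"
    and w: "w \<in> Dc" "\<forall>b\<in>B. inn w b = 0"
  shows "lam * nsq w \<le> Re (Q w w)"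
proof -
  define K where "K = {f \<in> L2 M. \<forall>b\<in>B. inn f b = 0}"
  have B_L2: "b \<in> L2 M" if "b \<in> B" for b using B[OF that] T_D(2) by (auto simp: eigenspace_def)
  have R_K: "R f \<in> K" if f: "f \<in> K" for f
  proof -
    have fL: "f \<in> L2 M" using f by (simp add: K_def)
    have "inn (R f) b = 0" if b: "b \<in> B" for b
    proof -
      obtain \<mu> where \<mu>: "\<mu> \<ge> 0" "(b, \<lambda>x. of_real \<mu> * b x) \<in> T" using B[OF b] by (auto simp: eigenspace_def)
      have "cnj (Q b (R f)) = of_real \<mu> * inn (R f) b"
        using T_D(4)[OF \<mu>(2) R_Dc[OF fL]] L2.ip_cnj[OF B_L2[OF b] R_L2[OF fL]] B_L2[OF b] R_L2[OF fL]
        by (simp add: L2.ip_scale)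
      moreover have "cnj (Q b (R f)) = inn f b - inn (R f) b"
        using Q_cnj[OF T_D(1)[OF \<mu>(2)] R_Dc[OF fL]] Q_R[OF fL T_D(1)[OF \<mu>(2)]] by simp
      ultimately have "of_real (1 + \<mu>) * inn (R f) b = 0" using f b by (simp add: K_def algebra_simps)
      moreover have "complex_of_real (1 + \<mu>) \<noteq> 0" using \<mu>(1) of_real_eq_0_iff[of "1 + \<mu>"] by simp
      ultimately show ?thesis by simp
    qed
    then show ?thesis using R_L2[OF fL] by (simp add: K_def)
  qed
  interpret C: compact_symmetric_operator "L2 M" inn K R
  proof
    show "(\<lambda>x. a * f x + b * g x) \<in> K" if "f \<in> K" "g \<in> K" for f g a b
      using that B_L2 by (auto simp: K_def L2.lin_mem L2.ip_lin)
    show "\<exists>r h. strict_mono (r :: nat \<Rightarrow> nat) \<and> h \<in> L2 M \<and> (\<lambda>n. nsq (\<lambda>x. R (f (r n)) x - h x)) \<longlonglongrightarrow> 0"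
      if "\<And>n. f n \<in> K" "\<And>n. nsq (f n) \<le> 1" for f
      using that by (intro R_compact) (auto simp: K_def)
    show "h \<in> K" if "\<And>n. f n \<in> K" and h: "h \<in> L2 M" and lim: "(\<lambda>n. nsq (\<lambda>x. f n x - h x)) \<longlonglongrightarrow> 0" for f h
    proof -
      have fL: "f n \<in> L2 M" for n using that(1)[of n] by (simp add: K_def)
      have "inn h b = 0" if b: "b \<in> B" for b
      proof -
        have "(\<lambda>n. inn (f n) b) \<longlonglongrightarrow> inn h b"
          using fL h lim B_L2[OF b] by (intro L2.ip_tendsto) (auto simp: L2.nsq_def L2.zero_mem)
        moreover have "inn (f n) b = 0" for n using \<open>\<And>n. f n \<in> K\<close>[of n] b by (simp add: K_def)
        ultimately show ?thesis by (simp add: LIMSEQ_const_iff)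
      qed
      then show ?thesis using h by (simp add: K_def)
    qed
  qed (use R_K R_sym B_L2 in \<open>auto simp: K_def L2.zero_mem\<close>)
  have wK: "w \<in> K" and wL: "w \<in> L2 M" using w Dc_L2 by (auto simp: K_def)
  have "Re (inn (R w) w) \<le> (1 / (1 + lam)) * nsq w"
  proof (rule C.numerical_range_bound[OF _ _ wK])
    show "0 \<le> 1 / (1 + lam)" using lam by simp
    fix \<phi> m assume \<phi>: "\<phi> \<in> K" and m: "1 / (1 + lam) < m"
      and 0: "nsq (\<lambda>x. R \<phi> x - of_real m * \<phi> x) = 0"
    have \<phi>L: "\<phi> \<in> L2 M" using \<phi> by (simp add: K_def)
    have m0: "m > 0" using m lam by (smt (verit) divide_nonneg_nonneg)
    have "1 / m - 1 < lam" using m m0 lam by (simp add: field_simps)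
    then have "inn (R \<phi>) \<phi> = 0"
      using span[OF _ eigen_of_R[OF \<phi>L _ 0]] \<phi> m0 by (auto simp: K_def)
    moreover have "inn (\<lambda>x. R \<phi> x - of_real m * \<phi> x) \<phi> = 0"
      using L2.ip_null[OF _ \<phi>L 0] \<phi>L by (simp add: L2.ip_simps R_L2)
    ultimately have "of_real m * inn \<phi> \<phi> = 0" using \<phi>L by (simp add: L2.ip_simps R_L2)
    then show "nsq \<phi> = 0" using m0 by (simp add: L2.nsq_def)
  qed
  then have "(1 + lam)\<^sup>2 * Re (inn (R w) w) \<le> (1 + lam)\<^sup>2 * ((1 / (1 + lam)) * nsq w)"
    by (intro mult_left_mono) auto
  also have "\<dots> = (1 + lam) * nsq w" using lam by (simp add: power2_eq_square)
  finally have 1: "(1 + lam)\<^sup>2 * Re (inn (R w) w) \<le> (1 + lam) * nsq w" .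
  define v where "v = (\<lambda>x. w x - of_real (1 + lam) * R w x)"
  have vD: "v \<in> Dc"
  proof -
    have "v = (\<lambda>x. 1 * w x + (- of_real (1 + lam)) * R w x)" by (auto simp: v_def algebra_simps)
    then show ?thesis using Dc_lin[OF w(1) R_Dc[OF wL], of 1 "- of_real (1 + lam)"] by (simp only:)
  qed
  have "0 \<le> Re (Q v v) + nsq v" by (rule shifted_form_nonneg[OF no_ev vD])
  also have "\<dots> = Re (Q w w) + nsq w - 2 * (1 + lam) * Re (inn w w) + (1 + lam)\<^sup>2 * Re (inn (R w) w)"
    unfolding v_def by (rule shifted_form_sub[OF w(1) wL])
  also have "\<dots> \<le> Re (Q w w) + nsq w - 2 * (1 + lam) * nsq w + (1 + lam) * nsq w"
    using 1 by (simp add: L2.nsq_def)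
  finally show ?thesis by (simp add: algebra_simps)
qed


text \<open>\<open>B\<close> consists of bases of all eigenspaces for eigenvalues below \<open>lam = ev (k + 1)\<close>; as \<open>ev\<close> is
  nondecreasing, these eigenvalues have indices at most \<open>k\<close>. Let \<open>p\<close> be the orthogonal projection of \<open>e\<close>
  to the span of \<open>B\<close>, and \<open>w = e - p\<close>. The mixed terms \<open>Q p w\<close> vanish because \<open>T p\<close> is again in the span,
  so \<open>q e = Q w w + Q p p\<close> with \<open>Q w w \<ge> lam \<parallel>w\<parallel>\<^sup>2\<close> and \<open>Q p p \<ge> 0\<close>.\<close>

lemma kroeger_variational_bound:
  assumes ev: "eigenvalue_enumeration M T ev" and pos: "0 < ev 1"
  shows "\<exists>U. finite U \<and> U \<subseteq> L2 M \<and> card U \<le> k \<and> (\<forall>u\<in>U. nsq u = 1) \<and>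
    (\<forall>e\<in>D. ev (k + 1) * (nsq e - (\<Sum>u\<in>U. (cmod (inn e u))\<^sup>2)) \<le> q e)"
proof -
  have mono: "ev i \<le> ev j" if "1 \<le> i" "i \<le> j" for i j using ev that unfolding eigenvalue_enumeration_def by blast
  have fin: "finite {j. 1 \<le> j \<and> ev j = \<mu>}" for \<mu> using ev unfolding eigenvalue_enumeration_def by blast
  define m where "m \<mu> = card {j. 1 \<le> j \<and> ev j = \<mu>}" for \<mu>
  have "has_dimension M (eigenspace T \<mu>) (m \<mu>)" for \<mu> using ev unfolding eigenvalue_enumeration_def m_def by blast
  then have "\<exists>\<phi>. (\<forall>i<m \<mu>. \<phi> i \<in> eigenspace T \<mu>) \<and>
      (\<forall>u\<in>eigenspace T \<mu>. \<exists>a. AE x in M. u x = (\<Sum>i<m \<mu>. a i * \<phi> i x))" for \<mu>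
    unfolding has_dimension_def by blast
  then obtain \<phi> where \<phi>: "\<And>\<mu> i. i < m \<mu> \<Longrightarrow> \<phi> \<mu> i \<in> eigenspace T \<mu>"
    "\<And>\<mu> u. u \<in> eigenspace T \<mu> \<Longrightarrow> \<exists>a. AE x in M. u x = (\<Sum>i<m \<mu>. a i * \<phi> \<mu> i x)" by metis
  have eig_L2: "u \<in> L2 M" if "u \<in> eigenspace T \<mu>" for u \<mu>
    using that T_D(2) by (auto simp: eigenspace_def)
  have null_space: "nsq u = 0" if "\<And>j. 1 \<le> j \<Longrightarrow> ev j \<noteq> \<mu>" "u \<in> eigenspace T \<mu>" for u \<mu>
  proof -
    have "{j. 1 \<le> j \<and> ev j = \<mu>} = {}" using that(1) by blast
    then have "m \<mu> = 0" unfolding m_def by (simp only: card.empty)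
    then show ?thesis using \<phi>(2)[OF that(2)] by (auto intro: L2_nsq_eq_0I)
  qed
  have no_ev1: "nsq u = 0" if "\<mu> < ev 1" "u \<in> eigenspace T \<mu>" for u \<mu>
    using null_space[OF _ that(2)] mono[of 1] that(1) by (metis linorder_not_le order_refl)
  have no_ev: "nsq u = 0" if "\<mu> < 0" "u \<in> eigenspace T \<mu>" for u \<mu>
    using no_ev1[OF _ that(2)] that(1) pos by simp
  \<comment> \<open>For \<open>lam = ev 1\<close> there is nothing to project away.\<close>
  have Q_pos: "0 \<le> Re (Q w w)" if w: "w \<in> Dc" for w
  proof -
    have "ev 1 * nsq w \<le> Re (Q w w)"
    proof (rule form_lower_bound[where B = "{}"])
      show "inn u f = 0" if "\<mu> < ev 1" "u \<in> eigenspace T \<mu>" "f \<in> L2 M" for \<mu> u f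
        using no_ev1[OF that(1,2)] L2.ip_null eig_L2[OF that(2)] that(3) by blast
    qed (use no_ev pos w in auto)
    moreover have "0 \<le> ev 1 * nsq w" using pos Dc_L2[OF w] by simp
    ultimately show ?thesis by linarith
  qed
  define lam where "lam = ev (k + 1)"
  have lam: "0 < lam" using mono[of 1 "k + 1"] pos by (simp add: lam_def)
  define \<Lambda> where "\<Lambda> = ev ` {j. 1 \<le> j \<and> ev j < lam}"
  have sub: "{j. 1 \<le> j \<and> ev j < lam} \<subseteq> {1..k}"
    using mono[of "k + 1"] unfolding lam_def by (auto simp: linorder_not_less[symmetric])
  then have fin_lam: "finite {j. 1 \<le> j \<and> ev j < lam}" by (rule finite_subset) simp
  then have fin_\<Lambda>: "finite \<Lambda>" unfolding \<Lambda>_def by blast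
  define B where "B = (\<Union>\<mu>\<in>\<Lambda>. \<phi> \<mu> ` {..<m \<mu>})"
  have B_eig: "\<exists>\<mu>\<ge>0. b \<in> eigenspace T \<mu>" if b: "b \<in> B" for b
  proof -
    obtain j i where "1 \<le> j" "i < m (ev j)" "b = \<phi> (ev j) i" using b by (auto simp: B_def \<Lambda>_def)
    then show ?thesis using \<phi>(1) mono[of 1 j] pos by (intro exI[of _ "ev j"]) auto
  qed
  have B_L2: "b \<in> L2 M" if "b \<in> B" for b using B_eig[OF that] eig_L2 by blast
  have card_B: "card B \<le> k"
  proof -
    have "card B \<le> (\<Sum>\<mu>\<in>\<Lambda>. card (\<phi> \<mu> ` {..<m \<mu>}))" unfolding B_def by (rule card_UN_le[OF fin_\<Lambda>])
    also have "\<dots> \<le> (\<Sum>\<mu>\<in>\<Lambda>. m \<mu>)" by (intro sum_mono order_trans[OF card_image_le]) auto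
    also have "\<dots> = card (\<Union>\<mu>\<in>\<Lambda>. {j. 1 \<le> j \<and> ev j = \<mu>})"
      unfolding m_def using fin_\<Lambda> fin by (intro card_UN_disjoint[symmetric]) auto
    also have "\<dots> \<le> card {1..k}" using sub by (intro card_mono) (auto simp: \<Lambda>_def)
    finally show ?thesis by simp
  qed
  have fin_B: "finite B" unfolding B_def using fin_\<Lambda> by blast
  have span: "inn u f = 0"
    if \<mu>: "\<mu> < lam" and u: "u \<in> eigenspace T \<mu>" and f: "f \<in> L2 M" "\<forall>b\<in>B. inn f b = 0" for \<mu> u f
  proof (cases "\<mu> \<in> \<Lambda>")
    case False
    then have "nsq u = 0" using \<mu> by (intro null_space[OF _ u]) (auto simp: \<Lambda>_def)
    then show ?thesis using L2.ip_null[OF eig_L2[OF u] f(1)] by simp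
  next
    case True
    obtain a where a: "AE x in M. u x = (\<Sum>i<m \<mu>. a i * \<phi> \<mu> i x)" using \<phi>(2)[OF u] by blast
    let ?s = "\<lambda>x. \<Sum>i<m \<mu>. a i * \<phi> \<mu> i x"
    have \<phi>L: "\<phi> \<mu> i \<in> L2 M" if "i < m \<mu>" for i using eig_L2 \<phi>(1)[OF that] by blast
    have s: "?s \<in> L2 M" using \<phi>L by (intro L2.sum_mem) auto
    have "nsq (\<lambda>x. u x - ?s x) = 0" using a by (intro L2_nsq_eq_0I) auto
    then have "inn u f = inn ?s f"
      using L2.ip_null[of "\<lambda>x. u x - ?s x" M f] eig_L2[OF u] s f by (simp add: L2.ip_simps)
    also have "\<dots> = (\<Sum>i<m \<mu>. a i * inn (\<phi> \<mu> i) f)" using \<phi>L f by (intro L2.ip_sum) auto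
    also have "\<dots> = 0"
    proof (intro sum.neutral ballI)
      fix i assume i: "i \<in> {..<m \<mu>}"
      then have "inn f (\<phi> \<mu> i) = 0" using f(2) True by (auto simp: B_def)
      then show "a i * inn (\<phi> \<mu> i) f = 0" using L2.ip_cnj[OF f(1) \<phi>L, of i] i by simp
    qed
    finally show ?thesis .
  qed
  define K where "K = {f \<in> L2 M. \<forall>b\<in>B. inn f b = 0}"
  \<comment> \<open>The vectors \<open>u\<close> such that both \<open>u\<close> and \<open>T u\<close> are orthogonal to \<open>K\<close>, a linear condition that holds on \<open>B\<close>.\<close>
  define W where "W = {u. \<exists>F. (u, F) \<in> T \<and> (\<forall>f\<in>K. inn f u = 0 \<and> inn f F = 0)}"
  have K_L2: "f \<in> L2 M" if "f \<in> K" for f using that by (simp add: K_def)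
  have W_L2: "W \<subseteq> L2 M" using T_D(2) by (auto simp: W_def)
  have W_lin: "(\<lambda>x. a * f x + b * g x) \<in> W" if fg: "f \<in> W" "g \<in> W" for f g a b
  proof -
    obtain F where F: "(f, F) \<in> T" "\<And>h. h \<in> K \<Longrightarrow> inn h f = 0 \<and> inn h F = 0" using fg(1) by (auto simp: W_def)
    obtain G where G: "(g, G) \<in> T" "\<And>h. h \<in> K \<Longrightarrow> inn h g = 0 \<and> inn h G = 0" using fg(2) by (auto simp: W_def)
    have "inn h (\<lambda>x. a * f x + b * g x) = 0 \<and> inn h (\<lambda>x. a * F x + b * G x) = 0" if "h \<in> K" for h
      using F(2)[OF that] G(2)[OF that] T_D(2,3)[OF F(1)] T_D(2,3)[OF G(1)] K_L2[OF that]
      by (simp add: L2.ip_lin_right)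
    then show ?thesis using T_lin[OF F(1) G(1), of a b] unfolding W_def by blast
  qed
  have BW: "B \<subseteq> W"
  proof
    fix b assume b: "b \<in> B"
    obtain \<mu> where \<mu>: "(b, \<lambda>x. of_real \<mu> * b x) \<in> T" using B_eig[OF b] by (auto simp: eigenspace_def)
    have "inn f b = 0 \<and> inn f (\<lambda>x. of_real \<mu> * b x) = 0" if "f \<in> K" for f
      using that b B_L2[OF b] by (simp add: K_def L2.ip_scale_right)
    then show "b \<in> W" using \<mu> unfolding W_def by blast
  qed
  have W0: "(\<lambda>x. 0) \<in> W"
  proof -
    have "(\<lambda>x. 0) \<in> Dc" using D_zero D_Dc by blast
    then have "(\<lambda>x. 0, \<lambda>x. 0) \<in> T"
      using Q_lin[of "\<lambda>x. 0" "\<lambda>x. 0" _ 0 0] by (simp add: T_form L2.zero_mem Dc_L2)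
    then show ?thesis unfolding W_def using K_L2 by (auto intro!: exI[of _ "\<lambda>x. 0"])
  qed
  have "\<exists>U. finite U \<and> U \<subseteq> W \<and> card U \<le> card B \<and>
    (\<forall>u\<in>U. \<forall>v\<in>U. inn u v = (if u = v then 1 else 0)) \<and>
    (\<forall>f\<in>L2 M. (\<forall>u\<in>U. inn f u = 0) \<longrightarrow> (\<forall>b\<in>B. inn f b = 0))"
    by (rule L2.gram_schmidt[OF fin_B BW W_L2 W0]) (rule W_lin)
  then obtain U where U: "finite U" "U \<subseteq> W" "card U \<le> card B"
    "\<forall>u\<in>U. \<forall>v\<in>U. inn u v = (if u = v then 1 else 0)"
    "\<forall>f\<in>L2 M. (\<forall>u\<in>U. inn f u = 0) \<longrightarrow> (\<forall>b\<in>B. inn f b = 0)"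
    by (elim exE conjE, intro that)
  have U_L2: "u \<in> L2 M" if "u \<in> U" for u using U(2) W_L2 that by blast
  have main: "lam * (nsq e - (\<Sum>u\<in>U. (cmod (inn e u))\<^sup>2)) \<le> q e" if e: "e \<in> D" for e
  proof -
    have eL: "e \<in> L2 M" and eDc: "e \<in> Dc" using e D_L2 D_Dc by auto
    define p where "p = (\<lambda>x. \<Sum>u\<in>U. inn e u * u x)"
    define w where "w = (\<lambda>x. e x - p x)"
    have "p \<in> W" unfolding p_def by (rule lin_closed_sum[OF W0 _ U(1,2)]) (rule W_lin)
    then obtain F where F: "(p, F) \<in> T" "\<And>f. f \<in> K \<Longrightarrow> inn f p = 0 \<and> inn f F = 0" by (auto simp: W_def)
    note pF = T_D[OF F(1)]
    have wDc: "w \<in> Dc" using Dc_lin[OF eDc pF(1), of 1 "-1"] by (simp add: w_def)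
    then have wL: "w \<in> L2 M" using Dc_L2 by blast
    have p_ip: "inn p v = inn e v" if v: "v \<in> U" for v
    proof -
      have "inn p v = (\<Sum>u\<in>U. inn e u * inn u v)" unfolding p_def using U_L2 v by (intro L2.ip_sum) auto
      also have "\<dots> = (\<Sum>u\<in>U. if u = v then inn e u else 0)" using U(4) v by (intro sum.cong) auto
      finally show ?thesis using U(1) v by simp
    qed
    have w_orth: "inn w v = 0" if "v \<in> U" for v
      using p_ip[OF that] U_L2[OF that] eL pF(2) by (simp add: w_def L2.ip_simps)
    then have w_B: "\<forall>b\<in>B. inn w b = 0" using U(5) wL by blast
    then have wK: "w \<in> K" using wL by (simp add: K_def)
    have wp: "inn w p = 0" "inn w F = 0" using F(2)[OF wK] by auto
    then have Fw: "inn F w = 0" using L2.ip_cnj[OF wL pF(3)] by simp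
    have "inn p e = (\<Sum>u\<in>U. of_real ((cmod (inn e u))\<^sup>2))"
    proof -
      have "inn p e = (\<Sum>u\<in>U. inn e u * inn u e)" unfolding p_def using U_L2 eL by (intro L2.ip_sum) auto
      also have "\<dots> = (\<Sum>u\<in>U. of_real ((cmod (inn e u))\<^sup>2))"
        using L2.ip_cnj[OF eL U_L2] by (intro sum.cong refl) (simp only: complex_norm_square)
      finally show ?thesis .
    qed
    moreover have "nsq w = Re (inn w e)"
    proof -
      have "inn w w = inn w (\<lambda>x. e x - p x)" by (simp add: w_def)
      also have "\<dots> = inn w e" using wp wL eL pF(2) by (simp add: L2.ip_diff_right)
      finally show ?thesis by (simp add: L2.nsq_def)
    qed
    moreover have "inn w e = inn e e - inn p e" using eL pF(2) by (simp add: w_def L2.ip_diff)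
    ultimately have nsq_w: "nsq w = nsq e - (\<Sum>u\<in>U. (cmod (inn e u))\<^sup>2)"
      by (simp add: L2.nsq_def)
    have e_eq: "e = (\<lambda>x. 1 * w x + 1 * p x)" by (auto simp: w_def)
    have Qpw: "Q p w = 0" using pF(4)[OF wDc] Fw by simp
    then have Qwp: "Q w p = 0" using Q_cnj[OF pF(1) wDc] by simp
    have "Q e e = Q (\<lambda>x. 1 * w x + 1 * p x) (\<lambda>x. 1 * w x + 1 * p x)" using e_eq by metis
    also have "\<dots> = Q w w + Q p p"
      unfolding Q_lin[OF wDc pF(1) Dc_lin[OF wDc pF(1)]] Q_lin_right[OF wDc pF(1) wDc] Q_lin_right[OF wDc pF(1) pF(1)]
      by (simp add: Qpw Qwp)
    finally have "of_real (q e) = Q w w + Q p p" using Q_eq_P[OF e e] P_self[OF e] by simp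
    from arg_cong[OF this, of Re] have "q e = Re (Q w w) + Re (Q p p)" by simp
    moreover have "lam * nsq w \<le> Re (Q w w)"
    proof (rule form_lower_bound[OF _ _ _ _ wDc w_B])
      show "nsq u = 0" if "\<mu> < 0" "u \<in> eigenspace T \<mu>" for \<mu> u by (rule no_ev[OF that])
      show "\<exists>\<mu>\<ge>0. b \<in> eigenspace T \<mu>" if "b \<in> B" for b by (rule B_eig[OF that])
      show "inn u f = 0" if "\<mu> < lam" "u \<in> eigenspace T \<mu>" "f \<in> L2 M" "\<forall>b\<in>B. inn f b = 0" for \<mu> u f
        by (rule span[OF that])
    qed (use lam in simp)
    ultimately show ?thesis using Q_pos[OF pF(1)] nsq_w by simp
  qed
  have "\<forall>u\<in>U. nsq u = 1" using U(4) by (simp add: L2.nsq_def)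
  moreover have "U \<subseteq> L2 M" using U_L2 by blast
  ultimately show ?thesis using U(1,3) card_B main unfolding lam_def
    by (intro exI[of _ U]) auto
qed

end

section \<open>Test functions and uniqueness of weak gradients\<close>

primrec smooth_upto :: "nat \<Rightarrow> (real \<Rightarrow> real) \<Rightarrow> bool" where
  "smooth_upto 0 f \<longleftrightarrow> True"
| "smooth_upto (Suc m) f \<longleftrightarrow> (\<exists>f'. (\<forall>x. (f has_real_derivative f' x) (at x)) \<and> smooth_upto m f')"

lemma smooth_upto_SucD: "smooth_upto (Suc m) f \<Longrightarrow> smooth_upto m f"
  by (induction m arbitrary: f) auto

lemma smooth_upto_const: "smooth_upto m (\<lambda>x. c)"
  by (induction m arbitrary: c) (auto intro!: DERIV_const exI[of _ "\<lambda>x. 0"])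

lemma smooth_upto_add: "smooth_upto m f \<Longrightarrow> smooth_upto m g \<Longrightarrow> smooth_upto m (\<lambda>x. f x + g x)"
proof (induction m arbitrary: f g)
  case (Suc m)
  then obtain f' g' where d: "\<And>x. (f has_real_derivative f' x) (at x)" "\<And>x. (g has_real_derivative g' x) (at x)"
    and s: "smooth_upto m f'" "smooth_upto m g'" by auto
  have "((\<lambda>x. f x + g x) has_real_derivative f' x + g' x) (at x)" for x by (intro DERIV_add d)
  then show ?case
    unfolding smooth_upto.simps by (intro exI[of _ "\<lambda>x. f' x + g' x"] conjI allI Suc.IH[OF s])
qed simp

lemma smooth_upto_mult: "smooth_upto m f \<Longrightarrow> smooth_upto m g \<Longrightarrow> smooth_upto m (\<lambda>x. f x * g x)"
proof (induction m arbitrary: f g)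
  case (Suc m)
  then obtain f' g' where d: "\<And>x. (f has_real_derivative f' x) (at x)" "\<And>x. (g has_real_derivative g' x) (at x)"
    and s: "smooth_upto m f'" "smooth_upto m g'" by auto
  have "((\<lambda>x. f x * g x) has_real_derivative f' x * g x + g' x * f x) (at x)" for x by (intro DERIV_mult d)
  moreover have "smooth_upto m (\<lambda>x. f' x * g x + g' x * f x)"
    by (rule smooth_upto_add[OF Suc.IH[OF s(1) smooth_upto_SucD[OF Suc.prems(2)]]
          Suc.IH[OF s(2) smooth_upto_SucD[OF Suc.prems(1)]]])
  ultimately show ?case
    unfolding smooth_upto.simps by (intro exI[of _ "\<lambda>x. f' x * g x + g' x * f x"] conjI allI)
qed simp

lemma smooth_upto_affine: "smooth_upto m f \<Longrightarrow> smooth_upto m (\<lambda>x. f (a * x + b))"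
proof (induction m arbitrary: f)
  case (Suc m)
  then obtain f' where d: "\<And>x. (f has_real_derivative f' x) (at x)" and s: "smooth_upto m f'" by auto
  have "((\<lambda>x. f (a * x + b)) has_real_derivative f' (a * x + b) * a) (at x)" for x
    by (rule DERIV_chain2[OF d]) (auto intro!: derivative_eq_intros)
  moreover have "smooth_upto m (\<lambda>x. f' (a * x + b) * a)"
    by (rule smooth_upto_mult[OF Suc.IH[OF s] smooth_upto_const])
  ultimately show ?case
    unfolding smooth_upto.simps by (intro exI[of _ "\<lambda>x. f' (a * x + b) * a"] conjI allI)
qed simp

text \<open>For \<open>p = 1\<close> this is the classical smooth function that is flat at \<open>0\<close>. The polynomial is there to make
  the class closed under differentiation.\<close>

definition flat :: "real poly \<Rightarrow> real \<Rightarrow> real" where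
  "flat p t = (if t > 0 then poly p (1 / t) * exp (- (1 / t)) else 0)"

lemma poly_exp_tendsto_0: "((\<lambda>s::real. poly p s * exp (- s)) \<longlongrightarrow> 0) at_top"
proof -
  have "((\<lambda>s::real. \<Sum>i\<le>degree p. coeff p i * (s ^ i / exp s)) \<longlongrightarrow> (\<Sum>i\<le>degree p. coeff p i * 0)) at_top"
    by (intro tendsto_sum tendsto_mult tendsto_const tendsto_power_div_exp_0)
  moreover have "(\<Sum>i\<le>degree p. coeff p i * (s ^ i / exp s)) = poly p s * exp (- s)" for s :: real
    by (simp add: poly_altdef sum_distrib_right exp_minus divide_inverse mult.assoc)
  ultimately show ?thesis by simp
qed

lemma flat_deriv: "(flat p has_real_derivative flat ([:0, 0, 1:] * (p - pderiv p)) t) (at t)"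
proof -
  consider "t > 0" | "t < 0" | "t = 0" by linarith
  then show ?thesis
  proof cases
    case 1
    have "((\<lambda>t. poly p (1 / t) * exp (- (1 / t))) has_real_derivative
        poly (pderiv p) (1 / t) * (- 1 / (t * t)) * exp (- (1 / t)) + (exp (- (1 / t)) * (1 / (t * t))) * poly p (1 / t)) (at t)"
    proof (rule DERIV_mult)
      have inv: "((\<lambda>t. 1 / t) has_real_derivative - 1 / (t * t)) (at t)"
        using 1 by (auto intro!: derivative_eq_intros)
      show "((\<lambda>t. poly p (1 / t)) has_real_derivative poly (pderiv p) (1 / t) * (- 1 / (t * t))) (at t)"
        by (rule DERIV_chain2[OF poly_DERIV inv])
      show "((\<lambda>t. exp (- (1 / t))) has_real_derivative exp (- (1 / t)) * (1 / (t * t))) (at t)"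
        using 1 by (auto intro!: derivative_eq_intros)
    qed
    then have "((\<lambda>t. poly p (1 / t) * exp (- (1 / t))) has_real_derivative
        flat ([:0, 0, 1:] * (p - pderiv p)) t) (at t)"
      using 1 by (simp add: flat_def field_simps)
    then show ?thesis
      by (rule has_field_derivative_transform_within_open[where S = "{0<..}"]) (use 1 in \<open>auto simp: flat_def\<close>)
  next
    case 2
    have "((\<lambda>t. 0) has_real_derivative flat ([:0, 0, 1:] * (p - pderiv p)) t) (at t)"
      using 2 by (simp add: flat_def)
    then show ?thesis
      by (rule has_field_derivative_transform_within_open[where S = "{..<0}"]) (use 2 in \<open>auto simp: flat_def\<close>)
  next
    case 3
    have "((\<lambda>y. (flat p y - flat p 0) / (y - 0)) \<longlongrightarrow> 0) (at 0)"
    proof (rule filterlim_split_at)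
      have "((\<lambda>y. 0) \<longlongrightarrow> 0) (at_left (0::real))" by simp
      then show "((\<lambda>y. (flat p y - flat p 0) / (y - 0)) \<longlongrightarrow> 0) (at_left 0)"
        by (rule Lim_transform_eventually) (auto simp: flat_def eventually_at_left_field intro!: exI[of _ "-1"])
      have "((\<lambda>y::real. poly ([:0, 1:] * p) (inverse y) * exp (- inverse y)) \<longlongrightarrow> 0) (at_right 0)"
        by (rule filterlim_compose[OF poly_exp_tendsto_0 filterlim_inverse_at_top_right])
      then show "((\<lambda>y. (flat p y - flat p 0) / (y - 0)) \<longlongrightarrow> 0) (at_right 0)"
        by (rule Lim_transform_eventually)
          (auto simp: flat_def eventually_at_right_field inverse_eq_divide intro!: exI[of _ 1])
    qed
    then show ?thesis using 3 by (simp add: has_field_derivative_iff flat_def)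
  qed
qed

lemma smooth_upto_flat: "smooth_upto m (flat p)"
proof (induction m arbitrary: p)
  case (Suc m)
  show ?case unfolding smooth_upto.simps using flat_deriv Suc.IH by blast
qed simp

text \<open>A partial derivative of a product of functions of single coordinates is again such a product. The
  order of differentiability drops by one because \<open>smooth_upto 0\<close> does not include continuity.\<close>

lemma Ck_on_prod:
  fixes g :: "'n::finite \<Rightarrow> real \<Rightarrow> real"
  assumes "\<And>i. smooth_upto (Suc m) (g i)"
  shows "Ck_on m (\<lambda>x :: real ^ 'n. \<Prod>i\<in>UNIV. g i (x $ i)) UNIV"
  using assms
proof (induction m arbitrary: g)
  case 0
  then have "\<forall>i. \<exists>g'. \<forall>x. (g i has_real_derivative g' x) (at x)" by auto
  then have "continuous_on UNIV (g i)" for i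
    by (meson DERIV_isCont continuous_at_imp_continuous_on)
  then have "continuous_on UNIV (\<lambda>x :: real ^ 'n. g i (x $ i))" for i
    by (rule continuous_on_compose2) (auto intro: continuous_intros)
  then show ?case by (simp add: continuous_on_prod)
next
  case (Suc m)
  then have "\<forall>i. \<exists>g'. (\<forall>x. (g i has_real_derivative g' x) (at x)) \<and> smooth_upto (Suc m) g'" by auto
  then obtain g' where d: "\<And>i x. (g i has_real_derivative g' i x) (at x)"
    and s: "\<And>i. smooth_upto (Suc m) (g' i)" by metis
  have hd: "((\<lambda>x :: real ^ 'n. \<Prod>i\<in>UNIV. g i (x $ i)) has_derivative
      (\<lambda>y. \<Sum>i\<in>UNIV. (g' i (x $ i) * (y $ i)) * (\<Prod>j\<in>UNIV - {i}. g j (x $ j)))) (at x)" for x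
  proof (rule has_derivative_prod)
    fix i
    have "((\<lambda>x :: real ^ 'n. x $ i) has_derivative (\<lambda>y. y $ i)) (at x)"
      by (rule bounded_linear_imp_has_derivative[OF bounded_linear_vec_nth])
    moreover have "(g i has_derivative (*) (g' i (x $ i))) (at (x $ i))"
      using d[of i "x $ i"] by (simp add: has_field_derivative_def)
    ultimately show "((\<lambda>x. g i (x $ i)) has_derivative (\<lambda>y. g' i (x $ i) * y $ i)) (at x)"
      by (rule has_derivative_compose)
  qed
  have "frechet_derivative (\<lambda>x :: real ^ 'n. \<Prod>i\<in>UNIV. g i (x $ i)) (at x) (axis k 1)
      = (\<Prod>i\<in>UNIV. (if i = k then g' i else g i) (x $ i))" for x k
  proof -
    have "frechet_derivative (\<lambda>x :: real ^ 'n. \<Prod>i\<in>UNIV. g i (x $ i)) (at x) (axis k 1)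
       = (\<Sum>i\<in>UNIV. (g' i (x $ i) * (axis k 1 $ i)) * (\<Prod>j\<in>UNIV - {i}. g j (x $ j)))"
      by (simp add: frechet_derivative_at[OF hd[of x], symmetric])
    also have "\<dots> = (\<Sum>i\<in>UNIV. if i = k then g' i (x $ i) * (\<Prod>j\<in>UNIV - {i}. g j (x $ j)) else 0)"
      by (intro sum.cong refl) (simp add: axis_def)
    also have "\<dots> = g' k (x $ k) * (\<Prod>j\<in>UNIV - {k}. g j (x $ j))" by simp
    also have "\<dots> = (\<Prod>i\<in>UNIV. (if i = k then g' i else g i) (x $ i))"
      by (subst (2) prod.remove[of _ k]) (auto intro!: prod.cong)
    finally show ?thesis .
  qed
  moreover have "Ck_on m (\<lambda>x :: real ^ 'n. \<Prod>i\<in>UNIV. (if i = k then g' i else g i) (x $ i)) UNIV" for k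
    using s Suc.prems by (intro Suc.IH) (auto intro: smooth_upto_SucD simp del: smooth_upto.simps)
  moreover have "(\<lambda>x :: real ^ 'n. \<Prod>i\<in>UNIV. g i (x $ i)) differentiable (at x)" for x
    by (rule differentiableI[OF hd])
  ultimately show ?case by simp
qed

lemma smooth_on_prod:
  fixes g :: "'n::finite \<Rightarrow> real \<Rightarrow> real"
  assumes "\<And>i m. smooth_upto m (g i)"
  shows "smooth_on (\<lambda>x :: real ^ 'n. \<Prod>i\<in>UNIV. g i (x $ i)) UNIV"
  unfolding smooth_on_def using Ck_on_prod assms by blast

text \<open>Smooth functions supported in the closed box, which increase to the indicator of the open box as \<open>n\<close> grows.\<close>

definition bump :: "nat \<Rightarrow> real ^ 'n \<Rightarrow> real ^ 'n \<Rightarrow> real ^ 'n \<Rightarrow> real" where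
  "bump n a b x = (\<Prod>i\<in>UNIV. flat 1 (real n * (x $ i) + (- real n * a $ i)) * flat 1 (- real n * (x $ i) + real n * b $ i))"

lemma flat_1_bounds: "0 \<le> flat 1 t" "flat 1 t \<le> 1" "flat 1 t \<noteq> 0 \<longleftrightarrow> t > 0"
  by (auto simp: flat_def)

lemma bump_bounds: "0 \<le> bump n a b x" "bump n a b x \<le> 1"
  unfolding bump_def using flat_1_bounds
  by (auto intro!: prod_nonneg prod_le_1 mult_le_one simp del: of_nat_mult)

lemma smooth_on_bump: "smooth_on (bump n a b) UNIV"
  unfolding bump_def by (rule smooth_on_prod) (rule smooth_upto_mult[OF smooth_upto_affine smooth_upto_affine]; rule smooth_upto_flat)

lemma bump_zero: "x \<notin> box a b \<Longrightarrow> bump n a b x = 0"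
proof -
  assume "x \<notin> box a b"
  then obtain i where "x $ i \<le> a $ i \<or> b $ i \<le> x $ i" by (auto simp: mem_box_cart not_less)
  then have "flat 1 (real n * (x $ i) + (- real n * a $ i)) * flat 1 (- real n * (x $ i) + real n * b $ i) = 0"
  proof
    assume "x $ i \<le> a $ i"
    then have "real n * (x $ i) + (- real n * a $ i) \<le> 0" by (simp add: mult_left_mono)
    then show ?thesis by (simp add: flat_def)
  next
    assume "b $ i \<le> x $ i"
    then have "- real n * (x $ i) + real n * b $ i \<le> 0" by (simp add: mult_left_mono)
    then show ?thesis by (simp add: flat_def)
  qed
  then show ?thesis unfolding bump_def by (subst prod_zero_iff) auto
qed

lemma test_function_bump: assumes "cbox a b \<subseteq> \<Omega>" shows "test_function \<Omega> (bump n a b)"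
proof -
  have "{x. bump n a b x \<noteq> 0} \<subseteq> cbox a b" using bump_zero box_subset_cbox by blast
  then have sub: "closure {x. bump n a b x \<noteq> 0} \<subseteq> cbox a b" by (rule closure_minimal) (rule closed_cbox)
  then have "compact (closure {x. bump n a b x \<noteq> 0})"
    by (meson bounded_cbox bounded_subset closed_closure compact_eq_bounded_closed)
  then show ?thesis using smooth_on_bump sub assms unfolding test_function_def by blast
qed

lemma bump_tendsto: "(\<lambda>n. bump n a b x) \<longlonglongrightarrow> indicator (box a b) x"
proof (cases "x \<in> box a b")
  case False
  then show ?thesis by (simp add: bump_zero)
next
  case True
  have lim: "(\<lambda>n. flat 1 (real n * t)) \<longlonglongrightarrow> 1" if t: "t > 0" for t
  proof -
    have "(\<lambda>n. exp (- (1 / t) * (1 / real n))) \<longlonglongrightarrow> exp (- (1 / t) * 0)"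
      by (intro tendsto_intros lim_1_over_n)
    then have "(\<lambda>n. exp (- (1 / t) * (1 / real n))) \<longlonglongrightarrow> 1" by simp
    then show ?thesis
    proof (rule Lim_transform_eventually)
      show "\<forall>\<^sub>F n in sequentially. exp (- (1 / t) * (1 / real n)) = flat 1 (real n * t)"
        using eventually_gt_at_top[of 0]
        by eventually_elim (use t in \<open>auto simp: flat_def field_simps\<close>)
    qed
  qed
  have "(\<lambda>n. bump n a b x) \<longlonglongrightarrow> (\<Prod>i\<in>(UNIV::'a set). 1 * 1)"
    unfolding bump_def
  proof (intro tendsto_prod tendsto_mult)
    fix i
    show "(\<lambda>n. flat 1 (real n * x $ i + - real n * a $ i)) \<longlonglongrightarrow> 1"
      using lim[of "x $ i - a $ i"] True by (simp add: mem_box_cart algebra_simps)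
    show "(\<lambda>n. flat 1 (- real n * x $ i + real n * b $ i)) \<longlonglongrightarrow> 1"
      using lim[of "b $ i - x $ i"] True by (simp add: mem_box_cart algebra_simps)
  qed
  then show ?thesis using True by simp
qed

lemma test_function_continuous: "test_function \<Omega> \<phi> \<Longrightarrow> continuous_on UNIV \<phi>"
  unfolding test_function_def smooth_on_def by (metis Ck_on.simps(1))

lemma continuous_lebesgue_measurable:
  fixes f :: "'a::euclidean_space \<Rightarrow> 'b::topological_space"
  shows "continuous_on UNIV f \<Longrightarrow> f \<in> borel_measurable lebesgue"
  by (intro measurable_completion) (simp add: borel_measurable_continuous_onI)

lemma test_function_bounded:
  assumes "test_function \<Omega> \<phi>" shows "\<exists>C. \<forall>x. \<bar>\<phi> x\<bar> \<le> C"
proof -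
  let ?K = "closure {x. \<phi> x \<noteq> 0}"
  have "compact (\<phi> ` ?K)"
    using assms test_function_continuous[OF assms] unfolding test_function_def
    by (intro compact_continuous_image) (auto intro: continuous_on_subset)
  then obtain C where C: "\<And>y. y \<in> \<phi> ` ?K \<Longrightarrow> norm y \<le> C" using compact_imp_bounded[of "\<phi> ` ?K"] unfolding bounded_iff by blast
  have "\<bar>\<phi> x\<bar> \<le> max C 0" for x
  proof (cases "\<phi> x = 0")
    case False
    then have "x \<in> ?K" by (intro subsetD[OF closure_subset]) simp
    then have "norm (\<phi> x) \<le> C" by (intro C imageI)
    then show ?thesis by simp
  qed simp
  then show ?thesis by blast
qed

lemma integrable_times_test_function:
  fixes g :: "real ^ 'n \<Rightarrow> complex"
  assumes \<Omega>: "open \<Omega>" and loc: "\<And>K. compact K \<Longrightarrow> K \<subseteq> \<Omega> \<Longrightarrow> g absolutely_integrable_on K"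
    and \<phi>: "test_function \<Omega> \<phi>"
  shows "integrable (lebesgue_on \<Omega>) (\<lambda>x. g x * of_real (\<phi> x))"
proof -
  let ?K = "closure {x. \<phi> x \<noteq> 0}"
  have K: "compact ?K" "?K \<subseteq> \<Omega>" using \<phi> by (auto simp: test_function_def)
  have gK: "integrable lebesgue (\<lambda>x. indicator ?K x *\<^sub>R g x)" using loc[OF K] by (simp add: set_integrable_def)
  obtain C where C: "\<And>x. \<bar>\<phi> x\<bar> \<le> C" using test_function_bounded[OF \<phi>] by blast
  have m\<phi>: "(\<lambda>x. complex_of_real (\<phi> x)) \<in> borel_measurable lebesgue"
    by (intro continuous_lebesgue_measurable continuous_on_of_real test_function_continuous[OF \<phi>])
  have "integrable lebesgue (\<lambda>x. (indicator ?K x *\<^sub>R g x) * of_real (\<phi> x))"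
  proof (rule Bochner_Integration.integrable_bound)
    show "integrable lebesgue (\<lambda>x. C *\<^sub>R norm (indicator ?K x *\<^sub>R g x))"
      by (intro integrable_scaleR_right integrable_norm gK)
    show "(\<lambda>x. (indicator ?K x *\<^sub>R g x) * of_real (\<phi> x)) \<in> borel_measurable lebesgue"
      by (rule borel_measurable_times[OF borel_measurable_integrable[OF gK] m\<phi>])
    show "AE x in lebesgue. norm ((indicator ?K x *\<^sub>R g x) * of_real (\<phi> x)) \<le> norm (C *\<^sub>R norm (indicator ?K x *\<^sub>R g x))"
    proof (rule AE_I2)
      fix x
      have "norm (indicator ?K x *\<^sub>R g x) * \<bar>\<phi> x\<bar> \<le> norm (indicator ?K x *\<^sub>R g x) * \<bar>C\<bar>"
        using C[of x] by (intro mult_left_mono) auto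
      then show "norm ((indicator ?K x *\<^sub>R g x) * of_real (\<phi> x)) \<le> norm (C *\<^sub>R norm (indicator ?K x *\<^sub>R g x))"
        by (simp add: norm_mult mult.commute)
    qed
  qed
  moreover have "(indicator ?K x *\<^sub>R g x) * of_real (\<phi> x) = indicator \<Omega> x *\<^sub>R (g x * of_real (\<phi> x))" for x
  proof (cases "\<phi> x = 0")
    case False
    then have xK: "x \<in> ?K" by (intro subsetD[OF closure_subset]) simp
    then have "x \<in> \<Omega>" using K(2) by (rule subsetD[rotated])
    with xK show ?thesis by simp
  qed simp
  ultimately have "integrable lebesgue (\<lambda>x. indicator \<Omega> x *\<^sub>R (g x * of_real (\<phi> x)))" by (simp only:)
  then show ?thesis using \<Omega> by (subst integrable_restrict_space) auto
qed

lemma box_integral_eq_0: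
  fixes f :: "real ^ 'n \<Rightarrow> complex"
  assumes \<Omega>: "open \<Omega>" and loc: "\<And>K. compact K \<Longrightarrow> K \<subseteq> \<Omega> \<Longrightarrow> f absolutely_integrable_on K"
    and zero: "\<And>\<phi>. test_function \<Omega> \<phi> \<Longrightarrow> (LINT x|lebesgue_on \<Omega>. f x * of_real (\<phi> x)) = 0"
    and sub: "cbox a b \<subseteq> \<Omega>"
  shows "integral (box a b) f = 0"
proof -
  let ?F = "\<lambda>x. indicator (cbox a b) x *\<^sub>R f x"
  have F: "integrable lebesgue ?F" using loc[OF compact_cbox sub] by (simp add: set_integrable_def)
  have m: "(\<lambda>x. complex_of_real (bump n a b x)) \<in> borel_measurable lebesgue" for n
    by (intro continuous_lebesgue_measurable continuous_on_of_real test_function_continuous[OF test_function_bump[OF sub]])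
  have 0: "(LINT x|lebesgue. ?F x * of_real (bump n a b x)) = 0" for n
  proof -
    have "(LINT x|lebesgue. ?F x * of_real (bump n a b x)) = (LINT x|lebesgue. indicator \<Omega> x *\<^sub>R (f x * of_real (bump n a b x)))"
    proof (intro Bochner_Integration.integral_cong refl)
      fix x
      show "?F x * of_real (bump n a b x) = indicator \<Omega> x *\<^sub>R (f x * of_real (bump n a b x))"
      proof (cases "x \<in> box a b")
        case True
        then have "x \<in> cbox a b" "x \<in> \<Omega>" using subsetD[OF box_subset_cbox] subsetD[OF sub] by blast+
        then show ?thesis by simp
      qed (simp add: bump_zero)
    qed
    also have "\<dots> = (LINT x|lebesgue_on \<Omega>. f x * of_real (bump n a b x))"
      using \<Omega> by (subst integral_restrict_space) auto
    also have "\<dots> = 0" by (rule zero[OF test_function_bump[OF sub]])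
    finally show ?thesis .
  qed
  have "(\<lambda>n. LINT x|lebesgue. ?F x * of_real (bump n a b x)) \<longlonglongrightarrow> (LINT x|lebesgue. ?F x * of_real (indicator (box a b) x))"
  proof (rule integral_dominated_convergence[where w = "\<lambda>x. norm (?F x)"])
    show "integrable lebesgue (\<lambda>x. norm (?F x))" by (rule integrable_norm[OF F])
    show "(\<lambda>x. ?F x * of_real (bump n a b x)) \<in> borel_measurable lebesgue" for n
      by (rule borel_measurable_times[OF borel_measurable_integrable[OF F] m])
    show "(\<lambda>x. ?F x * of_real (indicator (box a b) x)) \<in> borel_measurable lebesgue"
    proof (rule borel_measurable_times[OF borel_measurable_integrable[OF F]])
      have [measurable]: "box a b \<in> sets lebesgue" by simp
      show "(\<lambda>x. complex_of_real (indicator (box a b) x)) \<in> borel_measurable lebesgue" by measurable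
    qed
    show "AE x in lebesgue. (\<lambda>n. ?F x * of_real (bump n a b x)) \<longlonglongrightarrow> ?F x * of_real (indicator (box a b) x)"
      by (intro AE_I2 tendsto_intros bump_tendsto)
    show "AE x in lebesgue. norm (?F x * of_real (bump n a b x)) \<le> norm (?F x)" for n
    proof (rule AE_I2)
      fix x
      have "norm (?F x) * \<bar>bump n a b x\<bar> \<le> norm (?F x) * 1"
        using bump_bounds[of n a b x] by (intro mult_left_mono) auto
      then show "norm (?F x * of_real (bump n a b x)) \<le> norm (?F x)" by (simp add: norm_mult)
    qed
  qed
  then have "(LINT x|lebesgue. ?F x * of_real (indicator (box a b) x)) = 0"
    unfolding 0 by (simp only: LIMSEQ_const_iff)
  also have "(\<lambda>x. ?F x * of_real (indicator (box a b) x)) = (\<lambda>x. indicator (box a b) x *\<^sub>R f x)"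
  proof (rule ext)
    fix x
    show "?F x * of_real (indicator (box a b) x) = indicator (box a b) x *\<^sub>R f x"
      using subsetD[OF box_subset_cbox, of x a b] by (cases "x \<in> box a b") auto
  qed
  finally have "(LINT x:box a b|lebesgue. f x) = 0" by (simp add: set_lebesgue_integral_def)
  moreover have "f absolutely_integrable_on box a b"
    using loc[OF compact_cbox sub] by (rule set_integrable_subset) (auto simp: box_subset_cbox)
  ultimately show ?thesis using set_lebesgue_integral_eq_integral(2) by metis
qed

text \<open>The fundamental lemma of the calculus of variations. Testing against \<open>bump\<close> shows that \<open>f\<close>
  has integral zero over every box, so Lebesgue's differentiation theorem gives the claim in each box, and countably
  many boxes cover \<open>\<Omega>\<close>.\<close>

lemma fundamental_lemma:
  fixes f :: "real ^ 'n \<Rightarrow> complex"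
  assumes \<Omega>: "open \<Omega>" and loc: "\<And>K. compact K \<Longrightarrow> K \<subseteq> \<Omega> \<Longrightarrow> f absolutely_integrable_on K"
    and zero: "\<And>\<phi>. test_function \<Omega> \<phi> \<Longrightarrow> (LINT x|lebesgue_on \<Omega>. f x * of_real (\<phi> x)) = 0"
  shows "AE x in lebesgue_on \<Omega>. f x = 0"
proof -
  have box: "negligible {x \<in> cbox a b. f x \<noteq> 0}" if sub: "cbox a b \<subseteq> \<Omega>" for a b
  proof -
    define F where "F = (\<lambda>x. if x \<in> cbox a b then f x else 0)"
    have "f integrable_on cbox a b"
      using loc[OF compact_cbox sub] set_lebesgue_integral_eq_integral(1) by blast
    then have "F integrable_on UNIV" by (simp add: F_def integrable_restrict_UNIV)
    then have "F integrable_on cbox c d" for c d by (rule integrable_on_subcbox) auto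
    then obtain N where N: "negligible N"
      "\<And>x e. x \<notin> N \<Longrightarrow> 0 < e \<Longrightarrow> \<exists>d>0. \<forall>h. 0 < h \<and> h < d \<longrightarrow>
        norm (integral (cbox x (x + h *\<^sub>R One)) F /\<^sub>R h ^ DIM(real ^ 'n) - F x) < e"
      using integrable_ccontinuous_explicit[of F] by metis
    have "f x = 0" if x: "x \<in> box a b" "x \<notin> N" for x
    proof (rule ccontr)
      assume "f x \<noteq> 0"
      then have "norm (f x) > 0" by simp
      from N(2)[OF x(2) this] obtain d where d: "d > 0"
        "\<And>h. 0 < h \<Longrightarrow> h < d \<Longrightarrow> norm (integral (cbox x (x + h *\<^sub>R One)) F /\<^sub>R h ^ DIM(real ^ 'n) - F x) < norm (f x)" by blast
      obtain r where r: "r > 0" "ball x r \<subseteq> box a b" using x(1) open_box open_contains_ball by blast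
      \<comment> \<open>Cubes of side less than \<open>s\<close> with corner \<open>x\<close> stay inside the ball of radius \<open>r\<close>.\<close>
      define s where "s = r / (norm (One :: real ^ 'n) + 1)"
      define h where "h = min (d / 2) (s / 2)"
      have s: "s > 0" using r(1) by (simp add: s_def add_nonneg_pos)
      have h: "0 < h" "h < d" "h < s" using d(1) s by (auto simp: h_def min_def)
      have sub2: "cbox x (x + h *\<^sub>R One) \<subseteq> box a b"
      proof -
        have "cbox x (x + h *\<^sub>R One) \<subseteq> cball x (norm (h *\<^sub>R (One :: real ^ 'n)))"
        proof
          fix y assume y: "y \<in> cbox x (x + h *\<^sub>R One)"
          have "norm (y - x) \<le> norm (h *\<^sub>R (One :: real ^ 'n))"
            by (rule norm_le_componentwise) (use y h in \<open>auto simp: mem_box inner_diff_left inner_add_left\<close>)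
          then show "y \<in> cball x (norm (h *\<^sub>R (One :: real ^ 'n)))" by (simp add: dist_norm norm_minus_commute)
        qed
        moreover have "norm (h *\<^sub>R (One :: real ^ 'n)) < r"
        proof -
          have "norm (h *\<^sub>R (One :: real ^ 'n)) = h * norm (One :: real ^ 'n)" using h by simp
          also have "\<dots> \<le> h * (norm (One :: real ^ 'n) + 1)" using h by (intro mult_left_mono) auto
          also have "\<dots> < s * (norm (One :: real ^ 'n) + 1)" using h(3) by (intro mult_strict_right_mono) (auto simp: add_nonneg_pos)
          also have "\<dots> = r"
          proof -
            have "norm (One :: real ^ 'n) + 1 \<noteq> 0" using norm_ge_zero[of "One :: real ^ 'n"] by linarith
            then show ?thesis by (simp add: s_def)
          qed
          finally show ?thesis .
        qed
        then have "cball x (norm (h *\<^sub>R (One :: real ^ 'n))) \<subseteq> ball x r" by (simp add: cball_subset_ball_iff)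
        ultimately show ?thesis using r(2) by (meson subset_trans)
      qed
      have "integral (cbox x (x + h *\<^sub>R One)) F = integral (cbox x (x + h *\<^sub>R One)) f"
        using sub2 box_subset_cbox[of a b] by (intro Henstock_Kurzweil_Integration.integral_cong) (auto simp: F_def)
      also have "\<dots> = integral (box x (x + h *\<^sub>R One)) f" by (simp add: integral_open_interval)
      also have "\<dots> = 0"
        using sub2 box_subset_cbox[of a b] sub by (intro box_integral_eq_0[OF \<Omega> loc zero]) auto
      finally have "norm (F x) < norm (f x)" using d(2)[OF h(1,2)] by simp
      moreover have "F x = f x" using x(1) box_subset_cbox[of a b] by (auto simp: F_def)
      ultimately show False by simp
    qed
    then have "{x \<in> cbox a b. f x \<noteq> 0} \<subseteq> N \<union> (cbox a b - box a b)" by blast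
    moreover have "negligible (N \<union> (cbox a b - box a b))"
      using N(1) negligible_frontier_interval by (rule negligible_Un)
    ultimately show ?thesis by (rule negligible_subset[rotated])
  qed
  obtain \<D> where \<D>: "countable \<D>" "\<D> \<subseteq> Pow \<Omega>" "\<And>X. X \<in> \<D> \<Longrightarrow> \<exists>a b. X = cbox a b" "\<Union>\<D> = \<Omega>"
    using open_countable_Union_open_cbox[OF \<Omega>] by metis
  have "negligible (\<Union>X\<in>\<D>. {x \<in> X. f x \<noteq> 0})"
  proof (rule negligible_countable_Union)
    show "countable ((\<lambda>X. {x \<in> X. f x \<noteq> 0}) ` \<D>)" using \<D>(1) by simp
    show "negligible S" if S: "S \<in> (\<lambda>X. {x \<in> X. f x \<noteq> 0}) ` \<D>" for S
    proof -
      obtain X where X: "X \<in> \<D>" "S = {x \<in> X. f x \<noteq> 0}" using S by blast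
      then obtain a b where "X = cbox a b" using \<D>(3) by blast
      moreover have "X \<subseteq> \<Omega>" using X(1) \<D>(2) by blast
      ultimately show ?thesis using box X(2) by blast
    qed
  qed
  moreover have "(\<Union>X\<in>\<D>. {x \<in> X. f x \<noteq> 0}) = {x \<in> \<Omega>. f x \<noteq> 0}" using \<D>(4) by blast
  ultimately have "{x \<in> \<Omega>. f x \<noteq> 0} \<in> null_sets lebesgue" by (simp add: negligible_iff_null_sets)
  then have "AE x in lebesgue. x \<notin> {x \<in> \<Omega>. f x \<noteq> 0}" by (rule AE_not_in)
  then have "AE x in lebesgue. x \<in> \<Omega> \<longrightarrow> f x = 0" by (rule AE_mp) auto
  then show ?thesis using \<Omega> by (subst AE_restrict_space_iff) auto
qed

lemma weak_gradient_unique: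
  assumes \<Omega>: "open \<Omega>" and G: "weak_gradient \<Omega> u G" "weak_gradient \<Omega> u G'"
  shows "AE x in lebesgue_on \<Omega>. G x = G' x"
proof -
  have comp: "(\<lambda>x. H x $ i) absolutely_integrable_on K"
    if "weak_gradient \<Omega> u H" "compact K" "K \<subseteq> \<Omega>" for H i K
  proof -
    have "integrable lebesgue (\<lambda>x. indicator K x *\<^sub>R H x)"
      using that by (auto simp: weak_gradient_def L1_loc_def set_integrable_def)
    from integrable_bounded_linear[OF bounded_linear_vec_nth this, of i]
    show ?thesis by (simp add: set_integrable_def)
  qed
  have "AE x in lebesgue_on \<Omega>. G x $ i - G' x $ i = 0" for i
  proof (rule fundamental_lemma[OF \<Omega>])
    show "(\<lambda>x. G x $ i - G' x $ i) absolutely_integrable_on K" if "compact K" "K \<subseteq> \<Omega>" for K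
      using comp[OF G(1) that, of i] comp[OF G(2) that, of i] by (rule set_integral_diff(1))
    fix \<phi> assume \<phi>: "test_function \<Omega> \<phi>"
    have "integrable (lebesgue_on \<Omega>) (\<lambda>x. G x $ i * of_real (\<phi> x))"
      "integrable (lebesgue_on \<Omega>) (\<lambda>x. G' x $ i * of_real (\<phi> x))"
      using comp G by (auto intro!: integrable_times_test_function[OF \<Omega> _ \<phi>])
    moreover have "(LINT x|lebesgue_on \<Omega>. G x $ i * of_real (\<phi> x)) = (LINT x|lebesgue_on \<Omega>. G' x $ i * of_real (\<phi> x))"
    proof -
      have "(LINT x|lebesgue_on \<Omega>. u x * of_real (frechet_derivative \<phi> (at x) (axis i 1))) =
        - (LINT x|lebesgue_on \<Omega>. H x $ i * of_real (\<phi> x))" if "weak_gradient \<Omega> u H" for H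
        using that \<phi> unfolding weak_gradient_def by blast
      from this[OF G(1)] this[OF G(2)] show ?thesis by (simp only: neg_equal_iff_equal)
    qed
    ultimately show "(LINT x|lebesgue_on \<Omega>. (G x $ i - G' x $ i) * of_real (\<phi> x)) = 0"
      by (simp add: left_diff_distrib)
  qed
  then have "AE x in lebesgue_on \<Omega>. \<forall>i. G x $ i - G' x $ i = 0" by (simp add: AE_all_countable)
  then show ?thesis by (rule AE_mp) (auto simp: vec_eq_iff)
qed

section \<open>Integration by parts and plane waves\<close>

lemma lborel_integral_translation:
  fixes f :: "'a::euclidean_space \<Rightarrow> 'b::{banach, second_countable_topology}"
  assumes [measurable]: "f \<in> borel_measurable borel"
  shows "(LINT x|lborel. f (c + x)) = (LINT x|lborel. f x)"
proof -
  have "(LINT x|lborel. f x) = (LINT x|distr lborel borel ((+) c). f x)" by (simp add: lborel_distr_plus)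
  also have "\<dots> = (LINT x|lborel. f (c + x))" by (rule integral_distr) auto
  finally show ?thesis by simp
qed

lemma integrable_compact_support:
  fixes f :: "'a::euclidean_space \<Rightarrow> 'b::{banach, second_countable_topology}"
  assumes "continuous_on UNIV f" "compact K" "\<And>x. x \<notin> K \<Longrightarrow> f x = 0"
  shows "integrable lborel f"
proof -
  have "integrable lborel (\<lambda>x. indicator K x *\<^sub>R f x)"
    using assms by (intro borel_integrable_compact) (auto intro: continuous_on_subset)
  moreover have "(\<lambda>x. indicator K x *\<^sub>R f x) = f" using assms(3) by (auto simp: indicator_def fun_eq_iff)
  ultimately show ?thesis by simp
qed

text \<open>Each difference quotient \<open>(\<psi>(x + t b) - \<psi>(x)) / t\<close> has integral zero by translation invariance. Their
  limit as \<open>t \<rightarrow> 0\<close> is taken by dominated convergence; the majorant comes from the mean value theorem.\<close>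

lemma integral_directional_derivative_eq_0:
  fixes \<psi> \<psi>' :: "'a::euclidean_space \<Rightarrow> complex"
  assumes deriv: "\<And>x. ((\<lambda>t. \<psi> (x + t *\<^sub>R b)) has_vector_derivative \<psi>' x) (at 0)"
    and cont: "continuous_on UNIV \<psi>" "continuous_on UNIV \<psi>'"
    and K: "compact K" and supp: "\<And>x. x \<notin> K \<Longrightarrow> \<psi> x = 0" "\<And>x. x \<notin> K \<Longrightarrow> \<psi>' x = 0"
  shows "(LINT x|lborel. \<psi>' x) = 0"
proof -
  have deriv_t: "((\<lambda>t. \<psi> (x + t *\<^sub>R b)) has_vector_derivative \<psi>' (x + s *\<^sub>R b)) (at s)" for x s
  proof -
    have "((\<lambda>t. \<psi> ((x + s *\<^sub>R b) + t *\<^sub>R b)) \<circ> (\<lambda>t. t - s) has_vector_derivative 1 *\<^sub>R \<psi>' (x + s *\<^sub>R b)) (at s)"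
      using deriv[of "x + s *\<^sub>R b"]
      by (intro vector_diff_chain_at) (auto intro!: derivative_eq_intros)
    then show ?thesis by (simp add: o_def algebra_simps)
  qed
  have int: "integrable lborel \<psi>" by (rule integrable_compact_support[OF cont(1) K supp(1)])
  have "bounded (\<psi>' ` K)" using cont(2) K by (intro compact_imp_bounded compact_continuous_image) (auto intro: continuous_on_subset)
  then obtain C0 where C0: "\<And>x. x \<in> K \<Longrightarrow> norm (\<psi>' x) \<le> C0" unfolding bounded_iff by blast
  define C where "C = max C0 0"
  have C: "norm (\<psi>' x) \<le> C" for x
    using C0[of x] supp(2)[of x] by (cases "x \<in> K") (auto simp: C_def)
  obtain r where r: "\<And>x. x \<in> K \<Longrightarrow> norm x \<le> r" using compact_imp_bounded[OF K] unfolding bounded_iff by blast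
  \<comment> \<open>Difference quotients with step at most one vanish outside this ball.\<close>
  define B where "B = cball (0::'a) (r + norm b)"
  define t where "t n = 1 / real (Suc n)" for n
  have t: "0 < t n" "t n \<le> 1" for n by (auto simp: t_def field_simps)
  define D where "D n x = (1 / t n) *\<^sub>R (\<psi> (x + t n *\<^sub>R b) - \<psi> x)" for n x
  have bound: "norm (D n x) \<le> C * indicator B x" for n x
  proof (cases "x \<in> B")
    case True
    have "norm (\<psi> (x + t n *\<^sub>R b) - \<psi> (x + 0 *\<^sub>R b)) \<le> C * t n - C * 0"
    proof (rule differentiable_bound_general[where f = "\<lambda>s. \<psi> (x + s *\<^sub>R b)" and \<phi> = "\<lambda>s. C * s"
          and f' = "\<lambda>s. \<psi>' (x + s *\<^sub>R b)" and \<phi>' = "\<lambda>s. C"])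
      show "continuous_on {0..t n} (\<lambda>s. \<psi> (x + s *\<^sub>R b))"
        by (rule continuous_on_compose2[OF cont(1)]) (auto intro!: continuous_intros)
    qed (use t deriv_t C in \<open>auto intro!: continuous_intros derivative_eq_intros\<close>)
    then have "norm (D n x) \<le> (1 / t n) * (C * t n)"
      using t(1)[of n] unfolding D_def by (simp add: pos_divide_le_eq)
    then show ?thesis using True t(1)[of n] by simp
  next
    case False
    have "x \<notin> K" using False r[of x] norm_ge_zero[of b] by (auto simp: B_def)
    moreover have "x + t n *\<^sub>R b \<notin> K"
    proof
      assume "x + t n *\<^sub>R b \<in> K"
      then have "norm (x + t n *\<^sub>R b) \<le> r" by (rule r)
      moreover have "norm x \<le> norm (x + t n *\<^sub>R b) + norm (t n *\<^sub>R b)"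
        using norm_triangle_ineq4[of "x + t n *\<^sub>R b" "t n *\<^sub>R b"] by simp
      moreover have "norm (t n *\<^sub>R b) \<le> norm b" using t[of n] by (simp add: mult_left_le_one_le)
      ultimately show False using False by (simp add: B_def)
    qed
    ultimately show ?thesis using False supp by (simp add: D_def)
  qed
  have "(\<lambda>n. LINT x|lborel. D n x) \<longlonglongrightarrow> (LINT x|lborel. \<psi>' x)"
  proof (rule integral_dominated_convergence[where w = "\<lambda>x. C * indicator B x"])
    show "\<psi>' \<in> borel_measurable lborel" using cont(2) by (simp add: borel_measurable_continuous_onI)
    show "D n \<in> borel_measurable lborel" for n
    proof -
      have "continuous_on UNIV (D n)"
        unfolding D_def by (intro continuous_intros continuous_on_compose2[OF cont(1)]) auto
      then show ?thesis by (simp add: borel_measurable_continuous_onI)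
    qed
    have "integrable lborel (indicator B :: 'a \<Rightarrow> real)"
      using emeasure_bounded_finite[OF bounded_cball, of "0::'a" "r + norm b"]
      unfolding B_def by (intro integrable_real_indicator) simp_all
    then show "integrable lborel (\<lambda>x. C * indicator B x)" by simp
    show "AE x in lborel. (\<lambda>n. D n x) \<longlonglongrightarrow> \<psi>' x"
    proof (rule AE_I2)
      fix x
      have "((\<lambda>h. norm (\<psi> (x + (0 + h) *\<^sub>R b) - \<psi> (x + 0 *\<^sub>R b) - h *\<^sub>R \<psi>' x) / norm h) \<longlongrightarrow> 0) (at 0)"
        using deriv[of x] unfolding has_vector_derivative_def has_derivative_at by blast
      moreover have "filterlim t (at 0) sequentially"
        unfolding filterlim_at t_def using LIMSEQ_inverse_real_of_nat by (simp add: inverse_eq_divide)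
      ultimately have "(\<lambda>n. norm (\<psi> (x + (0 + t n) *\<^sub>R b) - \<psi> (x + 0 *\<^sub>R b) - t n *\<^sub>R \<psi>' x) / norm (t n)) \<longlonglongrightarrow> 0"
        by (rule filterlim_compose)
      moreover have "norm (\<psi> (x + (0 + t n) *\<^sub>R b) - \<psi> (x + 0 *\<^sub>R b) - t n *\<^sub>R \<psi>' x) / norm (t n) = norm (D n x - \<psi>' x)" for n
      proof -
        have "D n x - \<psi>' x = (1 / t n) *\<^sub>R (\<psi> (x + t n *\<^sub>R b) - \<psi> x - t n *\<^sub>R \<psi>' x)"
          using t(1)[of n] by (simp add: D_def scaleR_diff_right)
        then show ?thesis using t(1)[of n] by simp
      qed
      ultimately have "(\<lambda>n. norm (D n x - \<psi>' x)) \<longlonglongrightarrow> 0" by simp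
      then have "(\<lambda>n. D n x - \<psi>' x) \<longlonglongrightarrow> 0" by (rule tendsto_norm_zero_cancel)
      then show "(\<lambda>n. D n x) \<longlonglongrightarrow> \<psi>' x" by (simp add: LIM_zero_iff)
    qed
    show "AE x in lborel. norm (D n x) \<le> C * indicator B x" for n using bound by simp
  qed
  moreover have "(LINT x|lborel. D n x) = 0" for n
  proof -
    have shift: "(\<lambda>x. \<psi> (x + t n *\<^sub>R b)) = (\<lambda>x. \<psi> (t n *\<^sub>R b + x))" by (simp add: add.commute)
    define K' where "K' = (\<lambda>x. x - t n *\<^sub>R b) ` K"
    have "compact K'" unfolding K'_def using K by (intro compact_continuous_image continuous_intros)
    then have int2: "integrable lborel (\<lambda>x. \<psi> (x + t n *\<^sub>R b))"
    proof (rule integrable_compact_support[rotated])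
      show "continuous_on UNIV (\<lambda>x. \<psi> (x + t n *\<^sub>R b))"
        by (intro continuous_on_compose2[OF cont(1)] continuous_intros) auto
      show "\<psi> (x + t n *\<^sub>R b) = 0" if "x \<notin> K'" for x
      proof (rule supp(1))
        show "x + t n *\<^sub>R b \<notin> K"
        proof
          assume "x + t n *\<^sub>R b \<in> K"
          then have "(x + t n *\<^sub>R b) - t n *\<^sub>R b \<in> K'" unfolding K'_def by (rule imageI)
          then show False using that by simp
        qed
      qed
    qed
    have "(LINT x|lborel. D n x) = (1 / t n) *\<^sub>R ((LINT x|lborel. \<psi> (x + t n *\<^sub>R b)) - (LINT x|lborel. \<psi> x))"
      unfolding D_def using int int2 by simp
    also have "\<dots> = 0" 
      unfolding shift using cont(1) by (simp add: lborel_integral_translation borel_measurable_continuous_onI)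
    finally show ?thesis .
  qed
  ultimately show ?thesis by (simp add: LIMSEQ_const_iff)
qed

definition plane_wave :: "'a::euclidean_space \<Rightarrow> 'a \<Rightarrow> complex" where
  "plane_wave \<xi> x = exp (\<i> * of_real (\<xi> \<bullet> x))"

lemma norm_plane_wave [simp]: "cmod (plane_wave \<xi> x) = 1"
  by (simp add: plane_wave_def)

lemma continuous_plane_wave [continuous_intros]: "continuous_on S (plane_wave \<xi>)"
  unfolding plane_wave_def by (intro continuous_intros)

lemma plane_wave_deriv:
  "((\<lambda>t. plane_wave \<xi> (x + t *\<^sub>R b)) has_vector_derivative \<i> * of_real (\<xi> \<bullet> b) * plane_wave \<xi> x) (at 0)"
proof -
  have "((\<lambda>z. exp (\<i> * (of_real (\<xi> \<bullet> x) + z * of_real (\<xi> \<bullet> b)))) has_field_derivative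
      exp (\<i> * (of_real (\<xi> \<bullet> x) + of_real 0 * of_real (\<xi> \<bullet> b))) * (\<i> * of_real (\<xi> \<bullet> b))) (at (of_real 0))"
    by (auto intro!: derivative_eq_intros)
  from has_vector_derivative_real_field[OF this, of UNIV]
  show ?thesis by (simp add: plane_wave_def inner_add_right mult.commute)
qed

lemma test_function_deriv:
  fixes \<phi> :: "real ^ 'n \<Rightarrow> real"
  assumes "test_function \<Omega> \<phi>"
  shows "((\<lambda>t. \<phi> (x + t *\<^sub>R axis i 1)) has_vector_derivative frechet_derivative \<phi> (at x) (axis i 1)) (at 0)"
    and "continuous_on UNIV (\<lambda>x. frechet_derivative \<phi> (at x) (axis i 1))"
    and "x \<notin> closure {x. \<phi> x \<noteq> 0} \<Longrightarrow> frechet_derivative \<phi> (at x) (axis i 1) = 0"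
proof -
  have smooth: "Ck_on 1 \<phi> UNIV" using assms by (auto simp: test_function_def smooth_on_def)
  then have d: "(\<phi> has_derivative frechet_derivative \<phi> (at x)) (at x)" for x
    by (simp add: frechet_derivative_works)
  show c: "continuous_on UNIV (\<lambda>x. frechet_derivative \<phi> (at x) (axis i 1))" using smooth by simp
  have "((\<lambda>t. \<phi> (x + t *\<^sub>R axis i 1)) has_derivative (\<lambda>t. frechet_derivative \<phi> (at x) (t *\<^sub>R axis i 1))) (at 0)"
    by (rule has_derivative_compose[where f = "\<lambda>t. x + t *\<^sub>R axis i 1" and g = \<phi>]) (use d in \<open>auto intro!: derivative_eq_intros\<close>)
  then show "((\<lambda>t. \<phi> (x + t *\<^sub>R axis i 1)) has_vector_derivative frechet_derivative \<phi> (at x) (axis i 1)) (at 0)"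
    unfolding has_vector_derivative_def
    using linear_cmul[OF has_derivative_linear[OF d]] by simp
  show "frechet_derivative \<phi> (at x) (axis i 1) = 0" if x: "x \<notin> closure {x. \<phi> x \<noteq> 0}"
  proof -
    have "(\<phi> has_derivative (\<lambda>h. 0)) (at x)"
    proof (rule has_derivative_transform_within_open[where s = "- closure {x. \<phi> x \<noteq> 0}" and f = "\<lambda>x. 0"])
      show "0 = \<phi> y" if "y \<in> - closure {x. \<phi> x \<noteq> 0}" for y
        using that subsetD[OF closure_subset, of y "{x. \<phi> x \<noteq> 0}"] by auto
    qed (use x in auto)
    from frechet_derivative_at[OF this] show ?thesis by (metis)
  qed
qed

lemma L1_loc_continuous:
  fixes f :: "real ^ 'n \<Rightarrow> 'b::euclidean_space"
  assumes f: "continuous_on UNIV f" and \<Omega>: "open \<Omega>"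
  shows "f \<in> L1_loc \<Omega>"
proof -
  have "f \<in> borel_measurable (lebesgue_on \<Omega>)"
    by (rule measurable_restrict_space1[OF continuous_lebesgue_measurable[OF f]])
  moreover have "f absolutely_integrable_on K" if K: "compact K" for K
  proof -
    have *: "integrable lborel (\<lambda>x. indicator K x *\<^sub>R f x)"
      using K f by (intro borel_integrable_compact) (auto intro: continuous_on_subset)
    then show ?thesis
      unfolding set_integrable_def by (subst integrable_completion) auto
  qed
  ultimately show ?thesis by (simp add: L1_loc_def)
qed

text \<open>Integration by parts: the derivative of \<open>e\<^sub>\<xi> \<phi>\<close> along a coordinate axis has integral zero.\<close>

lemma weak_gradient_plane_wave:
  fixes \<Omega> :: "(real ^ 'n) set"
  assumes \<Omega>: "open \<Omega>"
  shows "weak_gradient \<Omega> (plane_wave \<xi>) (\<lambda>x. \<chi> i. \<i> * of_real (\<xi> $ i) * plane_wave \<xi> x)"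
  unfolding weak_gradient_def
proof (intro conjI allI impI)
  show "plane_wave \<xi> \<in> L1_loc \<Omega>" by (intro L1_loc_continuous \<Omega> continuous_intros)
  show "(\<lambda>x. \<chi> i. \<i> * of_real (\<xi> $ i) * plane_wave \<xi> x) \<in> L1_loc \<Omega>"
    by (intro L1_loc_continuous \<Omega> continuous_on_vec_lambda continuous_intros)
  fix i \<phi> assume \<phi>: "test_function \<Omega> \<phi>"
  let ?d = "\<lambda>x. frechet_derivative \<phi> (at x) (axis i 1)"
  define K where "K = closure {x. \<phi> x \<noteq> 0}"
  have K: "compact K" "K \<subseteq> \<Omega>" using \<phi> by (auto simp: test_function_def K_def)
  have \<phi>0: "\<phi> x = 0" if "x \<notin> K" for x using that subsetD[OF closure_subset, of x "{x. \<phi> x \<noteq> 0}"] unfolding K_def by auto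
  have d0: "?d x = 0" if "x \<notin> K" for x using that test_function_deriv(3)[OF \<phi>] unfolding K_def by blast
  note d = test_function_deriv[OF \<phi>] and c\<phi> = test_function_continuous[OF \<phi>]
  let ?f = "\<lambda>x. plane_wave \<xi> x * of_real (?d x)" and ?g = "\<lambda>x. \<i> * of_real (\<xi> $ i) * plane_wave \<xi> x * of_real (\<phi> x)"
  have cf: "continuous_on UNIV ?f" and cg: "continuous_on UNIV ?g"
    by (intro continuous_intros d(2) c\<phi>)+
  have int: "integrable lborel ?f" by (rule integrable_compact_support[OF cf K(1)]) (simp add: d0)
  have int': "integrable lborel ?g" by (rule integrable_compact_support[OF cg K(1)]) (simp add: \<phi>0)
  have "(LINT x|lborel. ?f x + ?g x) = 0"
  proof (rule integral_directional_derivative_eq_0[where \<psi> = "\<lambda>x. plane_wave \<xi> x * of_real (\<phi> x)" and b = "axis i 1", OF _ _ _ K(1)])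
    fix x
    have "((\<lambda>t. of_real (\<phi> (x + t *\<^sub>R axis i 1)) :: complex) has_vector_derivative of_real (?d x)) (at 0)"
      
      by (rule has_vector_derivative_of_real) (simp add: has_real_derivative_iff_has_vector_derivative d(1))
    from has_vector_derivative_mult[OF plane_wave_deriv[of \<xi> x "axis i 1"] this]
    show "((\<lambda>t. plane_wave \<xi> (x + t *\<^sub>R axis i 1) * of_real (\<phi> (x + t *\<^sub>R axis i 1))) has_vector_derivative ?f x + ?g x) (at 0)"
      by (simp add: inner_axis)
  qed (auto intro!: continuous_intros cf cg c\<phi> simp: d0 \<phi>0)
  then have eq: "(LINT x|lborel. ?f x) = - (LINT x|lborel. ?g x)"
    using int int' by (simp add: add_eq_0_iff2)
  have leb: "(LINT x|lebesgue_on \<Omega>. h x) = (LINT x|lborel. h x)"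
    if "continuous_on UNIV h" "\<And>x. x \<notin> K \<Longrightarrow> h x = 0" for h :: "real ^ 'n \<Rightarrow> complex"
  proof -
    have "(LINT x|lebesgue_on \<Omega>. h x) = (LINT x|lebesgue. indicator \<Omega> x *\<^sub>R h x)"
      using \<Omega> by (subst integral_restrict_space) auto
    also have "(\<lambda>x. indicator \<Omega> x *\<^sub>R h x) = h"
    proof
      fix x show "indicator \<Omega> x *\<^sub>R h x = h x" using that(2)[of x] subsetD[OF K(2), of x] by (cases "x \<in> K") auto
    qed
    also have "(LINT x|lebesgue. h x) = (LINT x|lborel. h x)"
      using that(1) by (intro integral_completion) (simp add: borel_measurable_continuous_onI)
    finally show ?thesis .
  qed
  show "(LINT x|lebesgue_on \<Omega>. plane_wave \<xi> x * of_real (?d x)) =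
      - (LINT x|lebesgue_on \<Omega>. (\<chi> i. \<i> * of_real (\<xi> $ i) * plane_wave \<xi> x) $ i * of_real (\<phi> x))"
    using leb[OF cf] leb[OF cg] eq by (simp add: d0 \<phi>0)
qed

lemma magnetic_gradient_plane_wave:
  fixes \<Omega> :: "(real ^ 'n) set"
  assumes \<Omega>: "open \<Omega>"
  shows "magnetic_gradient \<Omega> A (plane_wave \<xi>) (\<lambda>x. \<chi> i. \<i> * of_real (\<xi> $ i - A x $ i) * plane_wave \<xi> x)"
proof -
  have "(\<lambda>x. \<chi> i. (\<chi> i. \<i> * of_real (\<xi> $ i - A x $ i) * plane_wave \<xi> x) $ i + \<i> * of_real (A x $ i) * plane_wave \<xi> x)
      = (\<lambda>x. \<chi> i. \<i> * of_real (\<xi> $ i) * plane_wave \<xi> x)"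
    by (auto simp: vec_eq_iff algebra_simps)
  then show ?thesis using weak_gradient_plane_wave[OF \<Omega>, of \<xi>] by (simp add: magnetic_gradient_def)
qed

lemma magnetic_gradient_unique:
  assumes "open \<Omega>" "magnetic_gradient \<Omega> A u G" "magnetic_gradient \<Omega> A u G'"
  shows "AE x in lebesgue_on \<Omega>. G x = G' x"
  using weak_gradient_unique[OF assms(1) assms(2,3)[unfolded magnetic_gradient_def]]
  by eventually_elim (auto simp: vec_eq_iff)

lemma norm_magnetic_plane_wave:
  "norm (\<chi> i. \<i> * of_real (\<xi> $ i - (a :: real ^ 'n) $ i) * plane_wave \<xi> x) = norm (\<xi> - a)"
  by (simp add: norm_vec_def norm_mult L2_set_def del: of_real_diff)

section \<open>The Robin form at a plane wave\<close>

lemma plane_wave_measurable [measurable (raw)]: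
  assumes "f \<in> borel_measurable M" "g \<in> borel_measurable M"
  shows "(\<lambda>x. plane_wave (f x) (g x)) \<in> borel_measurable M"
  using assms unfolding plane_wave_def
  by (rule borel_measurable_continuous_Pair) (intro continuous_intros)

lemma finite_measure_lebesgue_on_bounded:
  assumes "open \<Omega>" "bounded \<Omega>" shows "finite_measure (lebesgue_on \<Omega>)"
proof
  have "\<Omega> \<in> lmeasurable" using assms by (rule lmeasurable_open[rotated])
  then show "emeasure (lebesgue_on \<Omega>) (space (lebesgue_on \<Omega>)) \<noteq> \<infinity>"
    using assms by (auto simp: emeasure_restrict_space fmeasurable_def)
qed

lemma measure_lebesgue_on_space: "open \<Omega> \<Longrightarrow> measure (lebesgue_on \<Omega>) (space (lebesgue_on \<Omega>)) = measure lebesgue \<Omega>"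
  by (simp add: measure_restrict_space)

lemma L2_integral_norm_diff:
  fixes A :: "'a \<Rightarrow> 'b::euclidean_space"
  assumes fin: "finite_measure M" and A: "A \<in> L2 M"
  shows "integrable M A" "integrable M (\<lambda>x. (norm (\<xi> - A x))\<^sup>2)"
    "(LINT x|M. (norm (\<xi> - A x))\<^sup>2) = (norm \<xi>)\<^sup>2 * measure M (space M) - 2 * (\<xi> \<bullet> (LINT x|M. A x)) + (LINT x|M. (norm (A x))\<^sup>2)"
proof -
  interpret finite_measure M by fact
  have [measurable]: "A \<in> borel_measurable M" and sq: "integrable M (\<lambda>x. (norm (A x))\<^sup>2)" using A by (auto simp: L2_def)
  show int: "integrable M A"
  proof (rule Bochner_Integration.integrable_bound)
    show "integrable M (\<lambda>x. 1 + (norm (A x))\<^sup>2)" using sq by simp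
    show "AE x in M. norm (A x) \<le> norm (1 + (norm (A x))\<^sup>2)"
    proof (rule AE_I2)
      fix x
      have "2 * norm (A x) \<le> 1 + (norm (A x))\<^sup>2" using sum_squares_bound[of 1 "norm (A x)"] by simp
      then have "norm (A x) \<le> 1 + (norm (A x))\<^sup>2" using norm_ge_zero[of "A x"] by linarith
      then show "norm (A x) \<le> norm (1 + (norm (A x))\<^sup>2)" by simp
    qed
  qed simp
  have eq: "(norm (\<xi> - A x))\<^sup>2 = (norm \<xi>)\<^sup>2 - 2 * (\<xi> \<bullet> A x) + (norm (A x))\<^sup>2" for x
    by (simp add: power2_norm_eq_inner inner_diff_left inner_diff_right inner_commute)
  show "integrable M (\<lambda>x. (norm (\<xi> - A x))\<^sup>2)" unfolding eq using int sq by simp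
  show "(LINT x|M. (norm (\<xi> - A x))\<^sup>2) = (norm \<xi>)\<^sup>2 * measure M (space M) - 2 * (\<xi> \<bullet> (LINT x|M. A x)) + (LINT x|M. (norm (A x))\<^sup>2)"
    unfolding eq using int sq by simp
qed

context
  fixes \<Omega> :: "(real ^ 'n) set" and A :: "real ^ 'n \<Rightarrow> real ^ 'n" and V :: "real ^ 'n \<Rightarrow> real"
  assumes \<Omega>: "open \<Omega>" "bounded \<Omega>" and A: "A \<in> L2 (lebesgue_on \<Omega>)"
    and V: "integrable (lebesgue_on \<Omega>) V" "AE x in lebesgue_on \<Omega>. 0 \<le> V x"
begin

lemma plane_wave_L2: "plane_wave \<xi> \<in> L2 (lebesgue_on \<Omega>)"
proof -
  interpret finite_measure "lebesgue_on \<Omega>" using \<Omega> by (rule finite_measure_lebesgue_on_bounded)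
  have "plane_wave \<xi> \<in> borel_measurable (lebesgue_on \<Omega>)"
    by (rule measurable_restrict_space1[OF continuous_lebesgue_measurable]) (intro continuous_intros)
  then show ?thesis by (simp add: L2_def)
qed

lemma nsq_plane_wave: "L2.nsq (lebesgue_on \<Omega>) (plane_wave \<xi>) = measure lebesgue \<Omega>"
  using measure_lebesgue_on_space[OF \<Omega>(1)] by (simp add: L2_nsq_eq)

lemma magnetic_gradient_plane_wave_L2:
  "(\<lambda>x. \<chi> i. \<i> * of_real (\<xi> $ i - A x $ i) * plane_wave \<xi> x) \<in> L2 (lebesgue_on \<Omega>)"
proof -
  have "(\<lambda>x. \<chi> i. \<i> * of_real (\<xi> $ i - A x $ i) * plane_wave \<xi> x) \<in> borel_measurable (lebesgue_on \<Omega>)"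
  proof (rule borel_measurable_continuous_Pair[where H = "\<lambda>a z. \<chi> i. \<i> * of_real (\<xi> $ i - a $ i) * z"])
    show "A \<in> borel_measurable (lebesgue_on \<Omega>)" using A by (simp add: L2_def)
    show "plane_wave \<xi> \<in> borel_measurable (lebesgue_on \<Omega>)" using plane_wave_L2 by (simp add: L2_def)
    show "continuous_on UNIV (\<lambda>x. \<chi> i. \<i> * complex_of_real (\<xi> $ i - fst x $ i) * snd x)"
      by (intro continuous_on_vec_lambda continuous_intros)
  qed
  moreover have "integrable (lebesgue_on \<Omega>) (\<lambda>x. (norm (\<xi> - A x))\<^sup>2)"
    using L2_integral_norm_diff(2)[OF finite_measure_lebesgue_on_bounded[OF \<Omega>] A] .
  ultimately show ?thesis unfolding L2_def by (simp only: mem_Collect_eq norm_magnetic_plane_wave)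
qed

lemma plane_wave_form_domain: "plane_wave \<xi> \<in> robin_form_domain \<Omega> A V"
proof -
  have pm: "plane_wave \<xi> \<in> borel_measurable (lebesgue_on \<Omega>)" using plane_wave_L2 by (simp add: L2_def)
  have [measurable]: "V \<in> borel_measurable (lebesgue_on \<Omega>)" using V(1) by simp
  have m: "(\<lambda>x. complex_of_real (sqrt (V x)) * plane_wave \<xi> x) \<in> borel_measurable (lebesgue_on \<Omega>)"
    by (intro borel_measurable_times pm) measurable
  have "integrable (lebesgue_on \<Omega>) (\<lambda>x. (cmod (complex_of_real (sqrt (V x)) * plane_wave \<xi> x))\<^sup>2)"
  proof (rule integrable_cong_AE_imp[OF V(1)])
    show "(\<lambda>x. (cmod (complex_of_real (sqrt (V x)) * plane_wave \<xi> x))\<^sup>2) \<in> borel_measurable (lebesgue_on \<Omega>)"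
      using m by simp
    show "AE x in lebesgue_on \<Omega>. V x = (cmod (complex_of_real (sqrt (V x)) * plane_wave \<xi> x))\<^sup>2"
      using V(2) by eventually_elim (simp add: norm_mult)
  qed
  then have "(\<lambda>x. complex_of_real (sqrt (V x)) * plane_wave \<xi> x) \<in> L2 (lebesgue_on \<Omega>)"
    using m by (simp add: L2_def)
  then show ?thesis
    unfolding robin_form_domain_def
    using plane_wave_L2 magnetic_gradient_plane_wave[OF \<Omega>(1), of A \<xi>] magnetic_gradient_plane_wave_L2 by blast
qed

text \<open>The chosen gradient agrees almost everywhere with \<open>i (\<xi> - A) e\<^sub>\<xi>\<close>. The boundary integrand is nonpositive
  whatever function is chosen as the trace, because \<open>\<sigma> < 0\<close>.\<close>

lemma robin_form_plane_wave_le: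
  assumes sigma: "AE x in surface_measure \<Omega>. \<sigma> x < 0"
  shows "robin_form \<Omega> A V \<sigma> (plane_wave \<xi>) \<le>
    (norm \<xi>)\<^sup>2 * measure lebesgue \<Omega> - 2 * (\<xi> \<bullet> (LINT x|lebesgue_on \<Omega>. A x))
      + ((LINT x|lebesgue_on \<Omega>. (norm (A x))\<^sup>2) + (LINT x|lebesgue_on \<Omega>. V x))"
proof -
  let ?M = "lebesgue_on \<Omega>"
  define G where "G = (SOME G. magnetic_gradient \<Omega> A (plane_wave \<xi>) G)"
  define g where "g = (SOME g. is_trace \<Omega> (\<lambda>x. of_real (cmod (plane_wave \<xi> x))) g)"
  let ?G = "\<lambda>x. \<chi> i. \<i> * of_real (\<xi> $ i - A x $ i) * plane_wave \<xi> x"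
  have A_meas: "A \<in> borel_measurable ?M" using A by (simp add: L2_def)
  have mg: "magnetic_gradient \<Omega> A (plane_wave \<xi>) ?G" by (rule magnetic_gradient_plane_wave[OF \<Omega>(1)])
  then have mgG: "magnetic_gradient \<Omega> A (plane_wave \<xi>) G" 
    unfolding G_def by (rule someI[where P = "magnetic_gradient \<Omega> A (plane_wave \<xi>)"])
  then have AE_G: "AE x in ?M. G x = ?G x" using mg by (rule magnetic_gradient_unique[OF \<Omega>(1)])
  have G_meas: "G \<in> borel_measurable ?M"
  proof -
    \<comment> \<open>The weak gradient of the plane wave, which is measurable by definition.\<close>
    define H where "H = (\<lambda>x. \<chi> i. G x $ i + \<i> * of_real (A x $ i) * plane_wave \<xi> x)"
    have "H \<in> L1_loc \<Omega>" using mgG unfolding magnetic_gradient_def weak_gradient_def H_def by blast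
    then have H_meas: "H \<in> borel_measurable ?M" by (simp add: L1_loc_def)
    have "(\<lambda>x. \<chi> i. H x $ i - \<i> * of_real (fst (A x, plane_wave \<xi> x) $ i) * snd (A x, plane_wave \<xi> x)) \<in> borel_measurable ?M"
    proof (rule borel_measurable_continuous_Pair[where H = "\<lambda>h p. \<chi> i. h $ i - \<i> * of_real (fst p $ i) * snd p", OF H_meas])
      show "(\<lambda>x. (A x, plane_wave \<xi> x)) \<in> borel_measurable ?M"
        using A_meas plane_wave_L2 by (intro borel_measurable_Pair) (auto simp: L2_def)
      show "continuous_on UNIV (\<lambda>x :: (complex ^ 'n) \<times> (real ^ 'n) \<times> complex.
          \<chi> i. fst x $ i - \<i> * complex_of_real (fst (snd x) $ i) * snd (snd x))"
        by (intro continuous_on_vec_lambda continuous_intros)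
    qed
    also have "(\<lambda>x. \<chi> i. H x $ i - \<i> * of_real (fst (A x, plane_wave \<xi> x) $ i) * snd (A x, plane_wave \<xi> x)) = G"
      by (auto simp: H_def vec_eq_iff)
    finally show ?thesis .
  qed
  have bnd: "(LINT x|surface_measure \<Omega>. \<sigma> x * (cmod (g x))\<^sup>2) \<le> 0"
  proof -
    have "0 \<le> (LINT x|surface_measure \<Omega>. - (\<sigma> x * (cmod (g x))\<^sup>2))"
      by (rule integral_nonneg_AE) (use sigma in \<open>eventually_elim, simp add: mult_nonpos_nonneg\<close>)
    then show ?thesis by simp
  qed
  have "(LINT x|?M. (norm (G x))\<^sup>2) = (LINT x|?M. (norm (\<xi> - A x))\<^sup>2)"
  proof (rule integral_cong_AE)
    show "(\<lambda>x. (norm (G x))\<^sup>2) \<in> borel_measurable ?M" using G_meas by simp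
    show "(\<lambda>x. (norm (\<xi> - A x))\<^sup>2) \<in> borel_measurable ?M" using A_meas by simp
    show "AE x in ?M. (norm (G x))\<^sup>2 = (norm (\<xi> - A x))\<^sup>2"
      using AE_G by eventually_elim (simp only: norm_magnetic_plane_wave)
  qed
  also have "\<dots> = (norm \<xi>)\<^sup>2 * measure ?M (space ?M) - 2 * (\<xi> \<bullet> (LINT x|?M. A x)) + (LINT x|?M. (norm (A x))\<^sup>2)"
    by (rule L2_integral_norm_diff(3)[OF finite_measure_lebesgue_on_bounded[OF \<Omega>] A])
  finally have kin: "(LINT x|?M. (norm (G x))\<^sup>2) = (norm \<xi>)\<^sup>2 * measure lebesgue \<Omega> - 2 * (\<xi> \<bullet> (LINT x|?M. A x)) + (LINT x|?M. (norm (A x))\<^sup>2)"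
    using measure_lebesgue_on_space[OF \<Omega>(1)] by simp
  have "robin_form \<Omega> A V \<sigma> (plane_wave \<xi>) = (LINT x|?M. (norm (G x))\<^sup>2)
      + (LINT x|?M. V x * (cmod (plane_wave \<xi> x))\<^sup>2) + (LINT x|surface_measure \<Omega>. \<sigma> x * (cmod (g x))\<^sup>2)"
    unfolding robin_form_def Let_def G_def g_def by (rule refl)
  then show ?thesis using kin bnd by simp
qed

end

section \<open>The Fourier transform and its Bessel inequality\<close>

lemma cnj_measurable [measurable (raw)]:
  "f \<in> borel_measurable M \<Longrightarrow> (\<lambda>x. cnj (f x)) \<in> borel_measurable M"
  by (rule measurable_compose[OF _ borel_measurable_continuous_onI]) (auto intro: continuous_intros)

lemma ball_measurable [measurable]: "ball c r \<in> sets borel"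
  by simp

lemma plane_wave_diff: "plane_wave \<xi> (x - y) = plane_wave \<xi> x * cnj (plane_wave \<xi> y)"
  by (simp add: plane_wave_def exp_cnj inner_diff_right right_diff_distrib exp_diff exp_minus divide_inverse)

lemma integral_lborel_prod:
  fixes f :: "'a::euclidean_space \<Rightarrow> real \<Rightarrow> complex"
  assumes int: "\<And>b. b \<in> Basis \<Longrightarrow> integrable lborel (f b)"
  shows "integrable lborel (\<lambda>x::'a. \<Prod>b\<in>Basis. f b (x \<bullet> b))"
    and "(LINT x|lborel. (\<Prod>b\<in>Basis. f b (x \<bullet> b))) = (\<Prod>b\<in>Basis. (LINT t|lborel. f b t))"
proof -
  interpret product_sigma_finite "\<lambda>_::'a. lborel :: real measure" by standard
  let ?T = "\<lambda>y. (\<Sum>b\<in>Basis. y b *\<^sub>R b) :: 'a"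
  have fm: "f b \<in> borel_measurable borel" if "b \<in> Basis" for b using int[OF that] by simp
  have m: "(\<lambda>x::'a. \<Prod>b\<in>Basis. f b (x \<bullet> b)) \<in> borel_measurable borel"
    by (intro borel_measurable_prod measurable_compose[OF _ fm]) auto
  have T: "?T \<in> (\<Pi>\<^sub>M b\<in>Basis. lborel) \<rightarrow>\<^sub>M borel" by measurable
  have eq: "(\<Prod>b\<in>Basis. f b (?T y \<bullet> b)) = (\<Prod>b\<in>Basis. f b (y b))" for y
    by (intro prod.cong refl) (simp add: inner_sum_left inner_Basis if_distrib sum.delta cong: if_cong)
  have "integrable (\<Pi>\<^sub>M b\<in>Basis. lborel) (\<lambda>y. \<Prod>b\<in>(Basis::'a set). f b (y b))"
    by (rule product_integrable_prod) (use int in auto)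
  then show "integrable lborel (\<lambda>x::'a. \<Prod>b\<in>Basis. f b (x \<bullet> b))"
    by (subst lborel_eq, subst integrable_distr_eq[OF T m]) (simp only: eq)
  have "(LINT x|lborel. (\<Prod>b\<in>Basis. f b (x \<bullet> b))) = (LINT y|(\<Pi>\<^sub>M b\<in>Basis. lborel). (\<Prod>b\<in>(Basis::'a set). f b (y b)))"
    by (subst lborel_eq, subst integral_distr[OF T m]) (simp only: eq)
  also have "\<dots> = (\<Prod>b\<in>Basis. (LINT t|lborel. f b t))"
    by (rule product_integral_prod) (use int in auto)
  finally show "(LINT x|lborel. (\<Prod>b\<in>Basis. f b (x \<bullet> b))) = (\<Prod>b\<in>Basis. (LINT t|lborel. f b t))" .
qed

text \<open>The characteristic function of the standard normal distribution, rescaled by \<open>sqrt \<epsilon>\<close>.\<close>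

lemma gaussian_fourier_1d:
  assumes e: "\<epsilon> > 0"
  shows "integrable lborel (\<lambda>t. complex_of_real (exp (- \<epsilon> * t\<^sup>2 / 2)) * exp (\<i> * of_real (t * z)))"
    and "(LINT t|lborel. complex_of_real (exp (- \<epsilon> * t\<^sup>2 / 2)) * exp (\<i> * of_real (t * z)))
      = of_real (2 * pi * normal_density 0 (sqrt \<epsilon>) z)"
proof -
  let ?h = "\<lambda>t. complex_of_real (exp (- \<epsilon> * t\<^sup>2 / 2)) * exp (\<i> * of_real (t * z))"
  define s where "s = sqrt \<epsilon>"
  have s: "s > 0" "s\<^sup>2 = \<epsilon>" using e by (auto simp: s_def)
  have "(LINT x|lborel. complex_of_real (std_normal_density x) * iexp (z / s * x)) = of_real (exp (- ((z / s)\<^sup>2) / 2))"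
  proof -
    have "char std_normal_distribution (z / s) = (LINT x|lborel. std_normal_density x *\<^sub>R iexp (z / s * x))"
      unfolding char_def by (subst integral_density) (auto simp: normal_density_nonneg)
    then show ?thesis by (simp add: char_std_normal_distribution scaleR_conv_of_real)
  qed
  moreover have int0: "integrable lborel (\<lambda>x. complex_of_real (std_normal_density x) * iexp (z / s * x))"
  proof (rule Bochner_Integration.integrable_bound)
    show "integrable lborel std_normal_density" by simp
    show "AE x in lborel. norm (complex_of_real (std_normal_density x) * iexp (z / s * x)) \<le> norm (std_normal_density x)"
      by (rule AE_I2) (simp add: norm_mult)
    show "(\<lambda>x. complex_of_real (std_normal_density x) * iexp (z / s * x)) \<in> borel_measurable lborel" by measurable
  qed
  have h_eq: "?h t = of_real (sqrt (2 * pi)) * (complex_of_real (std_normal_density (0 + s * t)) * iexp (z / s * (0 + s * t)))" for t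
  proof -
    have "sqrt (2 * pi) * std_normal_density (s * t) = exp (- \<epsilon> * t\<^sup>2 / 2)"
      using s(2) by (simp add: std_normal_density_def power_mult_distrib)
    then have "complex_of_real (exp (- \<epsilon> * t\<^sup>2 / 2)) = of_real (sqrt (2 * pi)) * of_real (std_normal_density (s * t))"
      by (metis of_real_mult)
    then show ?thesis using s(1) by (simp add: mult.commute mult.left_commute)
  qed
  have "integrable lborel (\<lambda>t. complex_of_real (std_normal_density (0 + s * t)) * iexp (z / s * (0 + s * t)))"
    using int0 s(1) by (intro lborel_integrable_real_affine) auto
  then show "integrable lborel ?h" unfolding h_eq by simp
  have "(LINT x|lborel. complex_of_real (std_normal_density x) * iexp (z / s * x))
     = \<bar>s\<bar> *\<^sub>R (LINT t|lborel. complex_of_real (std_normal_density (0 + s * t)) * iexp (z / s * (0 + s * t)))"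
    using s(1) by (intro lborel_integral_real_affine) auto
  moreover have "(LINT t|lborel. ?h t) = of_real (sqrt (2 * pi)) * (LINT t|lborel. complex_of_real (std_normal_density (0 + s * t)) * iexp (z / s * (0 + s * t)))"
    unfolding h_eq by simp
  ultimately have "of_real s * (LINT t|lborel. ?h t) = of_real (sqrt (2 * pi) * exp (- ((z / s)\<^sup>2) / 2))"
    using s(1) by (simp add: scaleR_conv_of_real)
  also have "sqrt (2 * pi) * exp (- ((z / s)\<^sup>2) / 2) = s * (2 * pi * normal_density 0 s z)"
  proof -
    have "sqrt (2 * pi * s\<^sup>2) = sqrt (2 * pi) * s" using s(1) by (simp add: real_sqrt_mult)
    moreover have "sqrt (2 * pi) * sqrt (2 * pi) = 2 * pi" by simp
    ultimately show ?thesis using s(1)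
      by (simp add: normal_density_def power_divide field_simps)
  qed
  finally have "of_real s * (LINT t|lborel. ?h t) = complex_of_real s * of_real (2 * pi * normal_density 0 s z)" by simp
  then show "(LINT t|lborel. ?h t) = of_real (2 * pi * normal_density 0 (sqrt \<epsilon>) z)"
    using s(1) by (simp add: s_def)
qed

text \<open>Up to the factor \<open>(2\<pi>)\<^sup>d\<close> this is the heat kernel at time \<open>\<epsilon> / 2\<close>. It arises as the Fourier transform of
  \<open>gaussian \<epsilon>\<close>.\<close>

definition heat_kernel :: "real \<Rightarrow> 'a::euclidean_space \<Rightarrow> real" where
  "heat_kernel \<epsilon> z = (\<Prod>b\<in>Basis. 2 * pi * normal_density 0 (sqrt \<epsilon>) (z \<bullet> b))"

definition gaussian :: "real \<Rightarrow> 'a::euclidean_space \<Rightarrow> real" where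
  "gaussian \<epsilon> \<xi> = exp (- \<epsilon> * (norm \<xi>)\<^sup>2 / 2)"

lemma gaussian_fourier:
  fixes z :: "'a::euclidean_space"
  assumes e: "\<epsilon> > 0"
  shows "integrable lborel (\<lambda>\<xi>::'a. complex_of_real (gaussian \<epsilon> \<xi>) * plane_wave \<xi> z)"
    and "(LINT \<xi>|lborel. complex_of_real (gaussian \<epsilon> \<xi>) * plane_wave \<xi> z) = of_real (heat_kernel \<epsilon> z)"
proof -
  have eq: "complex_of_real (gaussian \<epsilon> \<xi>) * plane_wave \<xi> z =
      (\<Prod>b\<in>Basis. complex_of_real (exp (- \<epsilon> * (\<xi> \<bullet> b)\<^sup>2 / 2)) * exp (\<i> * of_real ((\<xi> \<bullet> b) * (z \<bullet> b))))" for \<xi> :: 'a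
  proof -
    have "(norm \<xi>)\<^sup>2 = (\<Sum>b\<in>Basis. (\<xi> \<bullet> b)\<^sup>2)"
      unfolding power2_norm_eq_inner by (subst euclidean_inner) (simp only: power2_eq_square)
    then have "gaussian \<epsilon> \<xi> = exp (\<Sum>b\<in>Basis. - \<epsilon> * (\<xi> \<bullet> b)\<^sup>2 / 2)"
      by (simp add: gaussian_def sum_distrib_left sum_divide_distrib sum_negf)
    moreover have "plane_wave \<xi> z = exp (\<Sum>b\<in>Basis. \<i> * of_real ((\<xi> \<bullet> b) * (z \<bullet> b)))"
      by (simp add: plane_wave_def euclidean_inner[of \<xi> z] sum_distrib_left)
    ultimately show ?thesis by (simp add: exp_sum prod.distrib)
  qed
  note p = integral_lborel_prod[OF gaussian_fourier_1d(1)[OF e], of "\<lambda>b. z \<bullet> b"]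
  show "integrable lborel (\<lambda>\<xi>::'a. complex_of_real (gaussian \<epsilon> \<xi>) * plane_wave \<xi> z)"
    unfolding eq by (rule p(1))
  show "(LINT \<xi>|lborel. complex_of_real (gaussian \<epsilon> \<xi>) * plane_wave \<xi> z) = of_real (heat_kernel \<epsilon> z)"
    unfolding eq p(2) gaussian_fourier_1d(2)[OF e] heat_kernel_def by simp
qed

lemma heat_kernel_nonneg: "0 \<le> heat_kernel \<epsilon> z"
  unfolding heat_kernel_def by (intro prod_nonneg) auto

lemma heat_kernel_minus: "heat_kernel \<epsilon> (x - y) = heat_kernel \<epsilon> (y - x)"
proof -
  have "normal_density 0 s ((x - y) \<bullet> b) = normal_density 0 s ((y - x) \<bullet> b)" for s b
    by (simp add: normal_density_def inner_diff_left power2_commute)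
  then show ?thesis by (simp add: heat_kernel_def)
qed

lemma heat_kernel_measurable [measurable]: "heat_kernel \<epsilon> \<in> borel_measurable borel"
  unfolding heat_kernel_def by measurable

lemma nn_integral_heat_kernel:
  assumes "\<epsilon> > 0"
  shows "(\<integral>\<^sup>+y. ennreal (heat_kernel \<epsilon> (x - y :: 'a::euclidean_space)) \<partial>lborel) = ennreal ((2 * pi) ^ DIM('a))"
proof -
  have "(\<integral>\<^sup>+y. ennreal (heat_kernel \<epsilon> (x - y)) \<partial>lborel) = (\<integral>\<^sup>+y. ennreal (heat_kernel \<epsilon> (- x + y)) \<partial>lborel)"
    by (subst heat_kernel_minus) simp
  also have "\<dots> = (\<integral>\<^sup>+y. ennreal (heat_kernel \<epsilon> y) \<partial>distr lborel borel ((+) (- x)))"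
    by (rule nn_integral_distr[symmetric]) auto
  also have "\<dots> = (\<integral>\<^sup>+y. ennreal (heat_kernel \<epsilon> (y :: 'a)) \<partial>lborel)" by (simp only: lborel_distr_plus)
  also have "\<dots> = (\<integral>\<^sup>+y. (\<Prod>b\<in>Basis. ennreal (2 * pi * normal_density 0 (sqrt \<epsilon>) (y \<bullet> b))) \<partial>(lborel :: 'a measure))"
    unfolding heat_kernel_def by (subst prod_ennreal) auto
  also have "\<dots> = (\<Prod>b\<in>(Basis::'a set). (\<integral>\<^sup>+t. ennreal (2 * pi * normal_density 0 (sqrt \<epsilon>) t) \<partial>lborel))"
    by (rule nn_integral_lborel_prod) auto
  also have "(\<integral>\<^sup>+t. ennreal (2 * pi * normal_density 0 (sqrt \<epsilon>) t) \<partial>lborel) = ennreal (2 * pi)"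
  proof (subst nn_integral_eq_integral)
    show "ennreal (LINT t|lborel. 2 * pi * normal_density 0 (sqrt \<epsilon>) t) = ennreal (2 * pi)"
      using assms by simp
  qed (use assms in auto)
  finally show ?thesis by (simp add: ennreal_power)
qed

lemma (in pair_sigma_finite) integrable_pair_bound:
  fixes h :: "'a \<times> 'b \<Rightarrow> complex" and f :: "'a \<Rightarrow> real" and g :: "'b \<Rightarrow> real"
  assumes h: "h \<in> borel_measurable (M1 \<Otimes>\<^sub>M M2)" and f: "integrable M1 f" and g: "integrable M2 g"
    and le: "\<And>x y. norm (h (x, y)) \<le> f x * g y"
  shows "integrable (M1 \<Otimes>\<^sub>M M2) h"
proof -
  have [measurable]: "f \<in> borel_measurable M1" "g \<in> borel_measurable M2" using f g by auto
  have "integrable (M1 \<Otimes>\<^sub>M M2) (\<lambda>p. f (fst p) * g (snd p))"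
  proof (rule Fubini_integrable)
    show "integrable M1 (\<lambda>x. LINT y|M2. norm (f (fst (x, y)) * g (snd (x, y))))"
      using f g by (simp add: abs_mult)
    show "AE x in M1. integrable M2 (\<lambda>y. f (fst (x, y)) * g (snd (x, y)))" using g by simp
  qed measurable
  then show ?thesis
  proof (rule Bochner_Integration.integrable_bound)
    show "AE p in M1 \<Otimes>\<^sub>M M2. norm (h p) \<le> norm (f (fst p) * g (snd p))"
    proof (rule AE_I2)
      fix p show "norm (h p) \<le> norm (f (fst p) * g (snd p))"
        using le[of "fst p" "snd p"] by (cases p) auto
    qed
  qed (rule h)
qed

text \<open>Two exchanges of integrals turn the left side into the double integral of
  \<open>f(x) cnj(f(y)) K(x - y)\<close>, where \<open>K\<close> is the heat kernel. As \<open>K\<close> is nonnegative, even and of total mass \<open>(2\<pi>)\<^sup>d\<close>,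
  the estimate \<open>2 \<bar>f(x)\<bar> \<bar>f(y)\<bar> \<le> \<bar>f(x)\<bar>\<^sup>2 + \<bar>f(y)\<bar>\<^sup>2\<close> gives the bound.\<close>

lemma gaussian_bessel:
  fixes f :: "'a::euclidean_space \<Rightarrow> complex"
  assumes f1: "integrable lborel f" and f2: "integrable lborel (\<lambda>x. (cmod (f x))\<^sup>2)" and e: "\<epsilon> > 0"
  defines "F \<equiv> \<lambda>\<xi>. LINT x|lborel. plane_wave \<xi> x * f x"
  shows "integrable lborel (\<lambda>\<xi>. gaussian \<epsilon> \<xi> * (cmod (F \<xi>))\<^sup>2)"
    and "(LINT \<xi>|lborel. gaussian \<epsilon> \<xi> * (cmod (F \<xi>))\<^sup>2) \<le> (2 * pi) ^ DIM('a) * (LINT x|lborel. (cmod (f x))\<^sup>2)"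
proof -
  have [measurable]: "f \<in> borel_measurable borel" using f1 by simp
  have [measurable]: "F \<in> borel_measurable borel"
    unfolding F_def by measurable
  have [measurable]: "gaussian \<epsilon> \<in> borel_measurable (borel :: 'a measure)" unfolding gaussian_def by measurable
  have g: "integrable lborel (gaussian \<epsilon> :: 'a \<Rightarrow> real)"
  proof -
    have "integrable lborel (\<lambda>\<xi>::'a. norm (complex_of_real (gaussian \<epsilon> \<xi>) * plane_wave \<xi> (0::'a)))"
      by (rule integrable_norm[OF gaussian_fourier(1)[OF e]])
    also have "(\<lambda>\<xi>::'a. norm (complex_of_real (gaussian \<epsilon> \<xi>) * plane_wave \<xi> (0::'a))) = gaussian \<epsilon>"
      by (auto simp: norm_mult gaussian_def)
    finally show ?thesis .
  qed
  have g_nn: "0 \<le> gaussian \<epsilon> \<xi>" for \<xi> :: 'a by (simp add: gaussian_def)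
  define C where "C = (LINT x|lborel. cmod (f x))"
  have C: "0 \<le> C" by (simp add: C_def)
  have int_e: "integrable lborel (\<lambda>x. plane_wave \<xi> x * f x)" for \<xi>
    by (rule Bochner_Integration.integrable_bound[OF f1]) (auto simp: norm_mult)
  have F_le: "cmod (F \<xi>) \<le> C" for \<xi>
  proof -
    have "cmod (F \<xi>) \<le> (LINT x|lborel. norm (plane_wave \<xi> x * f x))" unfolding F_def by (rule integral_norm_bound)
    then show ?thesis by (simp add: C_def norm_mult)
  qed
  show int: "integrable lborel (\<lambda>\<xi>. gaussian \<epsilon> \<xi> * (cmod (F \<xi>))\<^sup>2)"
  proof (rule Bochner_Integration.integrable_bound)
    show "integrable lborel (\<lambda>\<xi>::'a. gaussian \<epsilon> \<xi> * C\<^sup>2)" using g by simp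
    show "AE \<xi> in lborel. norm (gaussian \<epsilon> \<xi> * (cmod (F \<xi>))\<^sup>2) \<le> norm (gaussian \<epsilon> \<xi> * C\<^sup>2)"
      using F_le g_nn C by (intro AE_I2) (auto simp: abs_mult intro!: mult_left_mono power_mono)
  qed measurable
  define I where "I x = (LINT \<xi>|lborel. gaussian \<epsilon> \<xi> * plane_wave \<xi> x * cnj (F \<xi>))" for x
  have "complex_of_real (LINT \<xi>|lborel. gaussian \<epsilon> \<xi> * (cmod (F \<xi>))\<^sup>2)
      = (LINT \<xi>|lborel. (LINT x|lborel. gaussian \<epsilon> \<xi> * plane_wave \<xi> x * cnj (F \<xi>) * f x))"
  proof -
    have inner: "(LINT x|lborel. gaussian \<epsilon> \<xi> * plane_wave \<xi> x * cnj (F \<xi>) * f x) = of_real (gaussian \<epsilon> \<xi> * (cmod (F \<xi>))\<^sup>2)" for \<xi>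
    proof -
      have "(LINT x|lborel. gaussian \<epsilon> \<xi> * plane_wave \<xi> x * cnj (F \<xi>) * f x)
          = (LINT x|lborel. (gaussian \<epsilon> \<xi> * cnj (F \<xi>)) * (plane_wave \<xi> x * f x))"
        by (intro Bochner_Integration.integral_cong refl) (simp add: mult_ac)
      also have "\<dots> = gaussian \<epsilon> \<xi> * cnj (F \<xi>) * F \<xi>" unfolding F_def using int_e by simp
      also have "\<dots> = of_real (gaussian \<epsilon> \<xi>) * of_real ((cmod (F \<xi>))\<^sup>2)"
        by (simp only: complex_norm_square mult_ac)
      finally show ?thesis by simp
    qed
    show ?thesis unfolding inner by (rule integral_complex_of_real[symmetric])
  qed
  also have "\<dots> = (LINT x|lborel. (LINT \<xi>|lborel. gaussian \<epsilon> \<xi> * plane_wave \<xi> x * cnj (F \<xi>) * f x))"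
  proof (rule lborel_pair.Fubini_integral[symmetric])
    have "(\<lambda>p. complex_of_real (gaussian \<epsilon> (fst p)) * plane_wave (fst p) (snd p) * cnj (F (fst p)) * f (snd p)) \<in> borel_measurable (lborel \<Otimes>\<^sub>M lborel)"
      by measurable
    then show "integrable (lborel \<Otimes>\<^sub>M lborel) (\<lambda>(\<xi>, x). complex_of_real (gaussian \<epsilon> \<xi>) * plane_wave \<xi> x * cnj (F \<xi>) * f x)"
      unfolding case_prod_beta
    proof (rule lborel_pair.integrable_pair_bound)
      show "integrable lborel (\<lambda>\<xi>::'a. gaussian \<epsilon> \<xi> * C)" using g by simp
      show "integrable lborel (\<lambda>x. cmod (f x))" using f1 by simp
      show "cmod (complex_of_real (gaussian \<epsilon> (fst (\<xi>, x))) * plane_wave (fst (\<xi>, x)) (snd (\<xi>, x)) * cnj (F (fst (\<xi>, x))) * f (snd (\<xi>, x)))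
          \<le> gaussian \<epsilon> \<xi> * C * cmod (f x)" for \<xi> x
        using F_le[of \<xi>] g_nn[of \<xi>] by (simp add: norm_mult mult_right_mono mult_left_mono)
    qed
  qed
  also have "\<dots> = (LINT x|lborel. I x * f x)" by (simp add: I_def)
  finally have J: "complex_of_real (LINT \<xi>|lborel. gaussian \<epsilon> \<xi> * (cmod (F \<xi>))\<^sup>2) = (LINT x|lborel. I x * f x)" .
  have I_eq: "I x = (LINT y|lborel. heat_kernel \<epsilon> (x - y) * cnj (f y))" for x
  proof -
    have "I x = (LINT \<xi>|lborel. (LINT y|lborel. gaussian \<epsilon> \<xi> * plane_wave \<xi> (x - y) * cnj (f y)))"
    proof -
      have "(LINT y|lborel. gaussian \<epsilon> \<xi> * plane_wave \<xi> (x - y) * cnj (f y)) = gaussian \<epsilon> \<xi> * plane_wave \<xi> x * cnj (F \<xi>)" for \<xi>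
      proof -
        have "(LINT y|lborel. gaussian \<epsilon> \<xi> * plane_wave \<xi> (x - y) * cnj (f y))
            = (LINT y|lborel. (gaussian \<epsilon> \<xi> * plane_wave \<xi> x) * cnj (plane_wave \<xi> y * f y))"
          by (intro Bochner_Integration.integral_cong refl) (simp add: plane_wave_diff mult_ac)
        also have "\<dots> = (gaussian \<epsilon> \<xi> * plane_wave \<xi> x) * (LINT y|lborel. cnj (plane_wave \<xi> y * f y))"
          by (rule integral_mult_right_zero)
        also have "(LINT y|lborel. cnj (plane_wave \<xi> y * f y)) = cnj (F \<xi>)"
          unfolding F_def by (rule Bochner_Integration.integral_cnj)
        finally show ?thesis .
      qed
      then show ?thesis by (simp add: I_def)
    qed
    also have "\<dots> = (LINT y|lborel. (LINT \<xi>|lborel. gaussian \<epsilon> \<xi> * plane_wave \<xi> (x - y) * cnj (f y)))"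
    proof (rule lborel_pair.Fubini_integral[symmetric])
      have "(\<lambda>p. complex_of_real (gaussian \<epsilon> (fst p)) * plane_wave (fst p) (x - snd p) * cnj (f (snd p))) \<in> borel_measurable (lborel \<Otimes>\<^sub>M lborel)"
        by measurable
      then show "integrable (lborel \<Otimes>\<^sub>M lborel) (\<lambda>(\<xi>, y). complex_of_real (gaussian \<epsilon> \<xi>) * plane_wave \<xi> (x - y) * cnj (f y))"
        unfolding case_prod_beta
      proof (rule lborel_pair.integrable_pair_bound[OF _ g integrable_norm[OF f1]])
        show "cmod (complex_of_real (gaussian \<epsilon> (fst (\<xi>, y))) * plane_wave (fst (\<xi>, y)) (x - snd (\<xi>, y)) * cnj (f (snd (\<xi>, y))))
            \<le> gaussian \<epsilon> \<xi> * cmod (f y)" for \<xi> y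
          using g_nn[of \<xi>] by (simp add: norm_mult)
      qed
    qed
    also have "\<dots> = (LINT y|lborel. heat_kernel \<epsilon> (x - y) * cnj (f y))"
      by (simp add: gaussian_fourier(2)[OF e])
    finally show ?thesis .
  qed
  have I_bound: "ennreal (cmod (I x)) \<le> (\<integral>\<^sup>+y. ennreal (heat_kernel \<epsilon> (x - y) * cmod (f y)) \<partial>lborel)" for x
  proof (cases "integrable lborel (\<lambda>y. complex_of_real (heat_kernel \<epsilon> (x - y)) * cnj (f y))")
    case True
    have "ennreal (cmod (I x)) \<le> (\<integral>\<^sup>+y. ennreal (norm (complex_of_real (heat_kernel \<epsilon> (x - y)) * cnj (f y))) \<partial>lborel)"
      unfolding I_eq by (rule integral_norm_bound_ennreal[OF True])
    then show ?thesis by (simp add: norm_mult heat_kernel_nonneg)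
  next
    case False
    then show ?thesis unfolding I_eq by (simp add: not_integrable_integral_eq)
  qed
  let ?K = "\<lambda>x y. ennreal (heat_kernel \<epsilon> (x - y :: 'a))" and ?n = "\<lambda>x. ennreal ((cmod (f x))\<^sup>2)"
  let ?N = "\<integral>\<^sup>+x. ?n x \<partial>lborel"
  have [measurable]: "(\<lambda>p. ?K (fst p) (snd p)) \<in> borel_measurable (borel \<Otimes>\<^sub>M borel)" by measurable
  \<comment> \<open>A name for the numeral, which simplification of \<open>ennreal\<close> terms would otherwise rewrite.\<close>
  define \<kappa> :: real where "\<kappa> = 1 / 2"
  have \<kappa>: "0 \<le> \<kappa>" by (simp add: \<kappa>_def)
  define X where "X = (LINT \<xi>|lborel. gaussian \<epsilon> \<xi> * (cmod (F \<xi>))\<^sup>2)"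
  have X0: "0 \<le> X" unfolding X_def by (intro integral_nonneg_AE AE_I2) (simp add: g_nn)
  have "ennreal X \<le> (\<integral>\<^sup>+x. ennreal (cmod (I x) * cmod (f x)) \<partial>lborel)"
  proof (cases "integrable lborel (\<lambda>x. I x * f x)")
    case True
    have "ennreal (cmod (LINT x|lborel. I x * f x)) \<le> (\<integral>\<^sup>+x. ennreal (norm (I x * f x)) \<partial>lborel)"
      by (rule integral_norm_bound_ennreal[OF True])
    then show ?thesis unfolding J[symmetric] X_def[symmetric] using X0 by (simp add: norm_mult)
  next
    case False
    then have "complex_of_real X = 0" using J by (simp add: X_def not_integrable_integral_eq)
    then show ?thesis by simp
  qed
  also have "\<dots> \<le> (\<integral>\<^sup>+x. (\<integral>\<^sup>+y. ennreal (heat_kernel \<epsilon> (x - y) * cmod (f y)) \<partial>lborel) * ennreal (cmod (f x)) \<partial>lborel)"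
    by (intro nn_integral_mono) (simp add: ennreal_mult mult_right_mono I_bound)
  also have "\<dots> = (\<integral>\<^sup>+x. (\<integral>\<^sup>+y. ennreal (heat_kernel \<epsilon> (x - y) * cmod (f y)) * ennreal (cmod (f x)) \<partial>lborel) \<partial>lborel)"
    by (intro nn_integral_cong nn_integral_multc[symmetric]) measurable
  also have "\<dots> \<le> (\<integral>\<^sup>+x. (\<integral>\<^sup>+y. ennreal \<kappa> * (?K x y * ?n x + ?K x y * ?n y) \<partial>lborel) \<partial>lborel)"
  proof (intro nn_integral_mono)
    fix x y :: 'a
    have "heat_kernel \<epsilon> (x - y) * (2 * cmod (f x) * cmod (f y)) \<le> heat_kernel \<epsilon> (x - y) * ((cmod (f x))\<^sup>2 + (cmod (f y))\<^sup>2)"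
      by (intro mult_left_mono sum_squares_bound heat_kernel_nonneg)
    then have "ennreal (heat_kernel \<epsilon> (x - y) * cmod (f y) * cmod (f x)) \<le>
        ennreal (\<kappa> * (heat_kernel \<epsilon> (x - y) * (cmod (f x))\<^sup>2 + heat_kernel \<epsilon> (x - y) * (cmod (f y))\<^sup>2))"
      by (intro ennreal_leI) (simp add: \<kappa>_def algebra_simps)
    then show "ennreal (heat_kernel \<epsilon> (x - y) * cmod (f y)) * ennreal (cmod (f x)) \<le> ennreal \<kappa> * (?K x y * ?n x + ?K x y * ?n y)"
      using \<kappa> by (simp add: ennreal_mult'[symmetric] ennreal_plus[symmetric] heat_kernel_nonneg del: ennreal_plus)
  qed
  also have "\<dots> = ennreal \<kappa> * ((\<integral>\<^sup>+x. (\<integral>\<^sup>+y. ?K x y * ?n x \<partial>lborel) \<partial>lborel) + (\<integral>\<^sup>+x. (\<integral>\<^sup>+y. ?K x y * ?n y \<partial>lborel) \<partial>lborel))"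
    by (simp add: nn_integral_cmult nn_integral_add)
  also have "(\<integral>\<^sup>+x. (\<integral>\<^sup>+y. ?K x y * ?n x \<partial>lborel) \<partial>lborel) = ennreal ((2 * pi) ^ DIM('a)) * ?N"
    by (simp add: nn_integral_multc nn_integral_cmult nn_integral_heat_kernel[OF e])
  also have "(\<integral>\<^sup>+x. (\<integral>\<^sup>+y. ?K x y * ?n y \<partial>lborel) \<partial>lborel) = (\<integral>\<^sup>+y. (\<integral>\<^sup>+x. ?K x y * ?n y \<partial>lborel) \<partial>lborel)"
    by (rule lborel_pair.Fubini') measurable
  also have "\<dots> = (\<integral>\<^sup>+y. (\<integral>\<^sup>+x. ?K y x * ?n y \<partial>lborel) \<partial>lborel)"
    by (subst heat_kernel_minus) (rule refl)
  also have "\<dots> = ennreal ((2 * pi) ^ DIM('a)) * ?N"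
    by (simp add: nn_integral_multc nn_integral_cmult nn_integral_heat_kernel[OF e])
  also have "?N = ennreal (LINT x|lborel. (cmod (f x))\<^sup>2)"
    by (rule nn_integral_eq_integral[OF f2]) simp
  finally have "ennreal X \<le> ennreal \<kappa> * (ennreal ((2 * pi) ^ DIM('a)) * ennreal (LINT x|lborel. (cmod (f x))\<^sup>2)
      + ennreal ((2 * pi) ^ DIM('a)) * ennreal (LINT x|lborel. (cmod (f x))\<^sup>2))" .
  also have "\<dots> = ennreal ((2 * pi) ^ DIM('a) * (LINT x|lborel. (cmod (f x))\<^sup>2))"
    using \<kappa> by (simp add: ennreal_mult'[symmetric] ennreal_plus[symmetric] del: ennreal_plus) (simp add: \<kappa>_def)
  finally have "X \<le> (2 * pi) ^ DIM('a) * (LINT x|lborel. (cmod (f x))\<^sup>2)"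
    by (subst (asm) ennreal_le_iff) simp_all
  then show "(LINT \<xi>|lborel. gaussian \<epsilon> \<xi> * (cmod (F \<xi>))\<^sup>2) \<le> (2 * pi) ^ DIM('a) * (LINT x|lborel. (cmod (f x))\<^sup>2)"
    by (simp add: X_def)
qed

text \<open>On the ball the Gaussian weight is at least \<open>exp(-\<epsilon> r\<^sup>2 / 2)\<close>, which tends to \<open>1\<close> as \<open>\<epsilon> \<rightarrow> 0\<close>.\<close>

lemma fourier_bessel_ball:
  fixes f :: "'a::euclidean_space \<Rightarrow> complex"
  assumes f1: "integrable lborel f" and f2: "integrable lborel (\<lambda>x. (cmod (f x))\<^sup>2)"
  defines "F \<equiv> \<lambda>\<xi>. LINT x|lborel. plane_wave \<xi> x * f x"
  shows "integrable lborel (\<lambda>\<xi>. indicator (ball 0 r) \<xi> * (cmod (F \<xi>))\<^sup>2)"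
    and "(LINT \<xi>|lborel. indicator (ball 0 r) \<xi> * (cmod (F \<xi>))\<^sup>2) \<le> (2 * pi) ^ DIM('a) * (LINT x|lborel. (cmod (f x))\<^sup>2)"
proof -
  have [measurable]: "f \<in> borel_measurable borel" using f1 by simp
  have [measurable]: "F \<in> borel_measurable borel" unfolding F_def by measurable
  have gb: "integrable lborel (\<lambda>\<xi>. gaussian \<epsilon> \<xi> * (cmod (F \<xi>))\<^sup>2)"
    "(LINT \<xi>|lborel. gaussian \<epsilon> \<xi> * (cmod (F \<xi>))\<^sup>2) \<le> (2 * pi) ^ DIM('a) * (LINT x|lborel. (cmod (f x))\<^sup>2)"
    if "\<epsilon> > 0" for \<epsilon>
    unfolding F_def using gaussian_bessel[OF f1 f2 that] by blast+
  let ?B = "\<lambda>\<xi>. indicator (ball 0 r) \<xi> * (cmod (F \<xi>))\<^sup>2"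
  have le: "exp (- \<epsilon> * r\<^sup>2 / 2) * ?B \<xi> \<le> gaussian \<epsilon> \<xi> * (cmod (F \<xi>))\<^sup>2" if "\<epsilon> > 0" for \<epsilon> \<xi>
  proof (cases "\<xi> \<in> ball 0 r")
    case True
    then have "(norm \<xi>)\<^sup>2 \<le> r\<^sup>2" by (intro power_mono) auto
    then have "exp (- \<epsilon> * r\<^sup>2 / 2) \<le> gaussian \<epsilon> \<xi>" using that by (simp add: gaussian_def)
    then show ?thesis using True by (simp add: mult_right_mono)
  qed (simp add: gaussian_def)
  show int: "integrable lborel ?B"
  proof (rule Bochner_Integration.integrable_bound)
    show "integrable lborel (\<lambda>\<xi>. exp (1 * r\<^sup>2 / 2) * (gaussian 1 \<xi> * (cmod (F \<xi>))\<^sup>2))" using gb(1)[of 1] by simp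
    show "AE \<xi> in lborel. norm (?B \<xi>) \<le> norm (exp (1 * r\<^sup>2 / 2) * (gaussian 1 \<xi> * (cmod (F \<xi>))\<^sup>2))"
    proof (rule AE_I2)
      fix \<xi>
      have "?B \<xi> = exp (1 * r\<^sup>2 / 2) * (exp (- 1 * r\<^sup>2 / 2) * ?B \<xi>)" by (simp add: exp_minus)
      also have "\<dots> \<le> exp (1 * r\<^sup>2 / 2) * (gaussian 1 \<xi> * (cmod (F \<xi>))\<^sup>2)" by (intro mult_left_mono le) auto
      finally show "norm (?B \<xi>) \<le> norm (exp (1 * r\<^sup>2 / 2) * (gaussian 1 \<xi> * (cmod (F \<xi>))\<^sup>2))"
        by (simp add: abs_mult gaussian_def)
    qed
  qed measurable
  let ?N = "(2 * pi) ^ DIM('a) * (LINT x|lborel. (cmod (f x))\<^sup>2)"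
  have bd: "exp (- (1 / real (Suc n)) * r\<^sup>2 / 2) * integral\<^sup>L lborel ?B \<le> ?N" for n
  proof -
    have "exp (- (1 / real (Suc n)) * r\<^sup>2 / 2) * integral\<^sup>L lborel ?B
        = (LINT \<xi>|lborel. exp (- (1 / real (Suc n)) * r\<^sup>2 / 2) * ?B \<xi>)" by (rule integral_mult_right_zero[symmetric])
    also have "\<dots> \<le> (LINT \<xi>|lborel. gaussian (1 / real (Suc n)) \<xi> * (cmod (F \<xi>))\<^sup>2)"
      using int by (intro integral_mono le gb(1)) auto
    also have "\<dots> \<le> ?N" by (rule gb(2)) simp
    finally show ?thesis .
  qed
  have "(\<lambda>n. exp (- (1 / real (Suc n)) * r\<^sup>2 / 2) * integral\<^sup>L lborel ?B) \<longlonglongrightarrow> exp (- 0 * r\<^sup>2 / 2) * integral\<^sup>L lborel ?B"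
    using LIMSEQ_inverse_real_of_nat by (intro tendsto_intros) (auto simp: inverse_eq_divide)
  then have "(\<lambda>n. exp (- (1 / real (Suc n)) * r\<^sup>2 / 2) * integral\<^sup>L lborel ?B) \<longlonglongrightarrow> integral\<^sup>L lborel ?B" by simp
  then show "integral\<^sup>L lborel ?B \<le> ?N" by (rule LIMSEQ_le_const2) (use bd in blast)
qed

lemma lebesgue_ex_borel_complex:
  fixes h :: "'a::euclidean_space \<Rightarrow> complex"
  assumes h: "h \<in> borel_measurable lebesgue"
  shows "\<exists>f \<in> borel_measurable borel. AE x in lebesgue. h x = f x"
proof -
  have "(\<lambda>x. Re (h x)) \<in> borel_measurable lebesgue" "(\<lambda>x. Im (h x)) \<in> borel_measurable lebesgue"
    using h by (auto intro: measurable_compose[OF h])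
  then obtain a b where a: "a \<in> borel_measurable lborel" "AE x in lborel. Re (h x) = a x"
    and b: "b \<in> borel_measurable lborel" "AE x in lborel. Im (h x) = b x"
    using completion_ex_borel_measurable_real by metis
  have [measurable]: "a \<in> borel_measurable borel" "b \<in> borel_measurable borel" using a b by auto
  have "AE x in lborel. h x = of_real (a x) + \<i> * of_real (b x)"
    using a(2) b(2) by eventually_elim (simp add: complex_eq_iff)
  then have "AE x in lebesgue. h x = of_real (a x) + \<i> * of_real (b x)" by (rule AE_completion)
  then show ?thesis by (intro bexI[of _ "\<lambda>x. of_real (a x) + \<i> * of_real (b x)"]) auto
qed

text \<open>This is \<open>fourier_bessel_ball\<close> for a Borel representative of the complex conjugate of \<open>u\<close>, extended by zero outside
  \<open>\<Omega>\<close>.\<close>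

lemma plane_wave_bessel:
  fixes \<Omega> :: "'a::euclidean_space set"
  assumes \<Omega>: "open \<Omega>" "bounded \<Omega>" and u: "u \<in> L2 (lebesgue_on \<Omega>)"
  shows "integrable lborel (\<lambda>\<xi>. indicator (ball 0 r) \<xi> * (cmod (L2_inner (lebesgue_on \<Omega>) (plane_wave \<xi>) u))\<^sup>2)"
    and "(LINT \<xi>|lborel. indicator (ball 0 r) \<xi> * (cmod (L2_inner (lebesgue_on \<Omega>) (plane_wave \<xi>) u))\<^sup>2)
      \<le> (2 * pi) ^ DIM('a) * L2.nsq (lebesgue_on \<Omega>) u"
proof -
  let ?M = "lebesgue_on \<Omega>"
  have \<Omega>s: "\<Omega> \<inter> space lebesgue \<in> sets lebesgue" using \<Omega> by auto
  define h where "h x = indicator \<Omega> x *\<^sub>R cnj (u x)" for x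
  have "integrable ?M u" by (rule L2_integral_norm_diff(1)[OF finite_measure_lebesgue_on_bounded[OF \<Omega>] u])
  then have "integrable ?M (\<lambda>x. cnj (u x))" by simp
  then have h1: "integrable lebesgue h" unfolding h_def by (subst (asm) integrable_restrict_space[OF \<Omega>s])
  have h_sq: "(cmod (h x))\<^sup>2 = indicator \<Omega> x *\<^sub>R (cmod (u x))\<^sup>2" for x by (simp add: h_def indicator_def)
  have "integrable ?M (\<lambda>x. (cmod (u x))\<^sup>2)" using u by (simp add: L2_def)
  then have h2: "integrable lebesgue (\<lambda>x. (cmod (h x))\<^sup>2)"
    unfolding h_sq by (subst (asm) integrable_restrict_space[OF \<Omega>s])
  obtain f where f_meas: "f \<in> borel_measurable borel" and AE_f: "AE x in lebesgue. h x = f x"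
    using lebesgue_ex_borel_complex[OF borel_measurable_integrable[OF h1]] by blast
  have [measurable]: "f \<in> borel_measurable borel" by (rule f_meas)
  have f_leb: "f \<in> borel_measurable lebesgue" by (rule measurable_completion) simp
  have hm: "h \<in> borel_measurable lebesgue" using h1 by simp
  have "integrable lebesgue f"
    by (rule integrable_cong_AE_imp[OF h1 f_leb]) (use AE_f in auto)
  then have f1: "integrable lborel f" by (subst (asm) integrable_completion) auto
  have "integrable lebesgue (\<lambda>x. (cmod (f x))\<^sup>2)"
    by (rule integrable_cong_AE_imp[OF h2]) (use AE_f f_leb in auto)
  then have f2: "integrable lborel (\<lambda>x. (cmod (f x))\<^sup>2)" by (subst (asm) integrable_completion) auto
  have inner: "L2_inner ?M (plane_wave \<xi>) u = (LINT x|lborel. plane_wave \<xi> x * f x)" for \<xi>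
  proof -
    have pm: "plane_wave \<xi> \<in> borel_measurable lebesgue"
      by (rule continuous_lebesgue_measurable) (intro continuous_intros)
    have "L2_inner ?M (plane_wave \<xi>) u = (LINT x|lebesgue. plane_wave \<xi> x * h x)"
      unfolding L2_inner_def integral_restrict_space[OF \<Omega>s] h_def by simp
    also have "\<dots> = (LINT x|lebesgue. plane_wave \<xi> x * f x)"
      using AE_f by (intro integral_cong_AE borel_measurable_times pm hm f_leb) auto
    also have "\<dots> = (LINT x|lborel. plane_wave \<xi> x * f x)" by (rule integral_completion) simp
    finally show ?thesis .
  qed
  have "L2.nsq ?M u = (LINT x|lebesgue. (cmod (h x))\<^sup>2)"
    unfolding L2_nsq_eq integral_restrict_space[OF \<Omega>s] h_sq ..
  also have "\<dots> = (LINT x|lebesgue. (cmod (f x))\<^sup>2)"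
    using AE_f hm f_leb by (intro integral_cong_AE) auto
  also have "\<dots> = (LINT x|lborel. (cmod (f x))\<^sup>2)" by (rule integral_completion) simp
  finally have nsq: "L2.nsq ?M u = (LINT x|lborel. (cmod (f x))\<^sup>2)" .
  show "integrable lborel (\<lambda>\<xi>. indicator (ball 0 r) \<xi> * (cmod (L2_inner ?M (plane_wave \<xi>) u))\<^sup>2)"
    unfolding inner by (rule fourier_bessel_ball(1)[OF f1 f2])
  show "(LINT \<xi>|lborel. indicator (ball 0 r) \<xi> * (cmod (L2_inner ?M (plane_wave \<xi>) u))\<^sup>2) \<le> (2 * pi) ^ DIM('a) * L2.nsq ?M u"
    unfolding inner nsq by (rule fourier_bessel_ball(2)[OF f1 f2])
qed

section \<open>Moments of a ball\<close>

lemma lborel_integral_uminus: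
  fixes f :: "'a::euclidean_space \<Rightarrow> 'b::{banach, second_countable_topology}"
  assumes [measurable]: "f \<in> borel_measurable borel"
  shows "(LINT x|lborel. f (- x)) = (LINT x|lborel. f x)"
proof -
  have "lborel = density (distr lborel borel (\<lambda>x::'a. 0 + (-1) *\<^sub>R x)) (\<lambda>_. \<bar>- 1 :: real\<bar> ^ DIM('a))"
    by (rule lborel_affine) simp
  then have d: "distr lborel borel (\<lambda>x::'a. - x) = lborel" by (simp add: density_1)
  have "(LINT x|lborel. f x) = (LINT x|distr lborel borel (\<lambda>x::'a. - x). f x)" unfolding d ..
  also have "\<dots> = (LINT x|lborel. f (- x))" by (rule integral_distr) auto
  finally show ?thesis by simp
qed

lemma integrable_on_ball:
  fixes f :: "'a::euclidean_space \<Rightarrow> real"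
  assumes "continuous_on UNIV f"
  shows "integrable lborel (\<lambda>\<xi>. indicator (ball 0 r) \<xi> * f \<xi>)"
proof (rule Bochner_Integration.integrable_bound)
  show "integrable lborel (\<lambda>\<xi>. indicator (cball 0 r) \<xi> *\<^sub>R f \<xi>)"
    by (intro borel_integrable_compact) (use assms continuous_on_subset in auto)
  have [measurable]: "f \<in> borel_measurable borel" by (rule borel_measurable_continuous_onI[OF assms])
  show "(\<lambda>\<xi>. indicator (ball 0 r) \<xi> * f \<xi>) \<in> borel_measurable lborel" by measurable
qed (auto simp: indicator_def)

lemma ball_odd_integral:
  fixes v :: "'a::euclidean_space"
  shows "(LINT \<xi>|lborel. indicator (ball 0 r) \<xi> * (\<xi> \<bullet> v)) = (0::real)"
proof -
  have "(LINT \<xi>|lborel. indicator (ball 0 r) \<xi> * (\<xi> \<bullet> v)) = (LINT \<xi>|lborel. indicator (ball 0 r) (- \<xi>) * ((- \<xi>) \<bullet> v))"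
    by (rule lborel_integral_uminus[symmetric]) measurable
  also have "\<dots> = (LINT \<xi>|lborel. - (indicator (ball 0 r) \<xi> * (\<xi> \<bullet> v)))"
    by (intro Bochner_Integration.integral_cong refl) (simp add: indicator_def)
  also have "\<dots> = - (LINT \<xi>|lborel. indicator (ball 0 r) \<xi> * (\<xi> \<bullet> v))" by (rule integral_minus)
  finally show ?thesis by simp
qed

text \<open>Write \<open>r\<^sup>2 - \<bar>\<xi>\<bar>\<^sup>2\<close> as the integral of \<open>2 t\<close> over \<open>\<bar>\<xi>\<bar> \<le> t \<le> r\<close> and exchange the integrals: the inner one
  becomes the volume of the ball of radius \<open>t\<close>.\<close>

lemma ball_second_moment:
  assumes r: "0 \<le> r"
  shows "(LINT \<xi>|lborel. indicator (ball 0 r) \<xi> * (norm (\<xi> :: 'a::euclidean_space))\<^sup>2)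
    = real DIM('a) / (real DIM('a) + 2) * (unit_ball_vol (real DIM('a)) * r ^ (DIM('a) + 2))"
proof -
  let ?d = "DIM('a)" and ?w = "unit_ball_vol (real DIM('a))"
  have w: "0 \<le> ?w" by simp
  have inner: "(\<integral>\<^sup>+t. ennreal (2 * t) * indicator {norm \<xi>..r} t \<partial>lborel) = ennreal (indicator (ball 0 r) \<xi> * (r\<^sup>2 - (norm \<xi>)\<^sup>2))" for \<xi> :: 'a
  proof (cases "norm \<xi> \<le> r")
    case True
    have "(\<integral>\<^sup>+t. ennreal (2 * t) * indicator {norm \<xi>..r} t \<partial>lborel) = ennreal (r\<^sup>2 - (norm \<xi>)\<^sup>2)"
    proof (rule nn_integral_FTC_Icc[where F = "\<lambda>t. t\<^sup>2"])
      fix t assume "t \<in> {norm \<xi>..r}"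
      then show "0 \<le> 2 * t" by (auto intro: order_trans[OF norm_ge_zero])
    qed (use True in \<open>auto intro!: derivative_eq_intros\<close>)
    also have "r\<^sup>2 - (norm \<xi>)\<^sup>2 = indicator (ball 0 r) \<xi> * (r\<^sup>2 - (norm \<xi>)\<^sup>2)"
      using True by (cases "norm \<xi> = r") (auto simp: indicator_def)
    finally show ?thesis .
  qed (simp add: indicator_def)
  have "(\<integral>\<^sup>+\<xi>. ennreal (indicator (ball 0 r) \<xi> * (r\<^sup>2 - (norm (\<xi>::'a))\<^sup>2)) \<partial>lborel)
      = (\<integral>\<^sup>+\<xi>. (\<integral>\<^sup>+t. ennreal (2 * t) * indicator {norm \<xi>..r} t \<partial>lborel) \<partial>(lborel :: 'a measure))" by (simp only: inner)
  also have "\<dots> = (\<integral>\<^sup>+t. (\<integral>\<^sup>+\<xi>. ennreal (2 * t) * indicator {norm \<xi>..r} t \<partial>(lborel :: 'a measure)) \<partial>lborel)"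
  proof (rule lborel_pair.Fubini')
    have "(\<lambda>p::real \<times> 'a. ennreal (2 * fst p) * indicator {p. norm (snd p) \<le> fst p \<and> fst p \<le> r} p) \<in> borel_measurable (borel \<Otimes>\<^sub>M borel)"
      by measurable
    also have "(\<lambda>p::real \<times> 'a. ennreal (2 * fst p) * indicator {p. norm (snd p) \<le> fst p \<and> fst p \<le> r} p)
       = (\<lambda>(t, \<xi>). ennreal (2 * t) * indicator {norm \<xi>..r} t)" by (auto simp: indicator_def fun_eq_iff)
    finally show "(\<lambda>(t, \<xi>::'a). ennreal (2 * t) * indicator {norm \<xi>..r} t) \<in> borel_measurable (lborel \<Otimes>\<^sub>M lborel)"
      by (simp cong: measurable_cong_sets)
  qed
  also have "\<dots> = (\<integral>\<^sup>+t. ennreal (2 * ?w * t ^ (?d + 1)) * indicator {0..r} t \<partial>lborel)"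
  proof (rule nn_integral_cong)
    fix t :: real
    show "(\<integral>\<^sup>+\<xi>. ennreal (2 * t) * indicator {norm \<xi>..r} t \<partial>(lborel :: 'a measure)) = ennreal (2 * ?w * t ^ (?d + 1)) * indicator {0..r} t"
    proof (cases "t \<in> {0..r}")
      case True
      have "(\<integral>\<^sup>+\<xi>. ennreal (2 * t) * indicator {norm \<xi>..r} t \<partial>(lborel :: 'a measure)) = (\<integral>\<^sup>+\<xi>. ennreal (2 * t) * indicator (cball 0 t) \<xi> \<partial>(lborel :: 'a measure))"
        using True by (intro nn_integral_cong) (auto simp: indicator_def)
      also have "\<dots> = ennreal (2 * t) * emeasure lborel (cball (0::'a) t)" by (rule nn_integral_cmult_indicator) simp
      also have "\<dots> = ennreal (2 * t * (?w * t ^ ?d))" using True by (simp add: emeasure_cball ennreal_mult')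
      finally show ?thesis using True by (simp add: mult_ac)
    next
      case False
      then have "indicator {norm \<xi>..r} t = (0 :: ennreal)" for \<xi> :: 'a
        using order_trans[OF norm_ge_zero[of \<xi>], of t] by (auto simp: indicator_def)
      then show ?thesis using False by simp
    qed
  qed
  also have "\<dots> = ennreal (2 * ?w / (real ?d + 2) * r ^ (?d + 2) - 2 * ?w / (real ?d + 2) * 0 ^ (?d + 2))"
  proof (rule nn_integral_FTC_Icc)
    fix t :: real assume t: "t \<in> {0..r}"
    then show "0 \<le> 2 * ?w * t ^ (?d + 1)" by simp
    have "((\<lambda>t. 2 * ?w / (real ?d + 2) * t ^ (?d + 2)) has_real_derivative 2 * ?w / (real ?d + 2) * (real (?d + 2) * t ^ (?d + 1))) (at t)"
      using DERIV_pow[of "?d + 2" t] by (intro DERIV_cmult) simp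
    moreover have "2 * ?w / (real ?d + 2) * (real (?d + 2) * t ^ (?d + 1)) = 2 * ?w * t ^ (?d + 1)" by (simp add: field_simps)
    ultimately show "((\<lambda>t. 2 * ?w / (real ?d + 2) * t ^ (?d + 2)) has_real_derivative 2 * ?w * t ^ (?d + 1)) (at t)" by simp
  qed (use r in auto)
  finally have nn: "(\<integral>\<^sup>+\<xi>. ennreal (indicator (ball 0 r) \<xi> * (r\<^sup>2 - (norm (\<xi>::'a))\<^sup>2)) \<partial>lborel) = ennreal (2 * ?w / (real ?d + 2) * r ^ (?d + 2))" by simp
  have "(LINT \<xi>|lborel. indicator (ball 0 r) \<xi> * (r\<^sup>2 - (norm (\<xi>::'a))\<^sup>2)) = 2 * ?w / (real ?d + 2) * r ^ (?d + 2)"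
  proof (subst integral_eq_nn_integral)
    show "AE \<xi> in lborel. 0 \<le> indicator (ball 0 r) \<xi> * (r\<^sup>2 - (norm (\<xi>::'a))\<^sup>2)"
      by (intro AE_I2) (auto simp: indicator_def intro!: power_mono)
  qed (use r in \<open>simp_all add: nn\<close>)
  moreover have "(LINT \<xi>|lborel. indicator (ball 0 r) \<xi> * (r\<^sup>2 - (norm (\<xi>::'a))\<^sup>2))
      = r\<^sup>2 * (?w * r ^ ?d) - (LINT \<xi>|lborel. indicator (ball 0 r) \<xi> * (norm (\<xi>::'a))\<^sup>2)"
  proof -
    have "(LINT \<xi>|lborel. indicator (ball 0 r) \<xi> * (r\<^sup>2 - (norm (\<xi>::'a))\<^sup>2))
      = (LINT \<xi>|lborel. indicator (ball 0 r) \<xi> * r\<^sup>2 - indicator (ball 0 r) \<xi> * (norm (\<xi>::'a))\<^sup>2)"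
      by (simp only: right_diff_distrib)
    also have "\<dots> = (LINT \<xi>|lborel. indicator (ball (0::'a) r) \<xi> * r\<^sup>2) - (LINT \<xi>|lborel. indicator (ball 0 r) \<xi> * (norm (\<xi>::'a))\<^sup>2)"
      by (intro Bochner_Integration.integral_diff integrable_on_ball continuous_intros)
    finally show ?thesis using r by (simp add: content_ball mult.commute)
  qed
  ultimately have "(LINT \<xi>|lborel. indicator (ball 0 r) \<xi> * (norm (\<xi>::'a))\<^sup>2) = r\<^sup>2 * (?w * r ^ ?d) - 2 * ?w / (real ?d + 2) * r ^ (?d + 2)"
    by simp
  also have "\<dots> = real ?d / (real ?d + 2) * (?w * r ^ (?d + 2))"
  proof -
    have "real ?d + 2 \<noteq> 0" by simp
    then show ?thesis by (simp add: field_simps power_add power2_eq_square)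
  qed
  finally show ?thesis .
qed

section \<open>Averaging over plane waves\<close>

text \<open>Without the hypotheses on the form the graph would be empty and would have no resolvent.\<close>

lemma compact_resolvent_imp_form_operator_resolvent:
  fixes M :: "'a measure"
  assumes cr: "compact_resolvent M (form_operator M D q)"
  shows "\<exists>c. form_operator_resolvent M D q c (form_operator M D q)"
proof -
  let ?T = "form_operator M D q"
  have "(\<lambda>x::'a. 0 :: complex) \<in> L2 M" by (rule L2.zero_mem)
  then have "?T \<noteq> {}" using cr unfolding compact_resolvent_def by fastforce
  then have conds: "quadratic_form_on M D q" "semibounded_form M D q" "closable_form M D q"
    and T_eq: "?T = {(U, F). U \<in> closure_dom M D q \<and> F \<in> L2 M \<and>
                    (\<forall>W\<in>closure_dom M D q. closure_form M D q U W = L2_inner M F W)}"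
    unfolding form_operator_def by (auto split: if_splits)
  obtain c where c: "\<And>u. u \<in> D \<Longrightarrow> c * (LINT x|M. (cmod (u x))\<^sup>2) \<le> q u"
    using conds(2) unfolding semibounded_form_def by blast
  have D_L2: "D \<subseteq> L2 M" using conds(1) unfolding quadratic_form_on_def by blast
  have "form_operator_resolvent M D q (\<bar>c\<bar> + 1) ?T"
  proof
    show "- (\<bar>c\<bar> + 1) * L2.nsq M u \<le> q u" if u: "u \<in> D" for u
    proof -
      have "0 \<le> L2.nsq M u" using D_L2 u by auto
      then have "- (\<bar>c\<bar> + 1) * L2.nsq M u \<le> c * L2.nsq M u" by (intro mult_right_mono) auto
      then show ?thesis using c[OF u] by (simp add: L2_nsq_eq)
    qed
    show "(U, F) \<in> ?T \<longleftrightarrow> U \<in> closure_dom M D q \<and> F \<in> L2 M \<and>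
        (\<forall>W\<in>closure_dom M D q. closure_form M D q U W = L2_inner M F W)" for U F
      unfolding T_eq by simp
  qed (use conds cr in auto)
  then show ?thesis by blast
qed

lemma open_measure_pos:
  fixes \<Omega> :: "'a::euclidean_space set"
  assumes "open \<Omega>" "bounded \<Omega>" "\<Omega> \<noteq> {}"
  shows "0 < measure lebesgue \<Omega>"
proof -
  have "\<Omega> \<in> lmeasurable" using assms by (intro lmeasurable_open)
  moreover have "\<not> negligible \<Omega>" using assms open_not_negligible by blast
  ultimately have "measure lebesgue \<Omega> \<noteq> 0" by (simp add: negligible_iff_measure)
  then show ?thesis using measure_nonneg[of lebesgue \<Omega>] by linarith
qed

text \<open>Integrate the hypothesis over the ball of radius \<open>r\<close>, where \<open>r\<close> is such that \<open>k (2\<pi>)\<^sup>d\<close> is the fraction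
  \<open>2 / (d + 2)\<close> of the product of \<open>Vol \<Omega>\<close> with the volume of the ball. Then the fraction \<open>d / (d + 2)\<close> remains
  on the left side, the same factor as in the second moment of the ball, and \<open>r\<^sup>2\<close> appears with coefficient one.\<close>

lemma kroeger_averaging:
  fixes \<Omega> :: "(real ^ 'n) set" and v :: "real ^ 'n"
  assumes \<Omega>: "open \<Omega>" "bounded \<Omega>" "\<Omega> \<noteq> {}" and k: "k \<ge> 1" and lam: "0 \<le> lam"
    and U: "finite U" "U \<subseteq> L2 (lebesgue_on \<Omega>)" "card U \<le> k" "\<forall>u\<in>U. L2.nsq (lebesgue_on \<Omega>) u = 1"
    and le: "\<And>\<xi>. lam * (measure lebesgue \<Omega> - (\<Sum>u\<in>U. (cmod (L2_inner (lebesgue_on \<Omega>) (plane_wave \<xi>) u))\<^sup>2))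
      \<le> (norm \<xi>)\<^sup>2 * measure lebesgue \<Omega> - 2 * (\<xi> \<bullet> v) + a"
  shows "lam \<le> (real CARD('n) + 2) / (real CARD('n) * measure lebesgue \<Omega>) * a + kroeger_const \<Omega> k"
proof -
  let ?d = "CARD('n)" and ?M = "lebesgue_on \<Omega>"
  define vol where "vol = measure lebesgue \<Omega>"
  define w where "w = measure lebesgue (ball (0 :: real ^ 'n) 1)"
  have d0: "real ?d > 0" by simp
  have w_eq: "w = unit_ball_vol (real ?d)" unfolding w_def by (simp add: content_ball)
  have w0: "w > 0" unfolding w_eq by simp
  have vol0: "vol > 0" unfolding vol_def by (rule open_measure_pos[OF \<Omega>])
  \<comment> \<open>\<open>r\<close> is determined by \<open>r\<^sup>d = (2\<pi>)\<^sup>d s\<close>.\<close>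
  define s where "s = (real ?d + 2) / 2 * (real k / (w * vol))"
  have s0: "s > 0" unfolding s_def using w0 vol0 k d0 by (intro mult_pos_pos divide_pos_pos) auto
  define r where "r = 2 * pi * s powr (1 / real ?d)"
  have r0: "r > 0" unfolding r_def using s0 by simp
  have r_d: "r ^ ?d = (2 * pi) ^ ?d * s"
  proof -
    have "(s powr (1 / real ?d)) ^ ?d = s powr (1 / real ?d * real ?d)"
      using s0 by (simp add: powr_realpow[symmetric] powr_powr)
    then show ?thesis using s0 by (simp add: r_def power_mult_distrib)
  qed
  have r_2: "r\<^sup>2 = kroeger_const \<Omega> k"
  proof -
    have "(s powr (1 / real ?d))\<^sup>2 = s powr (2 / real ?d)"
      using s0 by (simp add: powr_realpow[symmetric] powr_powr power2_eq_square powr_add[symmetric])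
    also have "\<dots> = ((real ?d + 2) / 2) powr (2 / real ?d) * (real k / (w * vol)) powr (2 / real ?d)"
      unfolding s_def using w0 vol0 by (intro powr_mult)
    finally show ?thesis
      by (simp add: r_def power_mult_distrib kroeger_const_def Let_def w_def vol_def)
  qed
  let ?B = "\<lambda>\<xi> :: real ^ 'n. indicator (ball 0 r) \<xi> :: real"
  let ?c = "\<lambda>u \<xi>. (cmod (L2_inner ?M (plane_wave \<xi>) u))\<^sup>2"
  have intB: "integrable lborel ?B" using integrable_on_ball[of "\<lambda>_::real^'n. 1" r] by simp
  have intc: "integrable lborel (\<lambda>\<xi>. ?B \<xi> * ?c u \<xi>)" if "u \<in> U" for u
    using U(2) that by (intro plane_wave_bessel(1) \<Omega>) auto
  have int2: "integrable lborel (\<lambda>\<xi>. ?B \<xi> * (norm \<xi>)\<^sup>2)" "integrable lborel (\<lambda>\<xi>. ?B \<xi> * (\<xi> \<bullet> v))"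
    by (intro integrable_on_ball continuous_intros)+
  have volB: "measure lborel (ball (0 :: real ^ 'n) r) = w * r ^ ?d"
    using r0 by (simp add: content_ball w_eq)
  have lhs: "(LINT \<xi>|lborel. lam * (vol * ?B \<xi> - (\<Sum>u\<in>U. ?B \<xi> * ?c u \<xi>)))
      = lam * (vol * (w * r ^ ?d) - (\<Sum>u\<in>U. (LINT \<xi>|lborel. ?B \<xi> * ?c u \<xi>)))"
    using intB intc by (simp add: volB)
  have rhs: "(LINT \<xi>|lborel. vol * (?B \<xi> * (norm \<xi>)\<^sup>2) - 2 * (?B \<xi> * (\<xi> \<bullet> v)) + a * ?B \<xi>)
      = vol * (real ?d / (real ?d + 2) * (w * r ^ (?d + 2))) + a * (w * r ^ ?d)"
  proof -
    have "(LINT \<xi>|lborel. ?B \<xi> * (norm \<xi>)\<^sup>2) = real ?d / (real ?d + 2) * (w * r ^ (?d + 2))"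
      using ball_second_moment[where 'a = "real ^ 'n", of r] r0 by (simp add: w_eq)
    then show ?thesis using intB int2 by (simp add: volB ball_odd_integral)
  qed
  have "(LINT \<xi>|lborel. lam * (vol * ?B \<xi> - (\<Sum>u\<in>U. ?B \<xi> * ?c u \<xi>)))
      \<le> (LINT \<xi>|lborel. vol * (?B \<xi> * (norm \<xi>)\<^sup>2) - 2 * (?B \<xi> * (\<xi> \<bullet> v)) + a * ?B \<xi>)"
  proof (rule integral_mono)
    show "integrable lborel (\<lambda>\<xi>. lam * (vol * ?B \<xi> - (\<Sum>u\<in>U. ?B \<xi> * ?c u \<xi>)))"
      by (intro integrable_mult_right Bochner_Integration.integrable_diff Bochner_Integration.integrable_sum intB intc)
    show "integrable lborel (\<lambda>\<xi>. vol * (?B \<xi> * (norm \<xi>)\<^sup>2) - 2 * (?B \<xi> * (\<xi> \<bullet> v)) + a * ?B \<xi>)"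
      by (intro integrable_mult_right Bochner_Integration.integrable_diff Bochner_Integration.integrable_add intB int2)
    show "lam * (vol * ?B \<xi> - (\<Sum>u\<in>U. ?B \<xi> * ?c u \<xi>)) \<le> vol * (?B \<xi> * (norm \<xi>)\<^sup>2) - 2 * (?B \<xi> * (\<xi> \<bullet> v)) + a * ?B \<xi>" for \<xi>
      using le[of \<xi>] by (cases "\<xi> \<in> ball 0 r") (simp_all add: vol_def mult.commute)
  qed
  then have 1: "lam * (vol * (w * r ^ ?d) - (\<Sum>u\<in>U. (LINT \<xi>|lborel. ?B \<xi> * ?c u \<xi>)))
      \<le> vol * (real ?d / (real ?d + 2) * (w * r ^ (?d + 2))) + a * (w * r ^ ?d)"
    unfolding lhs rhs .
  have "(\<Sum>u\<in>U. (LINT \<xi>|lborel. ?B \<xi> * ?c u \<xi>)) \<le> (\<Sum>u\<in>U. (2 * pi) ^ ?d)"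
  proof (rule sum_mono)
    fix u assume u: "u \<in> U"
    then have "u \<in> L2 ?M" "L2.nsq ?M u = 1" using U by auto
    then show "(LINT \<xi>|lborel. ?B \<xi> * ?c u \<xi>) \<le> (2 * pi) ^ ?d"
      using plane_wave_bessel(2)[OF \<Omega>(1,2), of u r] by simp
  qed
  also have "\<dots> \<le> real k * (2 * pi) ^ ?d" using U(3) by (simp add: mult_right_mono)
  also have "\<dots> = 2 / (real ?d + 2) * (vol * (w * r ^ ?d))"
  proof -
    have "real k * x = 2 / y * (vol * (w * (x * (y / 2 * (real k / (w * vol))))))" if "y > 0" for x y :: real
      using w0 vol0 that by (simp add: field_simps)
    from this[of "real ?d + 2"] show ?thesis unfolding r_d s_def by simp
  qed
  finally have "lam * (vol * (w * r ^ ?d) - 2 / (real ?d + 2) * (vol * (w * r ^ ?d)))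
      \<le> lam * (vol * (w * r ^ ?d) - (\<Sum>u\<in>U. (LINT \<xi>|lborel. ?B \<xi> * ?c u \<xi>)))"
    using lam by (intro mult_left_mono) auto
  also note 1
  also have "vol * (real ?d / (real ?d + 2) * (w * r ^ (?d + 2))) + a * (w * r ^ ?d)
      = (w * r ^ ?d) * (vol * (real ?d / (real ?d + 2)) * r\<^sup>2 + a)"
    by (simp add: power_add power2_eq_square algebra_simps)
  also have "lam * (vol * (w * r ^ ?d) - 2 / (real ?d + 2) * (vol * (w * r ^ ?d)))
      = (w * r ^ ?d) * (vol * (real ?d / (real ?d + 2)) * lam)"
  proof -
    have "1 - 2 / (real ?d + 2) = real ?d / (real ?d + 2)" by (simp add: field_simps)
    moreover have "lam * (vol * (w * r ^ ?d) - 2 / (real ?d + 2) * (vol * (w * r ^ ?d)))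
      = (w * r ^ ?d) * (vol * (1 - 2 / (real ?d + 2)) * lam)" by (simp add: algebra_simps)
    ultimately show ?thesis by simp
  qed
  finally have "vol * (real ?d / (real ?d + 2)) * lam \<le> vol * (real ?d / (real ?d + 2)) * r\<^sup>2 + a"
    by (rule mult_left_le_imp_le) (use w0 r0 in simp)
  moreover have "0 < vol * (real ?d / (real ?d + 2))" using vol0 d0 by simp
  moreover have "x \<le> y + a / z" if "z * x \<le> z * y + a" "0 < z" for x y z :: real
    using that by (simp add: field_simps)
  ultimately have "lam \<le> r\<^sup>2 + a / (vol * (real ?d / (real ?d + 2)))" by blast
  also have "a / (vol * (real ?d / (real ?d + 2))) = (real ?d + 2) / (real ?d * vol) * a"
    using vol0 d0 by (simp add: field_simps)
  finally show ?thesis unfolding r_2 vol_def by simp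
qed

theorem theorem3p5:
  fixes \<Omega> :: "(real ^ 'n) set"
    and A :: "real ^ 'n \<Rightarrow> real ^ 'n"
    and V \<sigma> :: "real ^ 'n \<Rightarrow> real"
    and ev :: "nat \<Rightarrow> real"
    and k :: nat
  assumes dim: "CARD('n) \<ge> 2"
    and region: "open \<Omega>" "connected \<Omega>" "\<Omega> \<noteq> {}" "bounded \<Omega>" "smooth_boundary \<Omega>"
    and A: "A \<in> L2_loc \<Omega>"
    and V: "V \<in> L1_loc \<Omega>" "AE x in lebesgue_on \<Omega>. 0 \<le> V x"
    and sigma: "\<sigma> \<in> Linfinity (surface_measure \<Omega>)" "AE x in surface_measure \<Omega>. \<sigma> x < 0"
    and resolvent: "compact_resolvent (lebesgue_on \<Omega>) (robin_operator \<Omega> A V \<sigma>)"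
    and ev: "eigenvalue_enumeration (lebesgue_on \<Omega>) (robin_operator \<Omega> A V \<sigma>) ev"
    and ev_pos: "0 < ev 1" "ev 1 < ev 2"
    and k: "k \<ge> 1"
  shows "ennreal (ev (k + 1)) \<le>
    ennreal ((real CARD('n) + 2) / (real CARD('n) * measure lebesgue \<Omega>))
      * (L2_norm2 (lebesgue_on \<Omega>) A + L1_norm (lebesgue_on \<Omega>) V)
    + ennreal (kroeger_const \<Omega> k)"
proof (cases "L2_norm2 (lebesgue_on \<Omega>) A = \<infinity> \<or> L1_norm (lebesgue_on \<Omega>) V = \<infinity>")
  case True
  have "measure lebesgue \<Omega> > 0" by (rule open_measure_pos[OF region(1,4,3)])
  then have "0 < (real CARD('n) + 2) / (real CARD('n) * measure lebesgue \<Omega>)" by simp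
  then have nz: "ennreal ((real CARD('n) + 2) / (real CARD('n) * measure lebesgue \<Omega>)) \<noteq> 0"
    by (simp only: ennreal_eq_0_iff not_le)
  have sum_top: "L2_norm2 (lebesgue_on \<Omega>) A + L1_norm (lebesgue_on \<Omega>) V = top" using True by auto
  show ?thesis unfolding sum_top ennreal_mult_top using nz by (simp only: if_False) simp
next
  case False
  let ?M = "lebesgue_on \<Omega>"
  have A_L2: "A \<in> L2 ?M"
  proof -
    have "A \<in> borel_measurable ?M" using A by (simp add: L2_loc_def)
    moreover have "integrable ?M (\<lambda>x. (norm (A x))\<^sup>2)"
      using False \<open>A \<in> borel_measurable ?M\<close>
      by (intro integrableI_nonneg) (auto simp: L2_norm2_def less_top)
    ultimately show ?thesis by (simp add: L2_def)
  qed
  have V_int: "integrable ?M V"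
  proof -
    have "V \<in> borel_measurable ?M" using V(1) by (simp add: L1_loc_def)
    then show ?thesis using False by (intro integrableI_bounded) (auto simp: L1_norm_def less_top)
  qed
  define a1 where "a1 = (LINT x|?M. (norm (A x))\<^sup>2)"
  define a2 where "a2 = (LINT x|?M. V x)"
  have a1: "L2_norm2 ?M A = ennreal a1" "0 \<le> a1"
    using A_L2 unfolding L2_norm2_def a1_def L2_def by (auto intro: nn_integral_eq_integral)
  have a2: "L1_norm ?M V = ennreal a2" "0 \<le> a2"
  proof -
    have "L1_norm ?M V = (\<integral>\<^sup>+x. ennreal (V x) \<partial>?M)"
      unfolding L1_norm_def using V(2) by (intro nn_integral_cong_AE) auto
    also have "\<dots> = ennreal a2" unfolding a2_def by (rule nn_integral_eq_integral[OF V_int V(2)])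
    finally show "L1_norm ?M V = ennreal a2" .
    show "0 \<le> a2" unfolding a2_def by (rule integral_nonneg_AE[OF V(2)])
  qed
  obtain c where "form_operator_resolvent ?M (robin_form_domain \<Omega> A V) (robin_form \<Omega> A V \<sigma>) c (robin_operator \<Omega> A V \<sigma>)"
    using compact_resolvent_imp_form_operator_resolvent resolvent unfolding robin_operator_def by blast
  then interpret T: form_operator_resolvent ?M "robin_form_domain \<Omega> A V" "robin_form \<Omega> A V \<sigma>" c "robin_operator \<Omega> A V \<sigma>" .
  obtain U where U: "finite U" "U \<subseteq> L2 ?M" "card U \<le> k" "\<forall>u\<in>U. L2.nsq ?M u = 1"
    and var: "\<And>e. e \<in> robin_form_domain \<Omega> A V \<Longrightarrow>
      ev (k + 1) * (L2.nsq ?M e - (\<Sum>u\<in>U. (cmod (L2_inner ?M e u))\<^sup>2)) \<le> robin_form \<Omega> A V \<sigma> e"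
    using T.kroeger_variational_bound[OF ev ev_pos(1), of k] by blast
  have "ev 1 \<le> ev (k + 1)" using ev unfolding eigenvalue_enumeration_def by simp
  then have lam: "0 \<le> ev (k + 1)" using ev_pos(1) by linarith
  have "ev (k + 1) \<le> (real CARD('n) + 2) / (real CARD('n) * measure lebesgue \<Omega>) * (a1 + a2) + kroeger_const \<Omega> k"
  proof (rule kroeger_averaging[OF region(1,4,3) k lam U])
    fix \<xi>
    show "ev (k + 1) * (measure lebesgue \<Omega> - (\<Sum>u\<in>U. (cmod (L2_inner ?M (plane_wave \<xi>) u))\<^sup>2))
        \<le> (norm \<xi>)\<^sup>2 * measure lebesgue \<Omega> - 2 * (\<xi> \<bullet> (LINT x|?M. A x)) + (a1 + a2)"
      using var[OF plane_wave_form_domain[OF region(1,4) A_L2 V_int V(2), of \<xi>]]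
        robin_form_plane_wave_le[OF region(1,4) A_L2 V_int V(2) sigma(2), of \<xi>]
        nsq_plane_wave[OF region(1,4) A_L2 V_int V(2), of \<xi>]
      by (simp add: a1_def a2_def)
  qed
  moreover have "0 \<le> kroeger_const \<Omega> k" by (simp add: kroeger_const_def Let_def)
  moreover have "0 \<le> (real CARD('n) + 2) / (real CARD('n) * measure lebesgue \<Omega>)" by simp
  ultimately show ?thesis
    unfolding a1(1) a2(1) using a1(2) a2(2)
    by (simp add: ennreal_plus[symmetric] ennreal_mult'[symmetric] ennreal_leI del: ennreal_plus)
qed

end
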